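(* Let $f\in\widetilde{\mathcal{B}}$. Then for every $N\in\mathbb{N}_0$, every real $\lambda>-1$ and every $z\in\mathcal{U}$, $$f(z)=\frac{(-2i)^N\,\Gamma(1+\lambda)}{\Gamma(1+\lambda+N)}\;\widetilde{\mathcal{P}_\lambda}\big(\boldsymbol{\rho}^N\,\mathcal{L}_n^N f\big)(z),$$ where $\boldsymbol{\rho}^N\mathcal{L}_n^N f$ denotes the function $w\mapsto\boldsymbol{\rho}(w)^N(\mathcal{L}_n^Nf)(w)$.
   Context: Let $n$ be a positive integer; write $z=(z',z_n)\in\mathbb{C}^n$ with $z'=(z_1,\dots,z_{n-1})\in\mathbb{C}^{n-1}$, $z_n\in\mathbb{C}$. Put $\boldsymbol{\rho}(z)=\operatorname{Im}z_n-|z'|^2$ and $\mathcal{U}=\{z\in\mathbb{C}^n:\boldsymbol{\rho}(z)>0\}$ (Siegel upper half-space). Let $\mathbf{i}=(0',i)$ and $\boldsymbol{\rho}(z,w)=\frac{i}{2}(\overline{w}_n-z_n)-z'\cdot\overline{w'}$, where $z'\cdot\overline{w'}=\sum_{j<n}z_j\overline{w}_j$. For $z,w\in\mathcal{U}$ this has positive real part, and real powers of it are principal branch. $\mathbb{N}_0$ is the set of nonnegative integers and $dV$ is Lebesgue measure on $\mathbb{C}^n$. For $\lambda>-1$: $dV_\lambda(z)=c_\lambda\boldsymbol{\rho}(z)^\lambda dV(z)$ with $c_\lambda=\frac{\Gamma(n+1+\lambda)}{4\pi^n\Gamma(1+\lambda)}$; $K_\lambda(z,w)=\boldsymbol{\rho}(z,w)^{-(n+1+\lambda)}$;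 $\widetilde{K_\lambda}(z,w)=K_\lambda(z,w)-K_\lambda(\mathbf{i},w)$; and $\widetilde{\mathcal{P}_\lambda}f(z)=\int_{\mathcal{U}}\widetilde{K_\lambda}(z,w)f(w)\,dV_\lambda(w)$, whenever the integral converges absolutely. Let $\mathcal{L}_j=\partial_j+2i\overline{z}_j\partial_n$ for $1\le j\le n-1$ and $\mathcal{L}_n=\partial_n$, where $\partial_j=\partial/\partial z_j$ is the holomorphic partial derivative. For $f$ holomorphic on $\mathcal{U}$ let $|\widetilde{\nabla}f|=\big(2\boldsymbol{\rho}\sum_{j=1}^{n-1}|\mathcal{L}_jf|^2+8\boldsymbol{\rho}^2|\mathcal{L}_nf|^2\big)^{1/2}$ and $\|f\|_{\mathcal{B}}=\sup_{z\in\mathcal{U}}|\widetilde{\nabla}f(z)|$. $\widetilde{\mathcal{B}}$ is the space of holomorphic $f$ on $\mathcal{U}$ with $\|f\|_{\mathcal{B}}<\infty$ and $f(\mathbf{i})=0$. *)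

theory Defs
  imports "HOL-Analysis.Analysis"
begin

text \<open>
  \<open>\<complex>\<^sup>n\<close> is \<^typ>\<open>complex ^ 'n\<close> for a finite linearly ordered index type, with \<open>n = CARD('n) \<ge> 1\<close>.
  The largest index plays the role of \<open>n\<close>; the indices below it, of which there may be none, are
  those of \<open>z'\<close>.
\<close>

definition top_idx :: "'n::{finite,linorder}" where
  "top_idx = Max UNIV"

definition rho :: "complex ^ 'n::{finite,linorder} \<Rightarrow> real" where
  "rho z = Im (z $ top_idx) - (\<Sum>j\<in>{..<top_idx}. (cmod (z $ j))\<^sup>2)"

definition siegel :: "(complex ^ 'n::{finite,linorder}) set" where
  "siegel = {z. rho z > 0}"

definition base_pt :: "complex ^ 'n::{finite,linorder}" where
  "base_pt = axis top_idx \<i>"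

definition rho2 :: "complex ^ 'n::{finite,linorder} \<Rightarrow> complex ^ 'n::{finite,linorder} \<Rightarrow> complex" where
  "rho2 z w = \<i> / 2 * (cnj (w $ top_idx) - z $ top_idx) - (\<Sum>j\<in>{..<top_idx}. z $ j * cnj (w $ j))"

definition c_const :: "nat \<Rightarrow> real \<Rightarrow> real" where
  "c_const n l = Gamma (real n + 1 + l) / (4 * pi ^ n * Gamma (1 + l))"

definition dV :: "real \<Rightarrow> (complex ^ 'n::{finite,linorder}) measure" where
  "dV l = density (lebesgue_on siegel) (\<lambda>w. ennreal (c_const CARD('n) l * rho w powr l))"

text \<open>The complex \<open>powr\<close> is the principal branch.\<close>

definition kern :: "real \<Rightarrow> complex ^ 'n::{finite,linorder} \<Rightarrow> complex ^ 'n::{finite,linorder} \<Rightarrow> complex" where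
  "kern l z w = rho2 z w powr complex_of_real (- (real CARD('n) + 1 + l))"

definition kern_mod :: "real \<Rightarrow> complex ^ 'n::{finite,linorder} \<Rightarrow> complex ^ 'n::{finite,linorder} \<Rightarrow> complex" where
  "kern_mod l z w = kern l z w - kern l base_pt w"

text \<open>
  The integral of a non-integrable function is \<open>0\<close> by convention, so \<open>P_mod l f z\<close> has its
  mathematical meaning only where \<open>P_mod_converges l f z\<close> holds.
\<close>

definition P_mod_converges ::
    "real \<Rightarrow> (complex ^ 'n::{finite,linorder} \<Rightarrow> complex) \<Rightarrow> complex ^ 'n::{finite,linorder} \<Rightarrow> bool" where
  "P_mod_converges l f z \<longleftrightarrow> integrable (dV l) (\<lambda>w. kern_mod l z w * f w)"

definition P_mod ::
    "real \<Rightarrow> (complex ^ 'n::{finite,linorder} \<Rightarrow> complex) \<Rightarrow> complex ^ 'n::{finite,linorder} \<Rightarrow> complex" where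
  "P_mod l f z = (LINT w|dV l. kern_mod l z w * f w)"

text \<open>Holomorphy in several variables: complex-linear Frechet derivative at every point.\<close>

definition holo_on :: "(complex ^ 'n \<Rightarrow> complex) \<Rightarrow> (complex ^ 'n) set \<Rightarrow> bool" where
  "holo_on f S \<longleftrightarrow>
     (\<forall>z\<in>S. \<exists>D. (f has_derivative D) (at z) \<and> (\<forall>c v. D (c *s v) = c * D v))"

definition pd :: "'n::finite \<Rightarrow> (complex ^ 'n \<Rightarrow> complex) \<Rightarrow> complex ^ 'n \<Rightarrow> complex" where
  "pd j f z = deriv (\<lambda>t. f (z + axis j t)) 0"

definition Lop ::
    "'n::{finite,linorder} \<Rightarrow> (complex ^ 'n::{finite,linorder} \<Rightarrow> complex) \<Rightarrow> complex ^ 'n::{finite,linorder} \<Rightarrow> complex" where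
  "Lop j f z =
     (if j = top_idx then pd top_idx f z
      else pd j f z + 2 * \<i> * cnj (z $ j) * pd top_idx f z)"

definition grad_norm :: "(complex ^ 'n::{finite,linorder} \<Rightarrow> complex) \<Rightarrow> complex ^ 'n::{finite,linorder} \<Rightarrow> real" where
  "grad_norm f z =
     sqrt (2 * rho z * (\<Sum>j\<in>{..<top_idx}. (cmod (Lop j f z))\<^sup>2)
           + 8 * (rho z)\<^sup>2 * (cmod (Lop top_idx f z))\<^sup>2)"

definition bloch_norm :: "(complex ^ 'n::{finite,linorder} \<Rightarrow> complex) \<Rightarrow> ennreal" where
  "bloch_norm f = (SUP z\<in>siegel. ennreal (grad_norm f z))"

definition bloch0 :: "(complex ^ 'n::{finite,linorder} \<Rightarrow> complex) set" where
  "bloch0 = {f. holo_on f siegel \<and> bloch_norm f < \<infinity> \<and> f base_pt = 0}"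

end

theory Submission
  imports Defs "HOL-Complex_Analysis.Complex_Analysis" "HOL-Probability.Distributions"
begin

text \<open>
  Fix \<open>z\<close> and write \<open>R w = rho2 z w\<close>, which is antiholomorphic in \<open>w\<close>. For each coordinate \<open>j\<close> the
  function \<open>(w $ j - z $ j) * rho w powr l * R w powr (- (n + 1 + l))\<close> is a combination of
  antiholomorphic derivatives of explicit functions: below the top index it comes from the tangential
  fields conjugate to \<open>Lop\<close>, which annihilate \<open>rho\<close>, and for the top index one uses
  \<open>w $ top_idx - z $ top_idx = - 2 * \<i> * (R w - rho w - (\<Sum>k. (w $ k - z $ k) * cnj (w $ k)))\<close>. It is therefore
  orthogonal to rapidly decaying holomorphic functions. As the half-space is convex, \<open>g\<close> can be contracted
  to the constant \<open>g z\<close> along \<open>g (z + t *\<^sub>R (w - z))\<close> without changing the integral of \<open>g * m\<close> against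
  the kernel; exchanging the roles of \<open>g\<close> and \<open>m\<close> gives the reproducing formula up to a constant, which
  does not depend on \<open>z\<close> because the kernel is Hermitian, and which at \<open>base_pt\<close> is a Gamma integral.

  For \<open>f\<close> in the Bloch space the formula is applied to \<open>f\<close> times a damping factor at \<open>z\<close> and at
  \<open>base_pt\<close>; the difference of kernels gains half an order of decay, which beats the logarithmic growth of
  \<open>f\<close> and allows the damping to be removed. Integration by parts in the top coordinate passes
  from \<open>N\<close> to \<open>N + 1\<close>.
\<close>

section \<open>Holomorphic functions of several variables\<close>

text \<open>The kernel decays like \<open>wt\<close> to the power \<open>- (n + 1 + l)\<close>, and
  against the weight \<open>rho powr l\<close> this is the very exponent at which absolute
  integrability over the half-space fails. A Bloch function therefore cannot be paired with a single
  kernel. Subtracting the kernel at \<open>base_pt\<close> gains only half an order, not a whole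
  one, because the tangential coordinates still grow like the square root of \<open>wt\<close>.
  Hence the estimates are inequalities between two exponents, one for the boundary and one for
  infinity, with a small loss \<delta> standing in for the logarithm. At the boundary the obstacle
  is that \<open>l\<close> may be close to -1, so integrands extended by zero are not even
  continuous. They are regularised by a factor that vanishes two orders faster and is removed by
  dominated convergence. Exchanging two holomorphic factors takes the place of a density argument:
  either of them may be contracted to \<open>z\<close>, and comparing the two results isolates the
  value at \<open>z\<close>. The decay orders 5, 8 and 9 make room for the coordinates and
  derivatives that accumulate on the way.\<close>

definition cdiff :: "(complex ^ 'n \<Rightarrow> complex) \<Rightarrow> complex ^ 'n \<Rightarrow> complex ^ 'n \<Rightarrow> complex" where
  "cdiff h x v = deriv (\<lambda>\<xi>. h (x + \<xi> *s v)) 0"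

lemma axis_eq_smult: "axis j (t::complex) = t *s axis j 1"
  by (simp add: vec_eq_iff axis_def)

lemma pd_eq_cdiff: "pd j h x = cdiff h x (axis j 1)"
  unfolding pd_def cdiff_def by (subst axis_eq_smult) simp

lemma norm_smult: "norm (\<xi> *s v) = cmod \<xi> * norm v" for v :: "complex ^ 'n"
  by (simp add: norm_vec_def L2_set_def norm_mult power_mult_distrib sum_distrib_left[symmetric]
      real_sqrt_mult)

lemma scaleR_eq_smult: "r *\<^sub>R v = complex_of_real r *s v" for v :: "complex ^ 'n"
  by (simp add: vec_eq_iff scaleR_conv_of_real[where 'a=complex])

lemma bounded_linear_smult_left: "bounded_linear (\<lambda>\<xi>. \<xi> *s v)" for v :: "complex ^ 'n"
  by (rule bounded_linear_intro[where K="norm v"])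
    (auto simp: vec_eq_iff algebra_simps norm_smult scaleR_conv_of_real[where 'a=complex])

lemma holo_onE:
  assumes "holo_on h S" "x \<in> S"
  obtains D where "(h has_derivative D) (at x)" "\<And>c v. D (c *s v) = c * D v"
  using assms unfolding holo_on_def by blast

lemma has_field_derivative_line:
  fixes h :: "complex ^ 'n::finite \<Rightarrow> complex"
  assumes "(h has_derivative D) (at (x + \<xi> *s v))" "\<And>c v. D (c *s v) = c * D v"
  shows "((\<lambda>\<xi>. h (x + \<xi> *s v)) has_field_derivative D v) (at \<xi>)"
proof -
  have "((\<lambda>\<xi>. x + \<xi> *s v) has_derivative (\<lambda>\<xi>. \<xi> *s v)) (at \<xi>)"
    using has_derivative_add[OF has_derivative_const
        bounded_linear_imp_has_derivative[OF bounded_linear_smult_left[of v]], of x] by simp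
  from has_derivative_compose[OF this assms(1)] show ?thesis
    unfolding has_field_derivative_def by (simp add: assms(2) mult_commute_abs)
qed

lemma cdiff_eqI:
  fixes h :: "complex ^ 'n::finite \<Rightarrow> complex"
  assumes "(h has_derivative D) (at x)" "\<And>c v. D (c *s v) = c * D v"
  shows "cdiff h x = D"
proof
  fix v
  have "((\<lambda>\<xi>. h (x + \<xi> *s v)) has_field_derivative D v) (at 0)"
    by (rule has_field_derivative_line) (use assms in auto)
  thus "cdiff h x v = D v" unfolding cdiff_def by (rule DERIV_imp_deriv)
qed

lemma holo_has_derivative:
  fixes h :: "complex ^ 'n::finite \<Rightarrow> complex"
  assumes "holo_on h S" "x \<in> S"
  shows "(h has_derivative cdiff h x) (at x)"
  using assms by (metis holo_onE cdiff_eqI)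

lemma cdiff_smult:
  fixes h :: "complex ^ 'n::finite \<Rightarrow> complex"
  assumes "holo_on h S" "x \<in> S"
  shows "cdiff h x (c *s v) = c * cdiff h x v"
  using assms by (metis holo_onE cdiff_eqI)

lemma cdiff_eq_sum_pd:
  fixes h :: "complex ^ 'n::finite \<Rightarrow> complex"
  assumes "holo_on h S" "x \<in> S"
  shows "cdiff h x v = (\<Sum>j\<in>UNIV. v $ j * pd j h x)"
proof -
  interpret bounded_linear "cdiff h x"
    using holo_has_derivative[OF assms] by (rule has_derivative_bounded_linear)
  have "v = (\<Sum>j\<in>UNIV. v $ j *s axis j 1)"
    by (simp add: vec_eq_iff axis_def if_distrib[where f="\<lambda>x. _ * x"] cong: if_cong)
  hence "cdiff h x v = (\<Sum>j\<in>UNIV. cdiff h x (v $ j *s axis j 1))"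
    by (metis sum)
  thus ?thesis by (simp add: cdiff_smult[OF assms] pd_eq_cdiff)
qed

lemma holo_line_deriv:
  fixes h :: "complex ^ 'n::finite \<Rightarrow> complex"
  assumes "holo_on h S" "x + \<xi> *s v \<in> S"
  shows "((\<lambda>\<xi>. h (x + \<xi> *s v)) has_field_derivative cdiff h (x + \<xi> *s v) v) (at \<xi>)"
  by (rule has_field_derivative_line) (use holo_has_derivative[OF assms] cdiff_smult[OF assms] in auto)

lemma holo_continuous_on: "holo_on h S \<Longrightarrow> continuous_on S h"
  for h :: "complex ^ 'n::finite \<Rightarrow> complex"
  by (meson continuous_at_imp_continuous_on has_derivative_continuous holo_has_derivative)

lemma cauchy_line:
  fixes h :: "complex ^ 'n::finite \<Rightarrow> complex"
  assumes "holo_on h S" "0 < r" "\<And>\<xi>. cmod \<xi> \<le> r \<Longrightarrow> x + \<xi> *s v \<in> S"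
    and "\<And>\<xi>. cmod \<xi> \<le> r \<Longrightarrow> cmod (h (x + \<xi> *s v)) \<le> B"
  shows "cmod (cdiff h x v) \<le> B / r"
proof -
  let ?\<phi> = "\<lambda>\<xi>. h (x + \<xi> *s v)"
  have d: "(?\<phi> has_field_derivative cdiff h (x + \<xi> *s v) v) (at \<xi>)" if "cmod \<xi> \<le> r" for \<xi>
    by (rule holo_line_deriv[OF assms(1)]) (use assms(3) that in auto)
  have "cmod ((deriv ^^ 1) ?\<phi> 0) \<le> fact 1 * B / r ^ 1"
  proof (rule Cauchy_inequality)
    show "?\<phi> holomorphic_on ball 0 r"
      by (auto simp: holomorphic_on_open intro!: exI d)
    show "continuous_on (cball 0 r) ?\<phi>"
      by (intro continuous_at_imp_continuous_on) (auto intro!: DERIV_isCont d)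
  qed (use assms in auto)
  thus ?thesis using d[of 0] assms(2) by (auto simp: cdiff_def)
qed

text \<open>Cauchy's inequality on discs of radius \<open>R / 4\<close> bounds the second derivative
  by \<open>2 * M * 16 / R\<^sup>2\<close>, whence the 32; two mean value estimates do the rest. The
  constant depends on \<open>\<phi>\<close> only through \<open>M\<close>, so the estimate is
  uniform when \<open>\<phi>\<close> runs over the restrictions of one function to parallel
  lines.\<close>

lemma taylor1_bound:
  assumes hol: "\<phi> holomorphic_on ball 0 R" and M: "\<And>\<xi>. \<xi> \<in> ball 0 R \<Longrightarrow> cmod (\<phi> \<xi>) \<le> M"
    and \<xi>: "cmod \<xi> < R / 2"
  shows "cmod (\<phi> \<xi> - \<phi> 0 - deriv \<phi> 0 * \<xi>) \<le> 32 * M / R\<^sup>2 * (cmod \<xi>)\<^sup>2"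
proof -
  have R: "R > 0" using \<xi> by (smt (verit) field_sum_of_halves norm_ge_zero)
  define B where "B = 32 * M / R\<^sup>2"
  have M0: "M \<ge> 0" using M[of 0] R by (smt (verit) centre_in_ball norm_ge_zero)
  have d1: "(\<phi> has_field_derivative deriv \<phi> x) (at x)" if "cmod x < R" for x
    using hol that by (auto simp: holomorphic_derivI)
  have d2: "(deriv \<phi> has_field_derivative deriv (deriv \<phi>) x) (at x)" if "cmod x < R" for x
    using holomorphic_deriv[OF hol] that by (auto simp: holomorphic_derivI)
  have b2: "cmod (deriv (deriv \<phi>) x) \<le> B" if "cmod x < R / 2" for x
  proof -
    have sub: "cball x (R/4) \<subseteq> ball 0 R"
    proof
      fix y assume "y \<in> cball x (R/4)"
      hence "cmod (y - x) \<le> R / 4" by (simp add: dist_norm norm_minus_commute)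
      thus "y \<in> ball 0 R" using that R norm_triangle_sub[of y x] by simp
    qed
    have "cmod ((deriv ^^ 2) \<phi> x) \<le> fact 2 * M / (R / 4) ^ 2"
    proof (rule Cauchy_inequality)
      show "\<phi> holomorphic_on ball x (R/4)"
        using sub ball_subset_cball by (blast intro: holomorphic_on_subset[OF hol])
      show "continuous_on (cball x (R/4)) \<phi>"
        using sub by (blast intro: continuous_on_subset[OF holomorphic_on_imp_continuous_on[OF hol]])
      show "cmod (\<phi> y) \<le> M" if "cmod (x - y) = R / 4" for y
        by (rule M) (use that sub in \<open>auto simp: dist_norm\<close>)
    qed (use R in auto)
    thus ?thesis unfolding B_def by (simp add: numeral_2_eq_2 field_simps)
  qed
  have b1: "cmod (deriv \<phi> x - deriv \<phi> 0) \<le> B * cmod x" if "cmod x < R / 2" for x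
  proof -
    have "cmod (deriv \<phi> x - deriv \<phi> 0) \<le> B * cmod (x - 0)"
      by (rule field_differentiable_bound[where S="ball 0 (R/2)" and f'="deriv (deriv \<phi>)"])
        (use that R in \<open>auto intro!: has_field_derivative_at_within[OF d2] b2\<close>)
    thus ?thesis by simp
  qed
  have "cmod ((\<phi> \<xi> - deriv \<phi> 0 * \<xi>) - (\<phi> 0 - deriv \<phi> 0 * 0)) \<le> B * cmod \<xi> * cmod (\<xi> - 0)"
  proof (rule field_differentiable_bound[where S="cball 0 (cmod \<xi>)" and f'="\<lambda>x. deriv \<phi> x - deriv \<phi> 0"])
    fix x :: complex assume x: "x \<in> cball 0 (cmod \<xi>)"
    show "((\<lambda>x. \<phi> x - deriv \<phi> 0 * x) has_field_derivative deriv \<phi> x - deriv \<phi> 0) (at x within cball 0 (cmod \<xi>))"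
      by (auto intro!: derivative_eq_intros has_field_derivative_at_within[OF d1]) (use x \<xi> R in auto)
    have "cmod (deriv \<phi> x - deriv \<phi> 0) \<le> B * cmod x" by (rule b1) (use x \<xi> in auto)
    also have "\<dots> \<le> B * cmod \<xi>" using x M0 by (intro mult_left_mono) (auto simp: B_def)
    finally show "cmod (deriv \<phi> x - deriv \<phi> 0) \<le> B * cmod \<xi>" .
  qed auto
  thus ?thesis by (simp add: B_def power2_eq_square algebra_simps)
qed

text \<open>The difference quotients of \<open>h\<close> in direction \<open>v\<close> converge locally uniformly, and so do their
  derivatives by Cauchy's estimate.\<close>

lemma holo_on_cdiff:
  fixes h :: "complex ^ 'n::finite \<Rightarrow> complex"
  assumes hol: "holo_on h S" and S: "open S"
  shows "holo_on (\<lambda>x. cdiff h x v) S"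
  unfolding holo_on_def
proof
  fix x0 assume x0: "x0 \<in> S"
  obtain e where e: "e > 0" "cball x0 e \<subseteq> S" using S x0 open_contains_cball by blast
  have "compact (h ` cball x0 e)"
    by (intro compact_continuous_image continuous_on_subset[OF holo_continuous_on[OF hol]] e) auto
  then obtain M where M: "\<And>x. x \<in> cball x0 e \<Longrightarrow> cmod (h x) \<le> M"
    using compact_imp_bounded bounded_iff by (metis image_eqI)
  \<comment> \<open>A quarter of the radius leaves room for two moves: points within
    \<open>3 * \<delta>\<close> may be shifted by \<open>\<xi> *s v\<close>, and points within
    \<open>\<delta>\<close> may first be moved by \<open>\<delta>\<close> in a direction
    \<open>w\<close>, without leaving \<open>cball x0 e\<close>.\<close>
  define \<delta> where "\<delta> = e / 4"
  define R where "R = \<delta> / (norm v + 1)"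
  have \<delta>: "\<delta> > 0" using e by (simp add: \<delta>_def)
  have R: "R > 0" using \<delta> by (simp add: R_def add_nonneg_pos)
  have Rv: "cmod \<xi> * norm v \<le> \<delta>" if "cmod \<xi> \<le> R" for \<xi>
  proof -
    have "cmod \<xi> * norm v \<le> R * (norm v + 1)" using that R by (intro mult_mono) auto
    also have "\<dots> = \<delta>" unfolding R_def by (simp add: add_nonneg_eq_0_iff)
    finally show ?thesis .
  qed
  have in_S: "x + \<xi> *s v \<in> cball x0 e" if "x \<in> ball x0 (3*\<delta>)" "cmod \<xi> \<le> R" for x \<xi>
  proof -
    have "norm (x + \<xi> *s v - x0) \<le> norm (x - x0) + norm (\<xi> *s v)"
      using norm_triangle_ineq[of "x - x0" "\<xi> *s v"] by (simp add: algebra_simps)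
    also have "\<dots> \<le> 3 * \<delta> + \<delta>"
      using that Rv[OF that(2)] by (auto simp: norm_smult dist_norm norm_minus_commute)
    finally show ?thesis by (simp add: \<delta>_def dist_norm norm_minus_commute)
  qed
  define s where "s k = complex_of_real (R / (4 * (real k + 1)))" for k :: nat
  have s_norm: "cmod (s k) = R / (4 * (real k + 1))" for k
    using R by (simp add: s_def norm_divide norm_mult del: of_real_divide)
  have s0: "s k \<noteq> 0" for k using R s_norm[of k] by (auto simp del: s_def)
  have s_le: "cmod (s k) < R / 2" for k
    unfolding s_norm using R by (simp add: field_simps) (smt (verit) mult_nonneg_nonneg of_nat_0_le_iff)
  define qf where "qf k x = (h (x + s k *s v) - h x) / s k" for k x
  define C where "C = 32 * M / R\<^sup>2"
  have M0: "M \<ge> 0" using M[of x0] e by (smt (verit) centre_in_cball norm_ge_zero)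
  have C0: "C \<ge> 0" using M0 by (simp add: C_def)
  have q1: "cmod (qf k x - cdiff h x v) \<le> C * cmod (s k)" if "x \<in> ball x0 (3*\<delta>)" for k x
  proof -
    let ?\<phi> = "\<lambda>\<xi>. h (x + \<xi> *s v)"
    have "cmod (?\<phi> (s k) - ?\<phi> 0 - deriv ?\<phi> 0 * s k) \<le> 32 * M / R\<^sup>2 * (cmod (s k))\<^sup>2"
    proof (rule taylor1_bound)
      have "(?\<phi> has_field_derivative cdiff h (x + \<xi> *s v) v) (at \<xi>)" if "cmod \<xi> \<le> R" for \<xi>
        by (rule holo_line_deriv[OF hol]) (use in_S that \<open>x \<in> _\<close> e in blast)
      thus "?\<phi> holomorphic_on ball 0 R" by (force simp: holomorphic_on_open)
      show "cmod (?\<phi> \<xi>) \<le> M" if "\<xi> \<in> ball 0 R" for \<xi>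
        by (rule M, rule in_S) (use that \<open>x \<in> _\<close> in auto)
    qed (rule s_le)
    moreover have "(qf k x - cdiff h x v) * s k = ?\<phi> (s k) - ?\<phi> 0 - deriv ?\<phi> 0 * s k"
    proof -
      have "qf k x * s k = ?\<phi> (s k) - ?\<phi> 0" using s0[of k] by (simp add: qf_def)
      thus ?thesis by (simp add: cdiff_def left_diff_distrib)
    qed
    ultimately have "cmod ((qf k x - cdiff h x v) * s k) \<le> C * (cmod (s k))\<^sup>2"
      by (simp add: C_def)
    thus ?thesis using s0[of k] by (simp add: norm_mult power2_eq_square)
  qed
  define Q where "Q k x w = (cdiff h (x + s k *s v) w - cdiff h x w) / s k" for k x w
  have qd: "(qf k has_derivative Q k x) (at x)" "Q k x (c *s w) = c * Q k x w"
    if "x \<in> ball x0 (3*\<delta>)" for k x c w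
  proof -
    have 1: "x + s k *s v \<in> S" using in_S[OF that, of "s k"] s_le[of k] R e by (auto simp: less_imp_le)
    have 2: "x \<in> S" using in_S[OF that, of 0] R e by auto
    have "((\<lambda>y. h (y + s k *s v)) has_derivative cdiff h (x + s k *s v)) (at x)"
    proof (rule has_derivative_compose[where f="\<lambda>y. y + s k *s v" and f'="\<lambda>w. w"])
      show "((\<lambda>y. y + s k *s v) has_derivative (\<lambda>w. w)) (at x)"
        by (rule has_derivative_add_const) (rule has_derivative_ident)
    qed (rule holo_has_derivative[OF hol 1])
    thus "(qf k has_derivative Q k x) (at x)"
      unfolding qf_def[abs_def] Q_def[abs_def] using s0
      by (auto intro!: derivative_eq_intros holo_has_derivative[OF hol 2] simp: divide_inverse)
    show "Q k x (c *s w) = c * Q k x w"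
      by (simp add: Q_def cdiff_smult[OF hol 1] cdiff_smult[OF hol 2] algebra_simps diff_divide_distrib)
  qed
  have holq: "holo_on (\<lambda>x. qf k x - qf m x) (ball x0 (3*\<delta>))" for k m
    unfolding holo_on_def
    by (intro ballI exI[of _ "\<lambda>w. Q k _ w - Q m _ w"] conjI)
      (auto intro!: derivative_eq_intros qd simp: qd(2) algebra_simps)
  have Qc: "cmod (Q k x w - Q m x w) \<le> C * (cmod (s k) + cmod (s m)) / \<delta> * norm w"
    if "x \<in> ball x0 \<delta>" for k m x w
  proof (cases "w = 0")
    case True
    thus ?thesis by (simp add: Q_def cdiff_def)
  next
    case False
    have x3: "x \<in> ball x0 (3*\<delta>)" using that \<delta> by auto
    have b: "x + \<xi> *s w \<in> ball x0 (3*\<delta>)" if "cmod \<xi> \<le> \<delta> / norm w" for \<xi>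
    proof -
      have "norm (x + \<xi> *s w - x0) \<le> norm (x - x0) + norm (\<xi> *s w)"
        using norm_triangle_ineq[of "x - x0" "\<xi> *s w"] by (simp add: algebra_simps)
      also have "\<dots> \<le> norm (x - x0) + \<delta>"
        using that False by (simp add: norm_smult field_simps)
      also have "\<dots> < 3 * \<delta>" using \<open>x \<in> ball x0 \<delta>\<close> \<delta> by (simp add: dist_norm norm_minus_commute)
      finally show ?thesis by (simp add: dist_norm norm_minus_commute)
    qed
    have "cdiff (\<lambda>x. qf k x - qf m x) x = (\<lambda>w. Q k x w - Q m x w)"
      by (rule cdiff_eqI) (auto intro!: derivative_eq_intros qd x3 simp: qd(2)[OF x3] algebra_simps)
    moreover have "cmod (cdiff (\<lambda>x. qf k x - qf m x) x w) \<le> C * (cmod (s k) + cmod (s m)) / (\<delta> / norm w)"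
    proof (rule cauchy_line[OF holq])
      fix \<xi> assume "cmod \<xi> \<le> \<delta> / norm w"
      note x = b[OF this]
      show "x + \<xi> *s w \<in> ball x0 (3*\<delta>)" by (rule x)
      let ?x = "x + \<xi> *s w"
      have "cmod (qf k ?x - qf m ?x) \<le> cmod (qf k ?x - cdiff h ?x v) + cmod (qf m ?x - cdiff h ?x v)"
        using norm_triangle_ineq4[of "qf k ?x - cdiff h ?x v" "qf m ?x - cdiff h ?x v"] by simp
      thus "cmod (qf k ?x - qf m ?x) \<le> C * (cmod (s k) + cmod (s m))"
        using q1[OF x, of k] q1[OF x, of m] by (simp add: algebra_simps)
    qed (use \<delta> False in auto)
    ultimately show ?thesis using False \<delta> by (simp add: field_simps)
  qed
  have s_lim: "(\<lambda>k. cmod (s k)) \<longlonglongrightarrow> 0"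
    unfolding s_norm by real_asymp
  have Cau: "Cauchy (\<lambda>k. Q k x w)" if x: "x \<in> ball x0 \<delta>" for x w
  proof (rule metric_CauchyI)
    fix \<epsilon> :: real assume "\<epsilon> > 0"
    have "(\<lambda>k. C * (2 * cmod (s k)) / \<delta> * norm w) \<longlonglongrightarrow> C * (2 * 0) / \<delta> * norm w"
      by (intro tendsto_intros s_lim) (use \<delta> in auto)
    hence "eventually (\<lambda>k. C * (2 * cmod (s k)) / \<delta> * norm w < \<epsilon>) sequentially"
      using \<open>\<epsilon> > 0\<close> by (auto dest: order_tendstoD(2))
    then obtain N where N: "C * (2 * cmod (s N)) / \<delta> * norm w < \<epsilon>"
      using eventually_happens'[OF sequentially_bot] by blast
    have mono: "cmod (s m) \<le> cmod (s N)" if "m \<ge> N" for m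
      unfolding s_norm using that R by (intro divide_left_mono) auto
    show "\<exists>N. \<forall>m\<ge>N. \<forall>n\<ge>N. dist (Q m x w) (Q n x w) < \<epsilon>"
    proof (intro exI allI impI)
      fix m n assume "N \<le> m" "N \<le> n"
      have "dist (Q m x w) (Q n x w) \<le> C * (cmod (s m) + cmod (s n)) / \<delta> * norm w"
        using Qc[OF x] by (simp add: dist_norm)
      also have "\<dots> \<le> C * (2 * cmod (s N)) / \<delta> * norm w"
        using mono[OF \<open>N \<le> m\<close>] mono[OF \<open>N \<le> n\<close>] C0 \<delta>
        by (intro mult_right_mono divide_right_mono mult_left_mono) auto
      finally show "dist (Q m x w) (Q n x w) < \<epsilon>" using N by simp
    qed
  qed
  define g where "g x w = lim (\<lambda>k. Q k x w)" for x w
  have Qg: "(\<lambda>k. Q k x w) \<longlonglongrightarrow> g x w" if "x \<in> ball x0 \<delta>" for x w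
    using Cau[OF that] by (simp add: Cauchy_convergent_iff convergent_LIMSEQ_iff g_def)
  have Qg': "cmod (Q k x w - g x w) \<le> C * cmod (s k) / \<delta> * norm w" if x: "x \<in> ball x0 \<delta>" for k x w
  proof (rule tendsto_le[OF sequentially_bot])
    show "(\<lambda>m. cmod (Q k x w - Q m x w)) \<longlonglongrightarrow> cmod (Q k x w - g x w)"
      by (intro tendsto_intros Qg x)
    have "(\<lambda>m. C * (cmod (s k) + cmod (s m)) / \<delta> * norm w) \<longlonglongrightarrow> C * (cmod (s k) + 0) / \<delta> * norm w"
      by (intro tendsto_intros s_lim) (use \<delta> in auto)
    thus "(\<lambda>m. C * (cmod (s k) + cmod (s m)) / \<delta> * norm w) \<longlonglongrightarrow> C * cmod (s k) / \<delta> * norm w" by simp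
    show "\<forall>\<^sub>F m in sequentially. cmod (Q k x w - Q m x w) \<le> C * (cmod (s k) + cmod (s m)) / \<delta> * norm w"
      by (intro always_eventually allI Qc x)
  qed
  have qlim: "(\<lambda>k. qf k x) \<longlonglongrightarrow> cdiff h x v" if "x \<in> ball x0 \<delta>" for x
  proof (rule LIM_zero_cancel, rule tendsto_norm_zero_cancel, rule tendsto_sandwich[OF _ _ tendsto_const])
    have "(\<lambda>k. C * cmod (s k)) \<longlonglongrightarrow> C * 0" by (intro tendsto_intros s_lim)
    thus "(\<lambda>k. C * cmod (s k)) \<longlonglongrightarrow> 0" by simp
    show "\<forall>\<^sub>F k in sequentially. cmod (qf k x - cdiff h x v) \<le> C * cmod (s k)"
      by (intro always_eventually allI q1) (use that \<delta> in auto)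
  qed auto
  \<comment> \<open>The derivatives have to converge uniformly relative to \<open>norm w\<close>;
    this is why the Cauchy estimate above uses a disc of radius
    \<open>\<delta> / norm w\<close>.\<close>
  have "\<exists>G. \<forall>x\<in>ball x0 \<delta>. (\<lambda>k. qf k x) \<longlonglongrightarrow> G x \<and> (G has_derivative g x) (at x within ball x0 \<delta>)"
  proof (rule has_derivative_sequence[where f=qf and f'=Q and ?x0.0=x0 and l="cdiff h x0 v"])
    show "x0 \<in> ball x0 \<delta>" using \<delta> by simp
    show "(\<lambda>k. qf k x0) \<longlonglongrightarrow> cdiff h x0 v" by (rule qlim) (use \<delta> in auto)
    fix \<epsilon> :: real assume "\<epsilon> > 0"
    have "(\<lambda>k. C * cmod (s k) / \<delta>) \<longlonglongrightarrow> C * 0 / \<delta>"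
      by (intro tendsto_intros s_lim) (use \<delta> in auto)
    hence "eventually (\<lambda>k. C * cmod (s k) / \<delta> < \<epsilon>) sequentially"
      using \<open>\<epsilon> > 0\<close> by (auto dest: order_tendstoD(2))
    thus "\<forall>\<^sub>F k in sequentially. \<forall>x\<in>ball x0 \<delta>. \<forall>w. cmod (Q k x w - g x w) \<le> \<epsilon> * norm w"
    proof eventually_elim
      case (elim k)
      show ?case
      proof (intro ballI allI)
        fix x w assume "x \<in> ball x0 \<delta>"
        from Qg'[OF this] have "cmod (Q k x w - g x w) \<le> C * cmod (s k) / \<delta> * norm w" .
        also have "\<dots> \<le> \<epsilon> * norm w" using elim by (intro mult_right_mono) auto
        finally show "cmod (Q k x w - g x w) \<le> \<epsilon> * norm w" .
      qed
    qed
  next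
    show "(qf k has_derivative Q k x) (at x within ball x0 \<delta>)" if "x \<in> ball x0 \<delta>" for k x
      by (rule has_derivative_at_withinI, rule qd(1)) (use that \<delta> in auto)
    show "convex (ball x0 \<delta>)" by simp
  qed
  then obtain G where G': "\<forall>x\<in>ball x0 \<delta>. (\<lambda>k. qf k x) \<longlonglongrightarrow> G x \<and> (G has_derivative g x) (at x within ball x0 \<delta>)"
    by (elim exE)
  have G: "(\<lambda>k. qf k x) \<longlonglongrightarrow> G x" "(G has_derivative g x) (at x within ball x0 \<delta>)"
    if "x \<in> ball x0 \<delta>" for x
    using bspec[OF G' that] by simp_all
  have Geq: "G x = cdiff h x v" if "x \<in> ball x0 \<delta>" for x
    using G(1)[OF that] qlim[OF that] LIMSEQ_unique by blast
  have x0': "x0 \<in> ball x0 \<delta>" using \<delta> by simp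
  have "(G has_derivative g x0) (at x0)"
    using G(2)[OF x0'] x0' at_within_open[of x0 "ball x0 \<delta>"] by simp
  hence "((\<lambda>x. cdiff h x v) has_derivative g x0) (at x0)"
    using has_derivative_transform_within_open[of G "g x0" x0 UNIV "ball x0 \<delta>"] x0' Geq by auto
  moreover have "g x0 (c *s w) = c * g x0 w" for c w
  proof (rule LIMSEQ_unique[OF Qg[OF x0']])
    have "(\<lambda>k. c * Q k x0 w) \<longlonglongrightarrow> c * g x0 w" by (intro tendsto_intros Qg x0')
    moreover have "Q k x0 (c *s w) = c * Q k x0 w" for k by (rule qd) (use \<delta> in auto)
    ultimately show "(\<lambda>k. Q k x0 (c *s w)) \<longlonglongrightarrow> c * g x0 w" by simp
  qed
  ultimately show "\<exists>D. ((\<lambda>x. cdiff h x v) has_derivative D) (at x0) \<and> (\<forall>c v. D (c *s v) = c * D v)"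
    by blast
qed

lemma holo_on_pd:
  fixes h :: "complex ^ 'n::finite \<Rightarrow> complex"
  assumes "holo_on h S" "open S" shows "holo_on (pd j h) S"
  using holo_on_cdiff[OF assms, of "axis j 1"] by (simp add: pd_eq_cdiff[abs_def])

section \<open>Integrals over the Siegel half-space\<close>

lemma nn_integral_translate:
  fixes c :: "'a::euclidean_space"
  assumes [measurable]: "f \<in> borel_measurable borel"
  shows "(\<integral>\<^sup>+x. f (x + c) \<partial>lborel) = (\<integral>\<^sup>+x. f x \<partial>lborel)"
proof -
  have "(\<integral>\<^sup>+x. f x \<partial>lborel) = (\<integral>\<^sup>+x. f x \<partial>distr lborel borel ((+) c))"
    by (simp add: lborel_distr_plus)
  also have "\<dots> = (\<integral>\<^sup>+x. f (x + c) \<partial>lborel)"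
    by (subst nn_integral_distr) (auto simp: add.commute)
  finally show ?thesis by simp
qed

lemma integral_translate:
  fixes c :: "'a::euclidean_space" and f :: "'a \<Rightarrow> 'b::{banach,second_countable_topology}"
  assumes [measurable]: "f \<in> borel_measurable borel"
  shows "(LINT x|lborel. f (x + c)) = (LINT x|lborel. f x)"
proof -
  have "(LINT x|lborel. f x) = (LINT x|distr lborel borel ((+) c). f x)"
    by (simp add: lborel_distr_plus)
  also have "\<dots> = (LINT x|lborel. f (x + c))"
    by (subst integral_distr) (auto simp: add.commute)
  finally show ?thesis by simp
qed

lemma integrable_translate:
  fixes c :: "'a::euclidean_space" and f :: "'a \<Rightarrow> 'b::{banach,second_countable_topology}"
  assumes "integrable lborel f"
  shows "integrable lborel (\<lambda>x. f (x + c))"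
proof -
  have "integrable (distr lborel borel ((+) c)) f"
    using assms by (simp add: lborel_distr_plus)
  thus ?thesis
    by (subst (asm) integrable_distr_eq) (use assms in \<open>auto simp: add.commute\<close>)
qed

lemma nn_integral_uminus_real:
  assumes [measurable]: "f \<in> borel_measurable borel"
  shows "(\<integral>\<^sup>+x. f (- x) \<partial>lborel) = (\<integral>\<^sup>+x. f x \<partial>(lborel :: real measure))"
  using nn_integral_real_affine[of f "-1" 0] by simp

text \<open>A Tonelli argument in a single real direction: it replaces the slicing of the space along the
  coordinate \<open>b\<close>.\<close>

lemma nn_integral_average_direction:
  fixes F :: "'a::euclidean_space \<Rightarrow> ennreal" and p :: "real \<Rightarrow> ennreal"
  assumes [measurable]: "F \<in> borel_measurable borel" "p \<in> borel_measurable borel"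
    and p: "(\<integral>\<^sup>+t. p t \<partial>lborel) = 1" and b: "b \<in> Basis"
  shows "(\<integral>\<^sup>+w. F w \<partial>lborel) = (\<integral>\<^sup>+w. p (w \<bullet> b) * (\<integral>\<^sup>+t. F (w + t *\<^sub>R b) \<partial>lborel) \<partial>lborel)"
proof -
  have 1: "(\<integral>\<^sup>+t. p (w \<bullet> b - t) \<partial>lborel) = 1" for w
    using nn_integral_uminus_real[of "\<lambda>t. p (t + w \<bullet> b)"] nn_integral_translate[of p "w \<bullet> b"] p
    by simp
  \<comment> \<open>The factor 1 is inserted as the integral of \<open>p (w \<bullet> b - t)\<close>
    over \<open>t\<close>. After the exchange of integrals, shifting \<open>w\<close> by
    \<open>t *\<^sub>R b\<close> moves \<open>t\<close> out of the argument of \<open>p\<close> and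
    into that of \<open>F\<close>, because \<open>b\<close> is a unit vector.\<close>
  have "(\<integral>\<^sup>+w. F w \<partial>lborel) = (\<integral>\<^sup>+w. (\<integral>\<^sup>+t. F w * p (w \<bullet> b - t) \<partial>lborel) \<partial>lborel)"
    by (simp add: nn_integral_cmult 1)
  also have "\<dots> = (\<integral>\<^sup>+t. (\<integral>\<^sup>+w. F w * p (w \<bullet> b - t) \<partial>lborel) \<partial>lborel)"
    by (rule lborel_pair.Fubini') measurable
  also have "\<dots> = (\<integral>\<^sup>+t. (\<integral>\<^sup>+w. F (w + t *\<^sub>R b) * p (w \<bullet> b) \<partial>lborel) \<partial>lborel)"
  proof (rule nn_integral_cong)
    fix t :: real
    show "(\<integral>\<^sup>+w. F w * p (w \<bullet> b - t) \<partial>lborel) = (\<integral>\<^sup>+w. F (w + t *\<^sub>R b) * p (w \<bullet> b) \<partial>lborel)"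
      by (subst nn_integral_translate[symmetric, where c="t *\<^sub>R b"])
        (auto simp: inner_add_left b)
  qed
  also have "\<dots> = (\<integral>\<^sup>+w. (\<integral>\<^sup>+t. F (w + t *\<^sub>R b) * p (w \<bullet> b) \<partial>lborel) \<partial>lborel)"
    by (rule lborel_pair.Fubini') measurable
  also have "\<dots> = (\<integral>\<^sup>+w. p (w \<bullet> b) * (\<integral>\<^sup>+t. F (w + t *\<^sub>R b) \<partial>lborel) \<partial>lborel)"
    by (simp add: nn_integral_multc mult.commute[of "p _"])
  finally show ?thesis .
qed

section \<open>Gamma, Gaussian and Cauchy-type integrals on the line\<close>

lemma nn_integral_gamma:
  assumes a: "a > 0" and c: "c > 0"
  shows "(\<integral>\<^sup>+t. ennreal (indicator {0<..} t * (t powr (a - 1) * exp (- c * t))) \<partial>lborel)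
    = ennreal (Gamma a * c powr - a)"
proof -
  let ?I = "\<integral>\<^sup>+t. ennreal (indicator {0<..} t * (t powr (a - 1) * exp (- c * t))) \<partial>lborel"
  have "ennreal (Gamma a) = (\<integral>\<^sup>+t. ennreal (indicator {0..} t * t powr (a - 1) / exp t) \<partial>lborel)"
    by (rule Gamma_conv_nn_integral_real[OF a])
  also have "\<dots> = ennreal \<bar>c\<bar> * (\<integral>\<^sup>+t. ennreal (indicator {0..} (0 + c * t) * (0 + c * t) powr (a - 1) / exp (0 + c * t)) \<partial>lborel)"
    by (rule nn_integral_real_affine) (use c in auto)
  also have "(\<integral>\<^sup>+t. ennreal (indicator {0..} (0 + c * t) * (0 + c * t) powr (a - 1) / exp (0 + c * t)) \<partial>lborel)
     = (\<integral>\<^sup>+t. ennreal (c powr (a - 1)) * ennreal (indicator {0<..} t * (t powr (a - 1) * exp (- c * t))) \<partial>lborel)"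
    by (intro nn_integral_cong)
      (use c in \<open>auto simp: ennreal_mult[symmetric] indicator_def powr_mult exp_minus field_simps mult_le_0_iff zero_le_mult_iff\<close>)
  also have "\<dots> = ennreal (c powr (a - 1)) * ?I" by (rule nn_integral_cmult) auto
  finally have eq: "ennreal (Gamma a) = ennreal (c powr a) * ?I"
    using c by (simp add: mult.assoc[symmetric] ennreal_mult[symmetric] powr_mult_base)
  have "?I = ennreal (c powr -a) * (ennreal (c powr a) * ?I)"
    using c by (simp add: mult.assoc[symmetric] ennreal_mult[symmetric] powr_add[symmetric])
  also have "\<dots> = ennreal (Gamma a * c powr - a)"
    using c a by (simp only: eq[symmetric]) (simp add: ennreal_mult[symmetric] mult.commute[of "Gamma a"] Gamma_real_pos less_imp_le)
  finally show ?thesis .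
qed

text \<open>A power of a sum does not split over the summands, but an exponential does. Writing
  negative powers as means of exponentials is what makes the later integrals factor over the
  coordinates.\<close>

lemma powr_conv_nn_integral:
  assumes "a > 0" "c > 0"
  shows "ennreal (c powr - a) = ennreal (1 / Gamma a) *
    (\<integral>\<^sup>+t. ennreal (indicator {0<..} t * (t powr (a - 1) * exp (- c * t))) \<partial>lborel)"
  using Gamma_real_pos[OF assms(1)] by (subst nn_integral_gamma[OF assms]) (simp add: ennreal_mult[symmetric])

lemma nn_integral_gauss:
  assumes "\<tau> > 0"
  shows "(\<integral>\<^sup>+x. ennreal (exp (- \<tau> * x\<^sup>2)) \<partial>lborel) = ennreal (sqrt (pi / \<tau>))"
proof -
  define s where "s = 1 / sqrt (2 * \<tau>)"
  have s: "s > 0" "s\<^sup>2 = 1 / (2 * \<tau>)" using assms by (auto simp: s_def power_divide)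
  have n: "(\<integral>\<^sup>+x. ennreal (normal_density 0 s x) \<partial>lborel) = 1"
    using s by (subst nn_integral_eq_integral) auto
  have "(\<integral>\<^sup>+x. ennreal (exp (- \<tau> * x\<^sup>2)) \<partial>lborel)
    = (\<integral>\<^sup>+x. ennreal (sqrt (pi / \<tau>)) * ennreal (normal_density 0 s x) \<partial>lborel)"
    using assms by (intro nn_integral_cong)
      (simp add: normal_density_def s ennreal_mult[symmetric] real_sqrt_divide)
  also have "\<dots> = ennreal (sqrt (pi / \<tau>))" by (subst nn_integral_cmult) (auto simp: n)
  finally show ?thesis .
qed

text \<open>Once the power is a Gamma mean of exponentials, the integral in \<open>x\<close> is
  Gaussian and costs half a power of \<open>t\<close>. The outer integral is again of Gamma type, at
  \<open>(\<sigma> - 1) / 2\<close>, and converges because \<open>\<sigma> > 1\<close>.\<close>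

lemma nn_integral_cauchy_powr:
  assumes b: "b > 0" and \<sigma>: "\<sigma> > 1"
  shows "(\<integral>\<^sup>+x. ennreal ((b\<^sup>2 + x\<^sup>2) powr (- \<sigma> / 2)) \<partial>lborel)
    = ennreal (sqrt pi * Gamma ((\<sigma> - 1) / 2) / Gamma (\<sigma> / 2) * b powr (1 - \<sigma>))"
proof -
  let ?a = "\<sigma> / 2"
  have G: "Gamma ?a > 0" "Gamma ((\<sigma> - 1) / 2) > 0" using \<sigma> by (auto intro!: Gamma_real_pos)
  have X: "b\<^sup>2 + x\<^sup>2 > 0" for x using b by (simp add: add_pos_nonneg)
  have "(\<integral>\<^sup>+x. ennreal ((b\<^sup>2 + x\<^sup>2) powr (- ?a)) \<partial>lborel) =
     (\<integral>\<^sup>+x. ennreal (1 / Gamma ?a) *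
    (\<integral>\<^sup>+t. ennreal (indicator {0<..} t * (t powr (?a - 1) * exp (- (b\<^sup>2 + x\<^sup>2) * t))) \<partial>lborel) \<partial>lborel)"
    using \<sigma> by (intro nn_integral_cong powr_conv_nn_integral X) auto
  also have "\<dots> = ennreal (1 / Gamma ?a) * (\<integral>\<^sup>+x. 
    (\<integral>\<^sup>+t. ennreal (indicator {0<..} t * (t powr (?a - 1) * exp (- (b\<^sup>2 + x\<^sup>2) * t))) \<partial>lborel) \<partial>lborel)"
    by (rule nn_integral_cmult) measurable
  also have "(\<integral>\<^sup>+x. 
    (\<integral>\<^sup>+t. ennreal (indicator {0<..} t * (t powr (?a - 1) * exp (- (b\<^sup>2 + x\<^sup>2) * t))) \<partial>lborel) \<partial>lborel)
    = (\<integral>\<^sup>+t. (\<integral>\<^sup>+x. ennreal (indicator {0<..} t * (t powr (?a - 1) * exp (- (b\<^sup>2 + x\<^sup>2) * t))) \<partial>lborel) \<partial>lborel)"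
    by (rule lborel_pair.Fubini') measurable
  also have "\<dots> = (\<integral>\<^sup>+t. ennreal (sqrt pi) * ennreal (indicator {0<..} t * (t powr ((\<sigma> - 1) / 2 - 1) * exp (- b\<^sup>2 * t))) \<partial>lborel)"
  proof (rule nn_integral_cong)
    fix t :: real
    show "(\<integral>\<^sup>+x. ennreal (indicator {0<..} t * (t powr (?a - 1) * exp (- (b\<^sup>2 + x\<^sup>2) * t))) \<partial>lborel)
      = ennreal (sqrt pi) * ennreal (indicator {0<..} t * (t powr ((\<sigma> - 1) / 2 - 1) * exp (- b\<^sup>2 * t)))"
    proof (cases "t > 0")
      case True
      have "(\<integral>\<^sup>+x. ennreal (indicator {0<..} t * (t powr (?a - 1) * exp (- (b\<^sup>2 + x\<^sup>2) * t))) \<partial>lborel)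
        = (\<integral>\<^sup>+x. ennreal (t powr (?a - 1) * exp (- b\<^sup>2 * t)) * ennreal (exp (- t * x\<^sup>2)) \<partial>lborel)"
        using True by (intro nn_integral_cong) (simp add: ennreal_mult[symmetric] mult_exp_exp algebra_simps)
      also have "\<dots> = ennreal (t powr (?a - 1) * exp (- b\<^sup>2 * t)) * ennreal (sqrt (pi / t))"
      proof -
        have "(\<integral>\<^sup>+x. ennreal (t powr (?a - 1) * exp (- b\<^sup>2 * t)) * ennreal (exp (- t * x\<^sup>2)) \<partial>lborel)
          = ennreal (t powr (?a - 1) * exp (- b\<^sup>2 * t)) * (\<integral>\<^sup>+x. ennreal (exp (- t * x\<^sup>2)) \<partial>lborel)"
          by (rule nn_integral_cmult) measurable
        thus ?thesis by (simp only: nn_integral_gauss[OF True])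
      qed
      also have "\<dots> = ennreal (sqrt pi) * ennreal (indicator {0<..} t * (t powr ((\<sigma> - 1) / 2 - 1) * exp (- b\<^sup>2 * t)))"
      proof -
        have "t powr (?a - 1) = t powr ((\<sigma> - 1) / 2 - 1) * sqrt t"
          using True by (simp add: powr_half_sqrt[symmetric] powr_add[symmetric] field_simps)
        thus ?thesis using True by (simp add: ennreal_mult[symmetric] real_sqrt_divide mult_ac)
      qed
      finally show ?thesis .
    qed auto
  qed
  also have "\<dots> = ennreal (sqrt pi) * ennreal (Gamma ((\<sigma> - 1) / 2) * (b\<^sup>2) powr - ((\<sigma> - 1) / 2))"
  proof -
    have "(\<integral>\<^sup>+t. ennreal (sqrt pi) * ennreal (indicator {0<..} t * (t powr ((\<sigma> - 1) / 2 - 1) * exp (- b\<^sup>2 * t))) \<partial>lborel)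
      = ennreal (sqrt pi) * (\<integral>\<^sup>+t. ennreal (indicator {0<..} t * (t powr ((\<sigma> - 1) / 2 - 1) * exp (- b\<^sup>2 * t))) \<partial>lborel)"
      by (rule nn_integral_cmult) measurable
    also have "(\<integral>\<^sup>+t. ennreal (indicator {0<..} t * (t powr ((\<sigma> - 1) / 2 - 1) * exp (- b\<^sup>2 * t))) \<partial>lborel)
      = ennreal (Gamma ((\<sigma> - 1) / 2) * (b\<^sup>2) powr - ((\<sigma> - 1) / 2))"
      by (rule nn_integral_gamma) (use \<sigma> b in auto)
    finally show ?thesis .
  qed
  also have "(b\<^sup>2) powr - ((\<sigma> - 1) / 2) = b powr (1 - \<sigma>)"
  proof -
    have "b\<^sup>2 = b powr 2" using b by simp
    moreover have "2 * - ((\<sigma> - 1) / 2) = 1 - \<sigma>" by (simp add: field_simps)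
    ultimately show ?thesis by (simp only: powr_powr)
  qed
  finally show ?thesis using G b
    by (simp add: ennreal_mult[symmetric] mult_ac)
qed

section \<open>Real coordinates, weights and measurability on the half-space\<close>

lemma UNIV_top_idx: "(UNIV :: 'n::{finite,linorder} set) = insert top_idx {..<top_idx}"
proof -
  have "i \<le> top_idx" for i :: 'n unfolding top_idx_def by (rule Max_ge) auto
  thus ?thesis by (auto simp: le_less)
qed

lemma card_below_top: "card {..<top_idx :: 'n::{finite,linorder}} = CARD('n) - 1"
proof -
  have "CARD('n) = Suc (card {..<top_idx :: 'n})"
    by (subst UNIV_top_idx) (subst card_insert_disjoint, auto)
  thus ?thesis by simp
qed

lemma below_top: "j \<noteq> top_idx \<longleftrightarrow> j < top_idx" for j :: "'n::{finite,linorder}"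
  using UNIV_top_idx[where 'n='n] by auto

lemma axis_complex_Basis: "axis i 1 \<in> (Basis :: (complex ^ 'n) set)" "axis i \<i> \<in> (Basis :: (complex ^ 'n) set)"
  by (auto simp: Basis_vec_def Basis_complex_def)

lemma inner_axis_complex: "w \<bullet> axis i 1 = Re (w $ i)" "w \<bullet> axis i \<i> = Im (w $ i)" for w :: "complex ^ 'n"
  by (simp_all add: inner_axis inner_complex_def)

lemma prod_Basis_complex_vec:
  fixes g :: "complex ^ 'n::finite \<Rightarrow> 'a::comm_monoid_mult"
  shows "(\<Prod>b\<in>Basis. g b) = (\<Prod>i\<in>UNIV. g (axis i 1) * g (axis i \<i>))"
proof -
  have B: "Basis = (\<lambda>(i, u). axis i u) ` (UNIV \<times> {1, \<i>} :: ('n \<times> complex) set)"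
    by (auto simp: Basis_vec_def Basis_complex_def)
  have "(\<Prod>b\<in>Basis. g b) = (\<Prod>(i, u)\<in>UNIV \<times> {1, \<i>}. g (axis i u))"
    unfolding B by (subst prod.reindex) (auto simp: inj_on_def axis_eq_axis case_prod_unfold)
  also have "\<dots> = (\<Prod>i\<in>UNIV. \<Prod>u\<in>{1, \<i>}. g (axis i u))"
    by (rule prod.cartesian_product[symmetric])
  finally show ?thesis by simp
qed

definition sqsum :: "complex ^ 'n::{finite,linorder} \<Rightarrow> real" where
  "sqsum w = (\<Sum>j\<in>{..<top_idx}. (cmod (w $ j))\<^sup>2)"

text \<open>Up to a factor 2 this is the modulus of \<open>rho2 w base_pt\<close> (see
  \<open>rho2_base_pt\<close>). It measures the size of a point: on the half-space it is at least 1
  and dominates \<open>rho\<close>, \<open>sqsum\<close> and every coordinate.\<close>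

definition wt :: "complex ^ 'n::{finite,linorder} \<Rightarrow> real" where
  "wt w = cmod (w $ top_idx + \<i>)"

lemma rho_eq: "rho w = Im (w $ top_idx) - sqsum w"
  by (simp add: rho_def sqsum_def)

lemma sqsum_nonneg [simp]: "sqsum w \<ge> 0"
  by (auto simp: sqsum_def intro!: sum_nonneg)

lemma continuous_rho [continuous_intros]: "continuous_on S rho"
  unfolding rho_def[abs_def] by (intro continuous_intros)

lemma continuous_wt [continuous_intros]: "continuous_on S wt"
  unfolding wt_def[abs_def] by (intro continuous_intros)

lemma continuous_sqsum [continuous_intros]: "continuous_on S sqsum"
  unfolding sqsum_def[abs_def] by (intro continuous_intros)

lemma vec_nth_measurable [measurable]: "(\<lambda>w::complex ^ 'n::finite. w $ i) \<in> borel_measurable borel"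
  by (intro borel_measurable_continuous_onI continuous_intros)

lemma rho_measurable [measurable]: "rho \<in> borel_measurable borel"
  by (intro borel_measurable_continuous_onI continuous_intros)

lemma wt_measurable [measurable]: "wt \<in> borel_measurable borel"
  by (intro borel_measurable_continuous_onI continuous_intros)

lemma sqsum_measurable [measurable]: "sqsum \<in> borel_measurable borel"
  by (intro borel_measurable_continuous_onI continuous_intros)

lemma open_siegel: "open (siegel :: (complex ^ 'n::{finite,linorder}) set)"
  unfolding siegel_def by (intro open_Collect_less continuous_intros)

lemma siegel_measurable [measurable]: "(siegel :: (complex ^ ('n::{finite,linorder})) set) \<in> sets borel"
  by (rule borel_open[OF open_siegel])

text \<open>The indicators confine the top coordinate, which will already have been integrated along
  lines, to a unit square; every other real coordinate contributes one Gaussian factor.\<close>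

lemma nn_integral_gauss_slab:
  fixes e1 e2 :: "(complex, 'n::{finite,linorder}) vec"
  assumes "\<tau> > 0"
  defines "e1 \<equiv> axis top_idx 1" and "e2 \<equiv> axis top_idx \<i>"
  shows "(\<integral>\<^sup>+w. indicator {0..1} (w \<bullet> e1) * (indicator {0..1} (w \<bullet> e2) * ennreal (exp (- \<tau> * sqsum w))) \<partial>lborel)
    = ennreal ((pi / \<tau>) ^ (CARD('n) - 1))"
proof -
  \<comment> \<open>Testing whether a basis vector points into the top coordinate lets a single
    family indexed by \<open>Basis\<close> describe all factors of the product.\<close>
  define f :: "(complex, 'n) vec \<Rightarrow> real \<Rightarrow> ennreal" where
    "f b x = (if b $ top_idx \<noteq> 0 then indicator {0..1} x else ennreal (exp (- \<tau> * x\<^sup>2)))" for b x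
  have f_axis: "f (axis i u) = (if i = top_idx then indicator {0..1} else (\<lambda>x. ennreal (exp (- \<tau> * x\<^sup>2))))"
    if "u \<noteq> 0" for i u
    using that by (auto simp: f_def axis_def fun_eq_iff)
  have ind: "(\<integral>\<^sup>+x. indicator {0..1} x \<partial>(lborel :: real measure)) = 1" by simp
  have prod_eq: "(\<Prod>b\<in>Basis. f b (w \<bullet> b)) = 
     indicator {0..1} (w \<bullet> e1) * (indicator {0..1} (w \<bullet> e2) * ennreal (exp (- \<tau> * sqsum w)))" for w
  proof -
    have "(\<Prod>b\<in>Basis. f b (w \<bullet> b)) = (\<Prod>i\<in>UNIV. f (axis i 1) (Re (w $ i)) * f (axis i \<i>) (Im (w $ i)))"
      by (simp add: prod_Basis_complex_vec inner_axis_complex)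
    also have "\<dots> = indicator {0..1} (Re (w $ top_idx)) * indicator {0..1} (Im (w $ top_idx)) *
        (\<Prod>i\<in>{..<top_idx}. f (axis i 1) (Re (w $ i)) * f (axis i \<i>) (Im (w $ i)))"
      by (subst UNIV_top_idx, subst prod.insert) (auto simp: f_axis ind)
    also have "(\<Prod>i\<in>{..<top_idx}. f (axis i 1) (Re (w $ i)) * f (axis i \<i>) (Im (w $ i)))
      = (\<Prod>i\<in>{..<top_idx}. ennreal (exp (- \<tau> * (cmod (w $ i))\<^sup>2)))"
      by (intro prod.cong)
        (auto simp: f_axis ennreal_mult[symmetric] exp_add[symmetric] cmod_power2 algebra_simps)
    also have "\<dots> = ennreal (exp (- \<tau> * sqsum w))"
      by (simp add: prod_ennreal sqsum_def sum_distrib_left exp_sum[symmetric] sum_negf)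
    finally show ?thesis by (simp add: e1_def e2_def inner_axis_complex mult.assoc)
  qed
  have "(\<integral>\<^sup>+w. (\<Prod>b\<in>Basis. f b (w \<bullet> b)) \<partial>lborel) = (\<Prod>b\<in>Basis. (\<integral>\<^sup>+x. f b x \<partial>lborel))"
    by (rule nn_integral_lborel_prod) (auto simp: f_def)
  also have "\<dots> = (\<Prod>i\<in>UNIV. (\<integral>\<^sup>+x. f (axis i 1) x \<partial>lborel) * (\<integral>\<^sup>+x. f (axis i \<i>) x \<partial>lborel))"
    by (rule prod_Basis_complex_vec)
  also have "\<dots> = (\<Prod>i\<in>{..<top_idx}. (\<integral>\<^sup>+x. f (axis i 1) x \<partial>lborel) * (\<integral>\<^sup>+x. f (axis i \<i>) x \<partial>lborel))"
    by (subst UNIV_top_idx, subst prod.insert) (auto simp: f_axis ind)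
  also have "\<dots> = (\<Prod>i\<in>{..<top_idx::'n}. ennreal (pi / \<tau>))"
  proof (rule prod.cong)
    fix i :: 'n assume "i \<in> {..<top_idx}"
    hence "(\<integral>\<^sup>+x. f (axis i u) x \<partial>lborel) = ennreal (sqrt (pi / \<tau>))" if "u \<noteq> 0" for u
      using nn_integral_gauss[OF assms(1)] that by (simp add: f_axis)
    thus "(\<integral>\<^sup>+x. f (axis i 1) x \<partial>lborel) * (\<integral>\<^sup>+x. f (axis i \<i>) x \<partial>lborel) = ennreal (pi / \<tau>)"
      using assms(1) by (simp add: ennreal_mult[symmetric])
  qed auto
  also have "\<dots> = ennreal ((pi / \<tau>) ^ (CARD('n) - 1))"
    using assms(1) by (simp add: card_below_top ennreal_power)
  finally show ?thesis by (simp only: prod_eq)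
qed

text \<open>Here \<open>y\<close> will be the height and \<open>r\<close> the value of
  \<open>sqsum\<close>. With \<open>(1 + y + r) powr (1 - \<sigma>)\<close> written as a mean of
  exponentials, \<open>y\<close> is integrated out as a Gamma integral and \<open>r\<close> survives
  only in \<open>exp (- \<tau> * r)\<close>, ready for the tangential Gaussians.\<close>

lemma nn_integral_beta_halfline:
  assumes l: "l > -1" and \<sigma>: "\<sigma> > 1" and r: "r \<ge> 0"
  shows "(\<integral>\<^sup>+y. ennreal (indicator {0<..} y * (y powr l * (1 + y + r) powr (1 - \<sigma>))) \<partial>lborel)
    = ennreal (Gamma (l + 1) / Gamma (\<sigma> - 1)) *
      (\<integral>\<^sup>+\<tau>. ennreal (indicator {0<..} \<tau> * (\<tau> powr (\<sigma> - 3 - l) * exp (- \<tau>))) * ennreal (exp (- \<tau> * r)) \<partial>lborel)"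
proof -
  have G: "Gamma (\<sigma> - 1) > 0" "Gamma (l + 1) > 0" using \<sigma> l by (auto intro!: Gamma_real_pos)
  have "(\<integral>\<^sup>+y. ennreal (indicator {0<..} y * (y powr l * (1 + y + r) powr (1 - \<sigma>))) \<partial>lborel)
    = (\<integral>\<^sup>+y. ennreal (1 / Gamma (\<sigma> - 1)) * (\<integral>\<^sup>+\<tau>. ennreal (indicator {0<..} y * y powr l) * ennreal (indicator {0<..} \<tau> * (\<tau> powr (\<sigma> - 1 - 1) * exp (- (1 + y + r) * \<tau>))) \<partial>lborel) \<partial>lborel)"
  proof (rule nn_integral_cong)
    fix y :: real
    show "ennreal (indicator {0<..} y * (y powr l * (1 + y + r) powr (1 - \<sigma>)))
      = ennreal (1 / Gamma (\<sigma> - 1)) * (\<integral>\<^sup>+\<tau>. ennreal (indicator {0<..} y * y powr l) * ennreal (indicator {0<..} \<tau> * (\<tau> powr (\<sigma> - 1 - 1) * exp (- (1 + y + r) * \<tau>))) \<partial>lborel)"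
    proof (cases "y > 0")
      case True
      have "ennreal (indicator {0<..} y * (y powr l * (1 + y + r) powr (1 - \<sigma>)))
        = ennreal (indicator {0<..} y * y powr l) * ennreal ((1 + y + r) powr - (\<sigma> - 1))"
        using True by (simp add: ennreal_mult[symmetric])
      also have "ennreal ((1 + y + r) powr - (\<sigma> - 1)) = ennreal (1 / Gamma (\<sigma> - 1)) *
         (\<integral>\<^sup>+\<tau>. ennreal (indicator {0<..} \<tau> * (\<tau> powr (\<sigma> - 1 - 1) * exp (- (1 + y + r) * \<tau>))) \<partial>lborel)"
        by (rule powr_conv_nn_integral) (use \<sigma> True r in auto)
      finally show ?thesis by (subst nn_integral_cmult) (measurable, simp add: mult_ac)
    qed simp
  qed
  also have "\<dots> = ennreal (1 / Gamma (\<sigma> - 1)) * (\<integral>\<^sup>+y. (\<integral>\<^sup>+\<tau>. ennreal (indicator {0<..} y * y powr l) * ennreal (indicator {0<..} \<tau> * (\<tau> powr (\<sigma> - 1 - 1) * exp (- (1 + y + r) * \<tau>))) \<partial>lborel) \<partial>lborel)"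
    by (rule nn_integral_cmult) measurable
  also have "(\<integral>\<^sup>+y. (\<integral>\<^sup>+\<tau>. ennreal (indicator {0<..} y * y powr l) * ennreal (indicator {0<..} \<tau> * (\<tau> powr (\<sigma> - 1 - 1) * exp (- (1 + y + r) * \<tau>))) \<partial>lborel) \<partial>lborel)
     = (\<integral>\<^sup>+\<tau>. (\<integral>\<^sup>+y. ennreal (indicator {0<..} y * y powr l) * ennreal (indicator {0<..} \<tau> * (\<tau> powr (\<sigma> - 1 - 1) * exp (- (1 + y + r) * \<tau>))) \<partial>lborel) \<partial>lborel)"
    by (rule lborel_pair.Fubini') measurable
  also have "\<dots> = (\<integral>\<^sup>+\<tau>. ennreal (Gamma (l + 1)) * (ennreal (indicator {0<..} \<tau> * (\<tau> powr (\<sigma> - 3 - l) * exp (- \<tau>))) * ennreal (exp (- \<tau> * r))) \<partial>lborel)"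
  proof (rule nn_integral_cong)
    fix \<tau> :: real
    show "(\<integral>\<^sup>+y. ennreal (indicator {0<..} y * y powr l) * ennreal (indicator {0<..} \<tau> * (\<tau> powr (\<sigma> - 1 - 1) * exp (- (1 + y + r) * \<tau>))) \<partial>lborel)
      = ennreal (Gamma (l + 1)) * (ennreal (indicator {0<..} \<tau> * (\<tau> powr (\<sigma> - 3 - l) * exp (- \<tau>))) * ennreal (exp (- \<tau> * r)))"
    proof (cases "\<tau> > 0")
      case True
      have "(\<integral>\<^sup>+y. ennreal (indicator {0<..} y * y powr l) * ennreal (indicator {0<..} \<tau> * (\<tau> powr (\<sigma> - 1 - 1) * exp (- (1 + y + r) * \<tau>))) \<partial>lborel)
        = (\<integral>\<^sup>+y. ennreal (\<tau> powr (\<sigma> - 2) * exp (- (1 + r) * \<tau>)) * ennreal (indicator {0<..} y * (y powr (l + 1 - 1) * exp (- \<tau> * y))) \<partial>lborel)"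
      proof (intro nn_integral_cong)
        fix y :: real
        have "exp (- (1 + y + r) * \<tau>) = exp (- (1 + r) * \<tau>) * exp (- \<tau> * y)"
          by (simp add: mult_exp_exp algebra_simps)
        thus "ennreal (indicator {0<..} y * y powr l) * ennreal (indicator {0<..} \<tau> * (\<tau> powr (\<sigma> - 1 - 1) * exp (- (1 + y + r) * \<tau>)))
          = ennreal (\<tau> powr (\<sigma> - 2) * exp (- (1 + r) * \<tau>)) * ennreal (indicator {0<..} y * (y powr (l + 1 - 1) * exp (- \<tau> * y)))"
          using True by (simp add: ennreal_mult[symmetric] mult_ac)
      qed
      also have "\<dots> = ennreal (\<tau> powr (\<sigma> - 2) * exp (- (1 + r) * \<tau>)) * ennreal (Gamma (l + 1) * \<tau> powr - (l + 1))"
      proof -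
        have "(\<integral>\<^sup>+y. ennreal (\<tau> powr (\<sigma> - 2) * exp (- (1 + r) * \<tau>)) * ennreal (indicator {0<..} y * (y powr (l + 1 - 1) * exp (- \<tau> * y))) \<partial>lborel)
          = ennreal (\<tau> powr (\<sigma> - 2) * exp (- (1 + r) * \<tau>)) * (\<integral>\<^sup>+y. ennreal (indicator {0<..} y * (y powr (l + 1 - 1) * exp (- \<tau> * y))) \<partial>lborel)"
          by (rule nn_integral_cmult) measurable
        also have "(\<integral>\<^sup>+y. ennreal (indicator {0<..} y * (y powr (l + 1 - 1) * exp (- \<tau> * y))) \<partial>lborel) = ennreal (Gamma (l + 1) * \<tau> powr - (l + 1))"
          by (rule nn_integral_gamma) (use l True in auto)
        finally show ?thesis .
      qed
      also have "\<dots> = ennreal (Gamma (l + 1)) * (ennreal (indicator {0<..} \<tau> * (\<tau> powr (\<sigma> - 3 - l) * exp (- \<tau>))) * ennreal (exp (- \<tau> * r)))"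
      proof -
        have "\<tau> powr (\<sigma> - 3 - l) = \<tau> powr (\<sigma> - 2) * \<tau> powr - (l + 1)"
          by (simp add: powr_add[symmetric] algebra_simps)
        moreover have "exp (- (1 + r) * \<tau>) = exp (- \<tau>) * exp (- \<tau> * r)"
          by (simp add: mult_exp_exp algebra_simps)
        ultimately show ?thesis using True G by (simp add: ennreal_mult[symmetric] mult_ac)
      qed
      finally show ?thesis .
    qed simp
  qed
  also have "\<dots> = ennreal (Gamma (l + 1)) * (\<integral>\<^sup>+\<tau>. (ennreal (indicator {0<..} \<tau> * (\<tau> powr (\<sigma> - 3 - l) * exp (- \<tau>))) * ennreal (exp (- \<tau> * r))) \<partial>lborel)"
    by (rule nn_integral_cmult) measurable
  finally show ?thesis using G by (simp add: mult.assoc[symmetric] ennreal_mult[symmetric])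
qed

text \<open>The factors follow the order of integration: the real part of the top coordinate, the
  height, the tangential Gaussians, and the parameter \<open>\<tau>\<close> of the exponential
  representation. The last Gamma factor is the one that requires
  \<open>\<sigma> > n + 1 + l\<close>.\<close>

definition siegel_moment :: "nat \<Rightarrow> real \<Rightarrow> real \<Rightarrow> real" where
  "siegel_moment n l \<sigma> = sqrt pi * Gamma ((\<sigma> - 1) / 2) / Gamma (\<sigma> / 2) * Gamma (l + 1) / Gamma (\<sigma> - 1)
     * pi ^ (n - 1) * Gamma (\<sigma> - 1 - l - n)"

text \<open>Only the top coordinate is sliced off, by averaging in its real and then in its
  imaginary direction. The first motion changes neither \<open>rho\<close> nor \<open>sqsum\<close>,
  the second moves \<open>rho\<close> at unit speed, and what remains is Gaussian in the tangential
  coordinates. This moment decides all questions of integrability below and also fixes the constant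
  of the reproducing formula.\<close>

lemma nn_integral_siegel_moment:
  assumes l: "l > -1" and \<sigma>: "\<sigma> > real CARD('n) + 1 + l"
  shows "(\<integral>\<^sup>+w. ennreal (indicator siegel w * (rho w powr l * wt w powr - \<sigma>)) \<partial>(lborel :: ((complex, 'n::{finite,linorder}) vec) measure))
    = ennreal (siegel_moment CARD('n) l \<sigma>)"
proof -
  define e1 e2 :: "(complex, 'n) vec" where "e1 = axis top_idx 1" and "e2 = axis top_idx \<i>"
  have B: "e1 \<in> Basis" "e2 \<in> Basis" by (simp_all add: e1_def e2_def axis_complex_Basis)
  have n1: "CARD('n) \<ge> 1" by (simp add: Suc_leI)
  have \<sigma>1: "\<sigma> > 1" using \<sigma> l n1 by linarith
  define p :: "real \<Rightarrow> ennreal" where "p = indicator {0..1}"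
  have [measurable]: "p \<in> borel_measurable borel" by (simp add: p_def)
  have p1: "(\<integral>\<^sup>+t. p t \<partial>lborel) = 1" by (simp add: p_def)
  define A where "A = sqrt pi * Gamma ((\<sigma> - 1) / 2) / Gamma (\<sigma> / 2)"
  have A: "A > 0" using \<sigma>1 by (auto simp: A_def intro!: Gamma_real_pos divide_pos_pos mult_pos_pos)
  let ?L = "lborel :: ((complex, 'n) vec) measure"
  let ?F = "\<lambda>w::(complex, 'n) vec. ennreal (indicator siegel w * (rho w powr l * wt w powr - \<sigma>))"
  define F1 :: "(complex, 'n) vec \<Rightarrow> ennreal" where
    "F1 w = ennreal (indicator {0<..} (rho w) * (rho w powr l * (A * (Im (w $ top_idx) + 1) powr (1 - \<sigma>))))" for w
  have [measurable]: "F1 \<in> borel_measurable borel" unfolding F1_def by measurable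
  have [measurable]: "?F \<in> borel_measurable borel" by measurable
  have comp1: "e1 $ i = (if i = top_idx then 1 else 0)"
    and comp2: "e2 $ i = (if i = top_idx then \<i> else 0)" for i
    by (simp_all add: e1_def e2_def axis_def)
  have sq: "sqsum (w + t *\<^sub>R e1) = sqsum w" "sqsum (w + t *\<^sub>R e2) = sqsum w" for w t
    by (auto simp: sqsum_def comp1 comp2 intro!: sum.cong)
  have rho1: "rho (w + t *\<^sub>R e1) = rho w" for w t
    by (simp add: rho_eq sq comp1)
  have ind: "indicator siegel w = (indicator {0<..} (rho w) :: real)" for w :: "(complex, 'n) vec"
    by (simp add: siegel_def indicator_def)
  have Fe1: "(\<integral>\<^sup>+t. ?F (w + t *\<^sub>R e1) \<partial>lborel) = F1 w" for w
  proof (cases "rho w > 0")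
    case False
    thus ?thesis by (simp add: F1_def ind rho1)
  next
    case True
    define b where "b = Im (w $ top_idx) + 1"
    have b: "b > 0" using True sqsum_nonneg[of w] unfolding b_def rho_eq by linarith
    have "(\<integral>\<^sup>+t. ?F (w + t *\<^sub>R e1) \<partial>lborel) =
      (\<integral>\<^sup>+t. ennreal (rho w powr l) * ennreal ((b\<^sup>2 + (t + Re (w $ top_idx))\<^sup>2) powr (- \<sigma> / 2)) \<partial>lborel)"
    proof (rule nn_integral_cong)
      fix t
      have "wt (w + t *\<^sub>R e1) = sqrt (b\<^sup>2 + (t + Re (w $ top_idx))\<^sup>2)"
        by (simp add: wt_def comp1 cmod_def b_def add_ac)
      hence "wt (w + t *\<^sub>R e1) = (b\<^sup>2 + (t + Re (w $ top_idx))\<^sup>2) powr (1/2)"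
        by (simp add: powr_half_sqrt)
      thus "?F (w + t *\<^sub>R e1) = ennreal (rho w powr l) * ennreal ((b\<^sup>2 + (t + Re (w $ top_idx))\<^sup>2) powr (- \<sigma> / 2))"
        using True by (simp add: ennreal_mult[symmetric] ind rho1 powr_powr)
    qed
    also have "\<dots> = ennreal (rho w powr l) * (\<integral>\<^sup>+t. ennreal ((b\<^sup>2 + (t + Re (w $ top_idx))\<^sup>2) powr (- \<sigma> / 2)) \<partial>lborel)"
      by (rule nn_integral_cmult) measurable
    also have "(\<integral>\<^sup>+t. ennreal ((b\<^sup>2 + (t + Re (w $ top_idx))\<^sup>2) powr (- \<sigma> / 2)) \<partial>lborel)
       = (\<integral>\<^sup>+t. ennreal ((b\<^sup>2 + t\<^sup>2) powr (- \<sigma> / 2)) \<partial>lborel)"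
      by (rule nn_integral_translate[where f="\<lambda>t. ennreal ((b\<^sup>2 + t\<^sup>2) powr (- \<sigma> / 2))"]) measurable
    also have "\<dots> = ennreal (A * b powr (1 - \<sigma>))"
      unfolding A_def by (rule nn_integral_cauchy_powr[OF b \<sigma>1])
    finally show ?thesis using True A by (simp add: F1_def b_def ennreal_mult[symmetric])
  qed
  define J where "J r = (\<integral>\<^sup>+y. ennreal (indicator {0<..} y * (y powr l * (1 + y + r) powr (1 - \<sigma>))) \<partial>lborel)" for r
  \<comment> \<open>Shifting the variable by \<open>rho w\<close> makes the height itself the
    variable of integration, so the result depends on the base point through \<open>sqsum w\<close>
    alone, apart from the factor \<open>p (w \<bullet> e1)\<close>.\<close>
  have F1e2: "(\<integral>\<^sup>+t. p ((w + t *\<^sub>R e2) \<bullet> e1) * F1 (w + t *\<^sub>R e2) \<partial>lborel) = p (w \<bullet> e1) * (ennreal A * J (sqsum w))" for w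
  proof -
    have "(\<integral>\<^sup>+t. p ((w + t *\<^sub>R e2) \<bullet> e1) * F1 (w + t *\<^sub>R e2) \<partial>lborel)
      = (\<integral>\<^sup>+t. p (w \<bullet> e1) * F1 (w + t *\<^sub>R e2) \<partial>lborel)"
      by (simp add: e1_def inner_axis_complex comp2)
    also have "\<dots> = p (w \<bullet> e1) * (\<integral>\<^sup>+t. F1 (w + t *\<^sub>R e2) \<partial>lborel)"
      by (rule nn_integral_cmult) measurable
    also have "(\<integral>\<^sup>+t. F1 (w + t *\<^sub>R e2) \<partial>lborel) = (\<integral>\<^sup>+t. ennreal A * ennreal (indicator {0<..} (t + rho w) * ((t + rho w) powr l * (1 + (t + rho w) + sqsum w) powr (1 - \<sigma>))) \<partial>lborel)"
    proof (rule nn_integral_cong)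
      fix t
      have "rho (w + t *\<^sub>R e2) = t + rho w" "Im ((w + t *\<^sub>R e2) $ top_idx) + 1 = 1 + (t + rho w) + sqsum w"
        by (simp_all add: rho_eq sq comp2)
      hence "F1 (w + t *\<^sub>R e2) = ennreal (indicator {0<..} (t + rho w) * ((t + rho w) powr l * (A * (1 + (t + rho w) + sqsum w) powr (1 - \<sigma>))))"
        unfolding F1_def by (simp only:)
      thus "F1 (w + t *\<^sub>R e2) = ennreal A * ennreal (indicator {0<..} (t + rho w) * ((t + rho w) powr l * (1 + (t + rho w) + sqsum w) powr (1 - \<sigma>)))"
        using A by (simp add: ennreal_mult[symmetric] mult_ac)
    qed
    also have "\<dots> = ennreal A * (\<integral>\<^sup>+t. ennreal (indicator {0<..} (t + rho w) * ((t + rho w) powr l * (1 + (t + rho w) + sqsum w) powr (1 - \<sigma>))) \<partial>lborel)"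
      by (rule nn_integral_cmult) measurable
    also have "(\<integral>\<^sup>+t. ennreal (indicator {0<..} (t + rho w) * ((t + rho w) powr l * (1 + (t + rho w) + sqsum w) powr (1 - \<sigma>))) \<partial>lborel) = J (sqsum w)"
      unfolding J_def
      by (rule nn_integral_translate[where f="\<lambda>t. ennreal (indicator {0<..} t * (t powr l * (1 + t + sqsum w) powr (1 - \<sigma>)))"]) measurable
    finally show ?thesis .
  qed
  define H where "H \<tau> = ennreal (indicator {0<..} \<tau> * (\<tau> powr (\<sigma> - 3 - l) * exp (- \<tau>)))" for \<tau>
  have [measurable]: "H \<in> borel_measurable borel" unfolding H_def by measurable
  define c where "c = Gamma (l + 1) / Gamma (\<sigma> - 1)"
  have c: "c > 0" using l \<sigma>1 by (auto simp: c_def intro!: divide_pos_pos Gamma_real_pos)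
  have "(\<integral>\<^sup>+w. ?F w \<partial>?L) = (\<integral>\<^sup>+w. p (w \<bullet> e1) * (\<integral>\<^sup>+t. ?F (w + t *\<^sub>R e1) \<partial>lborel) \<partial>?L)"
    by (rule nn_integral_average_direction) (use p1 B in auto)
  also have "\<dots> = (\<integral>\<^sup>+w. p (w \<bullet> e1) * F1 w \<partial>?L)" by (simp only: Fe1)
  also have "\<dots> = (\<integral>\<^sup>+w. p (w \<bullet> e2) * (\<integral>\<^sup>+t. p ((w + t *\<^sub>R e2) \<bullet> e1) * F1 (w + t *\<^sub>R e2) \<partial>lborel) \<partial>?L)"
    by (rule nn_integral_average_direction) (use p1 B in auto)
  also have "\<dots> = (\<integral>\<^sup>+w. p (w \<bullet> e2) * (p (w \<bullet> e1) * (ennreal A * (ennreal c *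
      (\<integral>\<^sup>+\<tau>. H \<tau> * ennreal (exp (- \<tau> * sqsum w)) \<partial>lborel)))) \<partial>?L)"
    by (simp only: F1e2 J_def nn_integral_beta_halfline[OF l \<sigma>1 sqsum_nonneg] c_def H_def)
  also have "\<dots> = (\<integral>\<^sup>+w. (\<integral>\<^sup>+\<tau>. ennreal (A * c) * (H \<tau> * (p (w \<bullet> e1) * (p (w \<bullet> e2) * ennreal (exp (- \<tau> * sqsum w))))) \<partial>lborel) \<partial>?L)"
  proof (rule nn_integral_cong)
    fix w :: "(complex, 'n) vec"
    have "(\<integral>\<^sup>+\<tau>. ennreal (A * c) * (H \<tau> * (p (w \<bullet> e1) * (p (w \<bullet> e2) * ennreal (exp (- \<tau> * sqsum w))))) \<partial>lborel)
      = (\<integral>\<^sup>+\<tau>. (ennreal (A * c) * p (w \<bullet> e1) * p (w \<bullet> e2)) * (H \<tau> * ennreal (exp (- \<tau> * sqsum w))) \<partial>lborel)"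
      by (simp add: mult_ac)
    also have "\<dots> = (ennreal (A * c) * p (w \<bullet> e1) * p (w \<bullet> e2)) * (\<integral>\<^sup>+\<tau>. H \<tau> * ennreal (exp (- \<tau> * sqsum w)) \<partial>lborel)"
      by (rule nn_integral_cmult) measurable
    finally show "p (w \<bullet> e2) * (p (w \<bullet> e1) * (ennreal A * (ennreal c *
      (\<integral>\<^sup>+\<tau>. H \<tau> * ennreal (exp (- \<tau> * sqsum w)) \<partial>lborel))))
      = (\<integral>\<^sup>+\<tau>. ennreal (A * c) * (H \<tau> * (p (w \<bullet> e1) * (p (w \<bullet> e2) * ennreal (exp (- \<tau> * sqsum w))))) \<partial>lborel)"
      using A c by (simp add: mult_ac ennreal_mult)
  qed
  also have "\<dots> = (\<integral>\<^sup>+\<tau>. (\<integral>\<^sup>+w. ennreal (A * c) * (H \<tau> * (p (w \<bullet> e1) * (p (w \<bullet> e2) * ennreal (exp (- \<tau> * sqsum w))))) \<partial>?L) \<partial>lborel)"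
    by (rule lborel_pair.Fubini') measurable
  also have "\<dots> = (\<integral>\<^sup>+\<tau>. ennreal (A * c * pi ^ (CARD('n) - 1)) * ennreal (indicator {0<..} \<tau> * (\<tau> powr (\<sigma> - 1 - l - CARD('n) - 1) * exp (- 1 * \<tau>))) \<partial>lborel)"
  proof (rule nn_integral_cong)
    fix \<tau> :: real
    show "(\<integral>\<^sup>+w. ennreal (A * c) * (H \<tau> * (p (w \<bullet> e1) * (p (w \<bullet> e2) * ennreal (exp (- \<tau> * sqsum w))))) \<partial>?L)
      = ennreal (A * c * pi ^ (CARD('n) - 1)) * ennreal (indicator {0<..} \<tau> * (\<tau> powr (\<sigma> - 1 - l - CARD('n) - 1) * exp (- 1 * \<tau>)))"
    proof (cases "\<tau> > 0")
      case True
      have "(\<integral>\<^sup>+w. ennreal (A * c) * (H \<tau> * (p (w \<bullet> e1) * (p (w \<bullet> e2) * ennreal (exp (- \<tau> * sqsum w))))) \<partial>?L)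
        = ennreal (A * c) * (H \<tau> * (\<integral>\<^sup>+w. (p (w \<bullet> e1) * (p (w \<bullet> e2) * ennreal (exp (- \<tau> * sqsum w)))) \<partial>?L))"
      proof -
        have "(\<integral>\<^sup>+w. H \<tau> * (p (w \<bullet> e1) * (p (w \<bullet> e2) * ennreal (exp (- \<tau> * sqsum w)))) \<partial>?L)
          = H \<tau> * (\<integral>\<^sup>+w. (p (w \<bullet> e1) * (p (w \<bullet> e2) * ennreal (exp (- \<tau> * sqsum w)))) \<partial>?L)"
          by (rule nn_integral_cmult) measurable
        moreover have "(\<integral>\<^sup>+w. ennreal (A * c) * (H \<tau> * (p (w \<bullet> e1) * (p (w \<bullet> e2) * ennreal (exp (- \<tau> * sqsum w))))) \<partial>?L)
          = ennreal (A * c) * (\<integral>\<^sup>+w. H \<tau> * (p (w \<bullet> e1) * (p (w \<bullet> e2) * ennreal (exp (- \<tau> * sqsum w)))) \<partial>?L)"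
          by (rule nn_integral_cmult) measurable
        ultimately show ?thesis by (simp only:)
      qed
      also have "(\<integral>\<^sup>+w. (p (w \<bullet> e1) * (p (w \<bullet> e2) * ennreal (exp (- \<tau> * sqsum w)))) \<partial>?L) = ennreal ((pi / \<tau>) ^ (CARD('n) - 1))"
        unfolding p_def e1_def e2_def by (rule nn_integral_gauss_slab[OF True])
      also have "ennreal (A * c) * (H \<tau> * \<dots>) = ennreal (A * c * (\<tau> powr (\<sigma> - 3 - l) * exp (- \<tau>) * (pi / \<tau>) ^ (CARD('n) - 1)))"
        using True A c by (simp add: H_def ennreal_mult[symmetric] mult_ac)
      also have "(pi / \<tau>) ^ (CARD('n) - 1) = pi ^ (CARD('n) - 1) * \<tau> powr - (real CARD('n) - 1)"
      proof -
        have "\<tau> powr - (real CARD('n) - 1) = inverse (\<tau> ^ (CARD('n) - 1))"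
          using True n1 by (simp only: powr_minus powr_realpow[symmetric] of_nat_diff of_nat_1)
        thus ?thesis using True by (simp add: power_mult_distrib divide_inverse power_inverse)
      qed
      also have "A * c * (\<tau> powr (\<sigma> - 3 - l) * exp (- \<tau>) * (pi ^ (CARD('n) - 1) * \<tau> powr - (real CARD('n) - 1)))
        = A * c * pi ^ (CARD('n) - 1) * ((\<tau> powr (\<sigma> - 3 - l) * \<tau> powr - (real CARD('n) - 1)) * exp (- \<tau>))"
        by (simp add: mult_ac)
      also have "\<tau> powr (\<sigma> - 3 - l) * \<tau> powr - (real CARD('n) - 1) = \<tau> powr (\<sigma> - 1 - l - CARD('n) - 1)"
        by (simp add: powr_add[symmetric] algebra_simps)
      finally show ?thesis using True A c by (simp add: ennreal_mult[symmetric])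
    qed (simp add: H_def)
  qed
  also have "\<dots> = ennreal (A * c * pi ^ (CARD('n) - 1)) * ennreal (Gamma (\<sigma> - 1 - l - CARD('n)) * 1 powr - (\<sigma> - 1 - l - CARD('n)))"
  proof -
    have "(\<integral>\<^sup>+\<tau>. ennreal (A * c * pi ^ (CARD('n) - 1)) * ennreal (indicator {0<..} \<tau> * (\<tau> powr (\<sigma> - 1 - l - CARD('n) - 1) * exp (- 1 * \<tau>))) \<partial>lborel)
      = ennreal (A * c * pi ^ (CARD('n) - 1)) * (\<integral>\<^sup>+\<tau>. ennreal (indicator {0<..} \<tau> * (\<tau> powr (\<sigma> - 1 - l - CARD('n) - 1) * exp (- 1 * \<tau>))) \<partial>lborel)"
      by (rule nn_integral_cmult) measurable
    also have "(\<integral>\<^sup>+\<tau>. ennreal (indicator {0<..} \<tau> * (\<tau> powr (\<sigma> - 1 - l - CARD('n) - 1) * exp (- 1 * \<tau>))) \<partial>lborel)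
      = ennreal (Gamma (\<sigma> - 1 - l - CARD('n)) * 1 powr - (\<sigma> - 1 - l - CARD('n)))"
      by (rule nn_integral_gamma) (use \<sigma> in auto)
    finally show ?thesis .
  qed
  also have "\<dots> = ennreal (siegel_moment CARD('n) l \<sigma>)"
  proof -
    have "Gamma (\<sigma> - 1 - l - CARD('n)) > 0" using \<sigma> by (intro Gamma_real_pos) auto
    moreover have "siegel_moment CARD('n) l \<sigma> = A * c * pi ^ (CARD('n) - 1) * Gamma (\<sigma> - 1 - l - CARD('n))"
      by (simp add: siegel_moment_def A_def c_def)
    moreover have "A * c * pi ^ (CARD('n) - 1) \<ge> 0" using A c by simp
    ultimately show ?thesis by (simp only: powr_one_eq_one mult_1_right ennreal_mult less_imp_le)
  qed
  finally show ?thesis .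
qed

text \<open>The mean over \<open>w\<close> does not depend on the parameter \<open>t\<close>, so it
  passes through the integral in \<open>t\<close>; this serves translations and contractions alike.
  The inner integral is of Henstock-Kurzweil type, as the fundamental theorem of calculus delivers
  it. Fubini makes it a Lebesgue integral for almost every \<open>w\<close>, which suffices.\<close>

lemma integral_fubini_interval:
  fixes \<Phi> :: "real \<Rightarrow> 'a::euclidean_space \<Rightarrow> complex"
  assumes \<tau>: "0 \<le> \<tau>"
    and int: "integrable (lborel \<Otimes>\<^sub>M lborel) (\<lambda>(t, w). indicator {0..\<tau>} t *\<^sub>R \<Phi> t w)"
    and c: "\<And>t. t \<in> {0..\<tau>} \<Longrightarrow> (LINT w|lborel. \<Phi> t w) = c"
    and g: "\<And>w. ((\<lambda>t. \<Phi> t w) has_integral g w) {0..\<tau>}" "g \<in> borel_measurable borel"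
  shows "(LINT w|lborel. g w) = \<tau> *\<^sub>R c"
proof -
  let ?\<Psi> = "\<lambda>t w. indicator {0..\<tau>} t *\<^sub>R \<Phi> t w"
  have meas: "(\<lambda>w. LINT t|lborel. ?\<Psi> t w) \<in> borel_measurable lborel"
    using int by (intro borel_measurable_integrable lborel_pair.integrable_snd) simp
  have "AE w in lborel. integrable lborel (\<lambda>t. ?\<Psi> t w)"
    by (rule lborel_pair.AE_integrable_snd) (use int in simp)
  hence "AE w in lborel. g w = (LINT t|lborel. ?\<Psi> t w)"
  proof eventually_elim
    case (elim w)
    hence "set_integrable lborel {0..\<tau>} (\<lambda>t. \<Phi> t w)" by (simp add: set_integrable_def)
    from set_borel_integral_eq_integral(2)[OF this] show ?case
      using g(1)[of w] by (simp add: set_lebesgue_integral_def integral_unique)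
  qed
  hence "(LINT w|lborel. g w) = (LINT w|lborel. LINT t|lborel. ?\<Psi> t w)"
    by (intro integral_cong_AE) (use g meas in auto)
  also have "\<dots> = (LINT t|lborel. LINT w|lborel. ?\<Psi> t w)"
    by (rule lborel_pair.Fubini_integral) (use int in simp)
  also have "\<dots> = (LINT t|lborel. indicator {0..\<tau>} t *\<^sub>R c)"
    by (intro Bochner_Integration.integral_cong) (auto simp: indicator_def c)
  also have "\<dots> = \<tau> *\<^sub>R c" using \<tau> by simp
  finally show ?thesis .
qed

lemma integrable_dominated_interval:
  fixes \<Phi> :: "real \<Rightarrow> 'a::euclidean_space \<Rightarrow> complex"
  assumes [measurable]: "(\<lambda>(t, w). \<Phi> t w) \<in> borel_measurable (borel \<Otimes>\<^sub>M borel)"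
    and B: "integrable lborel B" "\<And>t w. t \<in> {0..\<tau>} \<Longrightarrow> cmod (\<Phi> t w) \<le> B w"
  shows "integrable (lborel \<Otimes>\<^sub>M lborel) (\<lambda>(t, w). indicator {0..\<tau>} t *\<^sub>R \<Phi> t w)"
proof (rule lborel_pair.Fubini_integrable)
  show m: "(\<lambda>(t, w). indicator {0..\<tau>} t *\<^sub>R \<Phi> t w) \<in> borel_measurable (lborel \<Otimes>\<^sub>M lborel)"
    by measurable
  have i: "integrable lborel (\<lambda>w. indicator {0..\<tau>} t *\<^sub>R \<Phi> t w)" for t
    by (rule Bochner_Integration.integrable_bound[OF B(1)])
      (use B(2) in \<open>force simp: indicator_def intro!: AE_I2 order_trans[OF B(2)]\<close>)+
  show "AE t in lborel. integrable lborel (\<lambda>w. case (t, w) of (t, w) \<Rightarrow> indicator {0..\<tau>} t *\<^sub>R \<Phi> t w)"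
    using i by simp
  show "integrable lborel (\<lambda>t. LINT w|lborel. norm (case (t, w) of (t, w) \<Rightarrow> indicator {0..\<tau>} t *\<^sub>R \<Phi> t w))"
  proof (rule Bochner_Integration.integrable_bound)
    show "integrable lborel (\<lambda>t. indicator {0..\<tau>} t *\<^sub>R (LINT w|lborel. B w))"
      by (intro integrable_real_indicator integrable_scaleR_left) (auto simp: emeasure_lborel_Icc_eq)
    show "AE t in lborel. norm (LINT w|lborel. norm (case (t, w) of (t, w) \<Rightarrow> indicator {0..\<tau>} t *\<^sub>R \<Phi> t w))
      \<le> norm (indicator {0..\<tau>} t *\<^sub>R (LINT w|lborel. B w))"
    proof (intro AE_I2)
      fix t
      show "norm (LINT w|lborel. norm (case (t, w) of (t, w) \<Rightarrow> indicator {0..\<tau>} t *\<^sub>R \<Phi> t w))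
      \<le> norm (indicator {0..\<tau>} t *\<^sub>R (LINT w|lborel. B w))"
      proof (cases "t \<in> {0..\<tau>}")
        case True
        have "(LINT w|lborel. norm (\<Phi> t w)) \<le> (LINT w|lborel. B w)"
          using i[of t] True by (intro integral_mono B integrable_norm) auto
        moreover have "(LINT w|lborel. norm (\<Phi> t w)) \<ge> 0" by simp
        ultimately show ?thesis using True by simp
      qed simp
    qed
  qed (use m in measurable)
qed

text \<open>Averaging \<open>F\<close> over a unit step in the direction \<open>b\<close> gives
  \<open>G (w + b) - G w\<close>, whose integral vanishes by translation invariance. Integrability
  is the only decay asked for, but the derivative must exist at every point of the space, and this
  is what the cutoff at the boundary is for.\<close>

lemma integral_directional_derivative_eq_0:
  fixes G F :: "'a::euclidean_space \<Rightarrow> complex"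
  assumes G: "integrable lborel G" and F: "integrable lborel F"
    and der: "\<And>w. ((\<lambda>t. G (w + t *\<^sub>R b)) has_vector_derivative F w) (at 0)"
  shows "(LINT w|lborel. F w) = 0"
proof -
  have [measurable]: "G \<in> borel_measurable borel" "F \<in> borel_measurable borel"
    using G F by (auto dest: borel_measurable_integrable)
  \<comment> \<open>The derivative is assumed at parameter 0 for all base points; moving the base
    point along the line gives it at every \<open>t\<close>.\<close>
  have der': "((\<lambda>t. G (w + t *\<^sub>R b)) has_vector_derivative F (w + t *\<^sub>R b)) (at t)" for w t
  proof -
    have "((\<lambda>s. G ((w + t *\<^sub>R b) + s *\<^sub>R b)) \<circ> (\<lambda>s. s - t) has_vector_derivative 1 *\<^sub>R F (w + t *\<^sub>R b)) (at t)"
      by (rule vector_diff_chain_at) (auto intro!: derivative_eq_intros der)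
    thus ?thesis by (simp add: o_def algebra_simps scaleR_diff_left)
  qed
  have FI: "((\<lambda>t. F (w + t *\<^sub>R b)) has_integral (G (w + b) - G w)) {0..1}" for w
    using fundamental_theorem_of_calculus[of 0 1 "\<lambda>t. G (w + t *\<^sub>R b)" "\<lambda>t. F (w + t *\<^sub>R b)"]
      has_vector_derivative_at_within[OF der'] by simp
  have int: "integrable (lborel \<Otimes>\<^sub>M lborel) (\<lambda>(t, w). indicator {0..1} t *\<^sub>R F (w + t *\<^sub>R b))"
  proof (rule lborel_pair.Fubini_integrable)
    have eq: "(LINT w|lborel. norm (indicator {0..1} t *\<^sub>R F (w + t *\<^sub>R b))) = indicator {0..1} t *\<^sub>R (LINT w|lborel. norm (F w))" for t
      using integral_translate[of "\<lambda>w. norm (F w)" "t *\<^sub>R b"] by (simp add: indicator_def)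
    show "integrable lborel (\<lambda>t. LINT w|lborel. norm (case (t, w) of (t, w) \<Rightarrow> indicator {0..1} t *\<^sub>R F (w + t *\<^sub>R b)))"
      unfolding prod.case eq
      by (intro integrable_real_indicator integrable_scaleR_left) auto
    show "AE t in lborel. integrable lborel (\<lambda>w. case (t, w) of (t, w) \<Rightarrow> indicator {0..1} t *\<^sub>R F (w + t *\<^sub>R b))"
      by (intro AE_I2) (simp add: integrable_translate[OF F])
  qed measurable
  have "(LINT w|lborel. G (w + b) - G w) = 1 *\<^sub>R (LINT w|lborel. F w)"
  proof (rule integral_fubini_interval[OF _ int _ FI])
    show "(LINT w|lborel. F (w + t *\<^sub>R b)) = (LINT w|lborel. F w)" for t
      by (rule integral_translate) measurable
  qed auto
  moreover have "(LINT w|lborel. G (w + b) - G w) = 0"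
    using integral_translate[of G b] by (simp add: integrable_translate[OF G] G)
  ultimately show ?thesis by simp
qed

section \<open>Growth classes\<close>

lemma siegelD:
  fixes w :: "(complex, 'n::{finite,linorder}) vec"
  assumes "w \<in> siegel"
  shows "rho w > 0" "sqsum w \<le> wt w" "rho w \<le> wt w" "1 \<le> wt w" "cmod (w $ j) \<le> wt w"
    "j < top_idx \<Longrightarrow> (cmod (w $ j))\<^sup>2 \<le> wt w" "Im (w $ top_idx) > 0" "1 + rho w + sqsum w \<le> wt w"
proof -
  show r: "rho w > 0" using assms by (simp add: siegel_def)
  have Im: "Im (w $ top_idx) = rho w + sqsum w" by (simp add: rho_eq)
  show I0: "Im (w $ top_idx) > 0" using Im r sqsum_nonneg[of w] by linarith
  have I: "Im (w $ top_idx) + 1 \<le> wt w"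
    unfolding wt_def using abs_Im_le_cmod[of "w $ top_idx + \<i>"] by simp
  show "sqsum w \<le> wt w" "rho w \<le> wt w" "1 \<le> wt w" "1 + rho w + sqsum w \<le> wt w"
    using I I0 Im r sqsum_nonneg[of w] by linarith+
  have sq: "(cmod (w $ j))\<^sup>2 \<le> sqsum w" if "j < top_idx" for j
    unfolding sqsum_def using that by (intro member_le_sum) auto
  thus *: "(cmod (w $ j))\<^sup>2 \<le> wt w" if "j < top_idx" for j
    using \<open>sqsum w \<le> wt w\<close> that by force
  show "cmod (w $ j) \<le> wt w"
  proof (cases "j = top_idx")
    case True
    thus ?thesis using I0 unfolding wt_def cmod_def
      by (auto intro!: real_sqrt_le_mono add_left_mono power_mono)
  next
    case False
    hence "(cmod (w $ j))\<^sup>2 \<le> wt w" using * below_top by blast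
    also have "\<dots> \<le> (wt w)\<^sup>2" using \<open>1 \<le> wt w\<close> by (simp add: power2_eq_square)
    finally show ?thesis using \<open>1 \<le> wt w\<close> by (simp add: power2_le_iff_abs_le)
  qed
qed

lemma base_pt_siegel: "(base_pt :: (complex, 'n::{finite,linorder}) vec) \<in> siegel"
proof -
  have "sqsum (base_pt :: (complex, 'n) vec) = 0"
    unfolding sqsum_def by (rule sum.neutral) (auto simp: base_pt_def axis_def)
  moreover have "(base_pt :: (complex, 'n) vec) $ top_idx = \<i>" by (simp add: base_pt_def axis_def)
  ultimately show ?thesis by (simp add: siegel_def rho_eq)
qed

lemma rho_axis:
  "rho (w + axis j c) = rho w + (if j = top_idx then Im c else - 2 * Re (cnj (w $ j) * c) - (cmod c)\<^sup>2)"
proof (cases "j = top_idx")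
  case True
  have "sqsum (w + axis j c) = sqsum w"
    using True by (auto simp: sqsum_def axis_def intro!: sum.cong)
  thus ?thesis using True by (simp add: rho_eq)
next
  case False
  have "sqsum (w + axis j c) = (\<Sum>i\<in>{..<top_idx}. (cmod (w $ i))\<^sup>2 + (if i = j then (cmod (w $ j + c))\<^sup>2 - (cmod (w $ j))\<^sup>2 else 0))"
    unfolding sqsum_def by (intro sum.cong) (auto simp: axis_def)
  also have "\<dots> = sqsum w + ((cmod (w $ j + c))\<^sup>2 - (cmod (w $ j))\<^sup>2)"
    using below_top[of j] False by (simp add: sum.distrib sqsum_def)
  also have "(cmod (w $ j + c))\<^sup>2 - (cmod (w $ j))\<^sup>2 = 2 * Re (cnj (w $ j) * c) + (cmod c)\<^sup>2"
    by (simp only: cmod_power2) (simp add: power2_eq_square algebra_simps)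
  finally show ?thesis using False by (simp add: rho_eq axis_def)
qed

lemma wt_axis_le: "\<bar>wt (w + axis j c) - wt w\<bar> \<le> cmod c"
proof (cases "j = top_idx")
  case True
  have "\<bar>cmod (w $ top_idx + c + \<i>) - cmod (w $ top_idx + \<i>)\<bar> \<le> cmod (w $ top_idx + c + \<i> - (w $ top_idx + \<i>))"
    by (rule norm_triangle_ineq3)
  thus ?thesis using True by (simp add: wt_def axis_def)
qed (simp add: wt_def axis_def)

text \<open>Moving a tangential coordinate by \<open>c\<close> changes \<open>rho\<close> to first
  order by \<open>2 * Re (cnj (w $ j) * c)\<close>, which is estimated through
  \<open>cmod (w $ j) \<le> wt w\<close>. So \<open>rho w / (4 * wt w)\<close> is a safe radius in
  every coordinate direction.\<close>

lemma rho_axis_bound: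
  fixes w :: "(complex, 'n::{finite,linorder}) vec"
  assumes "w \<in> siegel" "cmod c \<le> rho w / (4 * wt w)"
  shows "rho w / 4 \<le> rho (w + axis j c)" "rho (w + axis j c) \<le> 4 * rho w"
    "wt w / 4 \<le> wt (w + axis j c)" "wt (w + axis j c) \<le> 4 * wt w" "w + axis j c \<in> siegel"
proof -
  note s = siegelD[OF assms(1)]
  have 1: "cmod c * wt w \<le> rho w / 4" using assms(2) s(4) by (simp add: field_simps)
  have c0: "cmod c \<le> 1/4"
  proof -
    have "rho w / (4 * wt w) \<le> 1/4" using s(3,4) by (simp add: field_simps)
    thus ?thesis using assms(2) by linarith
  qed
  have c1: "cmod c \<le> rho w / 4"
    using 1 s(4) mult_left_mono[of 1 "wt w" "cmod c"] by simp
  have c2: "(cmod c)\<^sup>2 \<le> rho w / 16"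
  proof -
    have "cmod c * cmod c \<le> (1/4) * (rho w / 4)" by (intro mult_mono c0 c1) auto
    thus ?thesis by (simp add: power2_eq_square)
  qed
  have Re: "\<bar>Re (cnj (w $ j) * c)\<bar> \<le> rho w / 4"
  proof -
    have "\<bar>Re (cnj (w $ j) * c)\<bar> \<le> cmod (w $ j) * cmod c"
      by (metis abs_Re_le_cmod complex_mod_cnj norm_mult)
    also have "\<dots> \<le> wt w * cmod c" by (intro mult_right_mono s) auto
    finally show ?thesis using 1 by (simp add: mult.commute)
  qed
  have Im: "\<bar>Im c\<bar> \<le> rho w / 4" using abs_Im_le_cmod[of c] c1 by linarith
  have "rho w / 4 \<le> rho (w + axis j c) \<and> rho (w + axis j c) \<le> 4 * rho w"
  proof (cases "j = top_idx")
    case True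
    hence "rho (w + axis j c) = rho w + Im c" by (simp add: rho_axis)
    thus ?thesis using Im[unfolded abs_le_iff] s(1) by linarith
  next
    case False
    hence "rho (w + axis j c) = rho w - 2 * Re (cnj (w $ j) * c) - (cmod c)\<^sup>2" by (simp add: rho_axis)
    thus ?thesis using Re[unfolded abs_le_iff] c2 s(1) zero_le_power2[of "cmod c"] by linarith
  qed
  thus a: "rho w / 4 \<le> rho (w + axis j c)" "rho (w + axis j c) \<le> 4 * rho w" by auto
  show "w + axis j c \<in> siegel" using a s(1) by (simp add: siegel_def)
  show "wt w / 4 \<le> wt (w + axis j c)" "wt (w + axis j c) \<le> 4 * wt w"
    using wt_axis_le[of w j c] c0 s(4) by (auto simp: abs_le_iff)
qed

lemma powr_compare:
  assumes "0 < (x::real)" "x / 4 \<le> y" "y \<le> 4 * x"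
  shows "y powr e \<le> 4 powr \<bar>e\<bar> * x powr e"
proof (cases "e \<ge> 0")
  case True
  have "y powr e \<le> (4 * x) powr e" using assms True by (intro powr_mono2) auto
  thus ?thesis using True assms by (simp add: powr_mult)
next
  case False
  have "y powr e \<le> (x / 4) powr e" using assms False by (intro powr_mono2') auto
  also have "\<dots> = 4 powr \<bar>e\<bar> * x powr e" using assms False by (simp add: powr_divide powr_minus_divide)
  finally show ?thesis .
qed

text \<open>The exponent \<open>a\<close> records the behaviour at the boundary and \<open>p\<close>
  the behaviour at infinity. With this bookkeeping, estimates of products become additions of
  exponents, and integrability becomes an inequality between them.\<close>

definition growth :: "real \<Rightarrow> real \<Rightarrow> (complex ^ 'n::{finite,linorder} \<Rightarrow> complex) \<Rightarrow> bool" where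
  "growth a p h \<longleftrightarrow> (\<exists>C\<ge>0. \<forall>w\<in>siegel. cmod (h w) \<le> C * (rho w powr a * wt w powr p))"

lemma growthI: "(\<And>w. w \<in> siegel \<Longrightarrow> cmod (h w) \<le> C * (rho w powr a * wt w powr p)) \<Longrightarrow> growth a p h"
proof -
  assume h: "\<And>w. w \<in> siegel \<Longrightarrow> cmod (h w) \<le> C * (rho w powr a * wt w powr p)"
  have "C * (rho w powr a * wt w powr p) \<le> max C 0 * (rho w powr a * wt w powr p)" for w
    by (intro mult_right_mono) auto
  thus ?thesis unfolding growth_def using h by (intro exI[of _ "max C 0"]) (auto intro: order_trans)
qed

lemma growthE:
  assumes "growth a p h"
  obtains C where "C \<ge> 0" "\<And>w. w \<in> siegel \<Longrightarrow> cmod (h w) \<le> C * (rho w powr a * wt w powr p)"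
  using assms unfolding growth_def by blast

text \<open>The bound is best read as \<open>(rho w / wt w) powr a * wt w powr (a + p)\<close>. The
  ratio is at most 1 and \<open>wt w\<close> at least 1, so the boundary exponent \<open>a\<close>
  may be lowered and the total order \<open>a + p\<close> raised.\<close>

lemma growth_weaken:
  fixes h :: "(complex, 'n::{finite,linorder}) vec \<Rightarrow> complex"
  assumes "growth a p h" "a' \<le> a" "a + p \<le> a' + p'"
  shows "growth a' p' h"
proof -
  from assms(1) obtain C where C: "C \<ge> 0" "\<And>w. w \<in> siegel \<Longrightarrow> cmod (h w) \<le> C * (rho w powr a * wt w powr p)"
    by (rule growthE) (rule that)
  show ?thesis
  proof (rule growthI)
    fix w :: "(complex, 'n) vec" assume w: "w \<in> siegel"
    note s = siegelD[OF w]
    have "rho w powr a * wt w powr p = (rho w / wt w) powr a * wt w powr (a + p)"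
      using s by (simp add: powr_divide powr_add)
    also have "\<dots> \<le> (rho w / wt w) powr a' * wt w powr (a' + p')"
      using s assms by (intro mult_mono powr_mono powr_mono') auto
    also have "\<dots> = rho w powr a' * wt w powr p'"
      using s by (simp add: powr_divide powr_add)
    finally show "cmod (h w) \<le> C * (rho w powr a' * wt w powr p')"
      using C(2)[OF w] C(1) by (meson mult_left_mono order_trans)
  qed
qed

lemma growth_mult:
  fixes h :: "(complex, 'n::{finite,linorder}) vec \<Rightarrow> complex"
  assumes "growth a p h" "growth a' p' k"
  shows "growth (a + a') (p + p') (\<lambda>w. h w * k w)"
proof -
  from assms(1) obtain C where C: "C \<ge> 0" "\<And>w. w \<in> siegel \<Longrightarrow> cmod (h w) \<le> C * (rho w powr a * wt w powr p)"
    by (rule growthE) (rule that)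
  from assms(2) obtain D where D: "D \<ge> 0" "\<And>w. w \<in> siegel \<Longrightarrow> cmod (k w) \<le> D * (rho w powr a' * wt w powr p')"
    by (rule growthE) (rule that)
  show ?thesis
  proof (rule growthI[where C="C * D"])
    fix w :: "(complex, 'n) vec" assume w: "w \<in> siegel"
    have "cmod (h w) * cmod (k w) \<le> (C * (rho w powr a * wt w powr p)) * (D * (rho w powr a' * wt w powr p'))"
      using C D w by (intro mult_mono) auto
    thus "cmod (h w * k w) \<le> C * D * (rho w powr (a + a') * wt w powr (p + p'))"
      by (simp add: norm_mult powr_add mult_ac)
  qed
qed

lemma growth_add:
  fixes h :: "(complex, 'n::{finite,linorder}) vec \<Rightarrow> complex"
  assumes "growth a p h" "growth a p k"
  shows "growth a p (\<lambda>w. h w + k w)"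
proof -
  from assms(1) obtain C where C: "C \<ge> 0" "\<And>w. w \<in> siegel \<Longrightarrow> cmod (h w) \<le> C * (rho w powr a * wt w powr p)"
    by (rule growthE) (rule that)
  from assms(2) obtain D where D: "D \<ge> 0" "\<And>w. w \<in> siegel \<Longrightarrow> cmod (k w) \<le> D * (rho w powr a * wt w powr p)"
    by (rule growthE) (rule that)
  show ?thesis
  proof (rule growthI[where C="C + D"])
    fix w :: "(complex, 'n) vec" assume w: "w \<in> siegel"
    show "cmod (h w + k w) \<le> (C + D) * (rho w powr a * wt w powr p)"
      using norm_triangle_ineq[of "h w" "k w"] C(2)[OF w] D(2)[OF w] by (simp add: distrib_right)
  qed
qed

lemma growth_cong: "growth a p h \<Longrightarrow> (\<And>w. w \<in> siegel \<Longrightarrow> cmod (k w) \<le> cmod (h w)) \<Longrightarrow> growth a p k"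
proof -
  assume h: "growth a p h" and k: "\<And>w. w \<in> siegel \<Longrightarrow> cmod (k w) \<le> cmod (h w)"
  from h obtain C where C: "C \<ge> 0" "\<And>w. w \<in> siegel \<Longrightarrow> cmod (h w) \<le> C * (rho w powr a * wt w powr p)"
    by (rule growthE) (rule that)
  show ?thesis by (rule growthI) (rule order_trans[OF k C(2)])
qed

lemma growth_const: "growth 0 0 (\<lambda>w::(complex, 'n::{finite,linorder}) vec. c)"
proof (rule growthI[where C="cmod c"])
  fix w :: "(complex, 'n) vec" assume "w \<in> siegel"
  from siegelD(1,4)[OF this] show "cmod c \<le> cmod c * (rho w powr 0 * wt w powr 0)" by simp
qed

lemma growth_cmult: "growth a p h \<Longrightarrow> growth a p (\<lambda>w. c * h w)"
  using growth_mult[OF growth_const, of a p h c] by simp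

lemma growth_coord: "growth 0 1 (\<lambda>w::(complex, 'n::{finite,linorder}) vec. w $ j)"
proof (rule growthI[where C=1])
  fix w :: "(complex, 'n) vec" assume "w \<in> siegel"
  from siegelD(1,4,5)[OF this] show "cmod (w $ j) \<le> 1 * (rho w powr 0 * wt w powr 1)" by simp
qed

lemma growth_coord_diff: "growth 0 1 (\<lambda>w. w $ j - c)"
  using growth_add[OF growth_coord growth_weaken[OF growth_const, of 0 1 "-c"]] by simp

lemma growth_cnj: "growth a p h \<Longrightarrow> growth a p (\<lambda>w. cnj (h w))"
  by (rule growth_cong, assumption) simp

lemma growth_rho: "growth a 0 (\<lambda>w::(complex, 'n::{finite,linorder}) vec. of_real (rho w powr a))"
proof (rule growthI[where C=1])
  fix w :: "(complex, 'n) vec" assume "w \<in> siegel"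
  from siegelD(1,4)[OF this] show "cmod (of_real (rho w powr a)) \<le> 1 * (rho w powr a * wt w powr 0)" by simp
qed

lemma cdiff_axis: "holo_on h S \<Longrightarrow> w \<in> S \<Longrightarrow> cdiff h w (axis j c) = c * pd j h w"
  by (subst axis_eq_smult) (simp add: cdiff_smult pd_eq_cdiff)

text \<open>Cauchy's estimate on the disc of \<open>rho_axis_bound\<close>. Its radius is of size
  \<open>rho w / wt w\<close>, which is why a derivative costs one power of each weight; in the top
  direction \<open>growth_pd_top\<close> does better.\<close>

lemma growth_pd:
  fixes h :: "(complex, 'n::{finite,linorder}) vec \<Rightarrow> complex"
  assumes hol: "holo_on h siegel" and gr: "growth a p h"
  shows "growth (a - 1) (p + 1) (pd j h)"
proof -
  from gr obtain C where C: "C \<ge> 0" "\<And>w. w \<in> siegel \<Longrightarrow> cmod (h w) \<le> C * (rho w powr a * wt w powr p)"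
    by (rule growthE) (rule that)
  show ?thesis
  proof (rule growthI)
    fix w :: "(complex, 'n) vec" assume w: "w \<in> siegel"
    note s = siegelD[OF w]
    define r where "r = rho w / (4 * wt w)"
    have r: "r > 0" using s by (simp add: r_def)
    have ax: "\<xi> *s axis j 1 = axis j \<xi>" for \<xi> :: complex by (rule axis_eq_smult[symmetric])
    have "cmod (cdiff h w (axis j 1)) \<le> C * ((4 powr \<bar>a\<bar> * rho w powr a) * (4 powr \<bar>p\<bar> * wt w powr p)) / r"
    proof (rule cauchy_line[OF hol r])
      fix \<xi> assume \<xi>: "cmod \<xi> \<le> r"
      note b = rho_axis_bound[OF w \<xi>[unfolded r_def], of j]
      show S: "w + \<xi> *s axis j 1 \<in> siegel" using b by (simp add: ax)
      have "cmod (h (w + axis j \<xi>)) \<le> C * (rho (w + axis j \<xi>) powr a * wt (w + axis j \<xi>) powr p)"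
        by (rule C(2)) (rule b(5))
      also have "\<dots> \<le> C * ((4 powr \<bar>a\<bar> * rho w powr a) * (4 powr \<bar>p\<bar> * wt w powr p))"
        by (rule mult_left_mono[OF mult_mono[OF powr_compare[OF s(1) b(1,2)] powr_compare[OF _ b(3,4)]]])
          (use s(4) C(1) in auto)
      finally show "cmod (h (w + \<xi> *s axis j 1)) \<le> C * ((4 powr \<bar>a\<bar> * rho w powr a) * (4 powr \<bar>p\<bar> * wt w powr p))"
        by (simp add: ax)
    qed
    also have "\<dots> = (C * (4 powr \<bar>a\<bar> * 4 powr \<bar>p\<bar> * 4)) * ((rho w powr a / rho w) * (wt w powr p * wt w))"
      by (simp add: r_def)
    also have "rho w powr a / rho w = rho w powr (a - 1)" using s by (simp add: powr_diff)
    also have "wt w powr p * wt w = wt w powr (p + 1)" using s by (simp add: powr_add)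
    finally show "cmod (pd j h w) \<le> (C * (4 powr \<bar>a\<bar> * 4 powr \<bar>p\<bar> * 4)) * (rho w powr (a - 1) * wt w powr (p + 1))"
      by (simp add: pd_eq_cdiff)
  qed
qed

lemma set_integrable_siegel_weight:
  assumes "a > -1" "- p > real CARD('n) + 1 + a"
  shows "set_integrable lborel (siegel :: (complex ^ ('n::{finite,linorder})) set) (\<lambda>w. rho w powr a * wt w powr p)"
  unfolding set_integrable_def
proof (rule integrableI_nonneg)
  show "(\<integral>\<^sup>+ w. ennreal (indicator siegel w *\<^sub>R (rho w powr a * wt w powr p)) \<partial>(lborel :: (complex, 'n) vec measure)) < \<infinity>"
    using nn_integral_siegel_moment[OF assms] by simp
qed (auto simp: indicator_def)

text \<open>The two inequalities exclude equality, and equality in the second is precisely what one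
  kernel with its weight offers, having \<open>a = l\<close> and \<open>p = - (n + 1 + l)\<close>.
  Any bounded factor must bring some additional decay.\<close>

lemma set_integrable_growth:
  fixes h :: "(complex, 'n::{finite,linorder}) vec \<Rightarrow> complex"
  assumes cont: "continuous_on siegel h" and gr: "growth a p h"
    and a: "a > -1" "- p > real CARD('n) + 1 + a"
  shows "set_integrable lborel siegel h"
proof -
  from gr obtain C where C: "C \<ge> 0" "\<And>w. w \<in> siegel \<Longrightarrow> cmod (h w) \<le> C * (rho w powr a * wt w powr p)"
    by (rule growthE) (rule that)
  have "set_integrable lborel siegel (\<lambda>w::(complex, 'n) vec. C * (rho w powr a * wt w powr p))"
    using set_integrable_siegel_weight[OF a] by (intro set_integrable_mult_right)
  moreover have "set_borel_measurable lborel siegel h"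
    unfolding set_borel_measurable_def
    by (simp, rule borel_measurable_continuous_on_indicator[OF _ cont]) simp
  ultimately show ?thesis
    by (rule set_integrable_bound) (use C in \<open>auto intro!: AE_I2 simp: siegelD(1) less_imp_le\<close>)
qed

section \<open>Integration by parts\<close>

text \<open>This is \<open>x powr \<mu>\<close> times the square of
  \<open>x / (x + \<epsilon>)\<close>, a factor tending to 1 as \<open>\<epsilon>\<close> tends to
  0. For fixed \<open>\<epsilon>\<close> it adds two orders of vanishing at 0, which lifts a total
  exponent above -1 to one above 1.\<close>

definition cutoff :: "real \<Rightarrow> real \<Rightarrow> real \<Rightarrow> real" where
  "cutoff \<mu> \<epsilon> x = x powr (\<mu> + 2) / (x + \<epsilon>)\<^sup>2"

definition cutoff' :: "real \<Rightarrow> real \<Rightarrow> real \<Rightarrow> real" where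
  "cutoff' \<mu> \<epsilon> x = (\<mu> + 2) * x powr (\<mu> + 1) / (x + \<epsilon>)\<^sup>2 - 2 * x powr (\<mu> + 2) / (x + \<epsilon>) ^ 3"

lemma cutoff_deriv:
  assumes "x > 0" "\<epsilon> > 0"
  shows "(cutoff \<mu> \<epsilon> has_real_derivative cutoff' \<mu> \<epsilon> x) (at x)"
proof -
  have "((\<lambda>x. x powr (\<mu> + 2) / (x + \<epsilon>)\<^sup>2) has_real_derivative
     (((\<mu> + 2) * x powr (\<mu> + 2 - 1)) * (x + \<epsilon>)\<^sup>2 - x powr (\<mu> + 2) * (2 * (x + \<epsilon>))) / ((x + \<epsilon>)\<^sup>2 * (x + \<epsilon>)\<^sup>2)) (at x)"
    using assms by (auto intro!: derivative_eq_intros)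
  moreover have "(((\<mu> + 2) * x powr (\<mu> + 2 - 1)) * (x + \<epsilon>)\<^sup>2 - x powr (\<mu> + 2) * (2 * (x + \<epsilon>))) / ((x + \<epsilon>)\<^sup>2 * (x + \<epsilon>)\<^sup>2)
     = cutoff' \<mu> \<epsilon> x"
  proof -
    obtain y where y: "x + \<epsilon> = y" "y \<noteq> 0" using assms by auto
    have "\<mu> + 2 - 1 = \<mu> + 1" by simp
    thus ?thesis unfolding cutoff'_def y(1) using y(2)
      by (simp add: diff_divide_distrib power2_eq_square power3_eq_cube add.commute mult_ac)
  qed
  ultimately show ?thesis unfolding cutoff_def[abs_def] by simp
qed

text \<open>The bounds free of \<open>\<epsilon>\<close> dominate the passage to the limit. Those
  with \<open>\<epsilon>\<close> in the denominator trade it for extra powers of \<open>x\<close>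
  and serve the integration by parts at fixed \<open>\<epsilon>\<close>.\<close>

lemma cutoff_bounds:
  assumes x: "x > 0" and \<epsilon>: "\<epsilon> > 0"
  shows "0 \<le> cutoff \<mu> \<epsilon> x" "cutoff \<mu> \<epsilon> x \<le> x powr \<mu>" "cutoff \<mu> \<epsilon> x \<le> x powr (\<mu> + 1) / \<epsilon>"
    "cutoff \<mu> \<epsilon> x \<le> x powr (\<mu> + 2) / \<epsilon>\<^sup>2"
    "\<bar>cutoff' \<mu> \<epsilon> x\<bar> \<le> (\<bar>\<mu> + 2\<bar> + 2) * x powr \<mu> / \<epsilon>" "\<bar>cutoff' \<mu> \<epsilon> x\<bar> \<le> (\<bar>\<mu> + 2\<bar> + 2) * x powr (\<mu> - 1)"
proof -
  have p: "x powr (\<mu> + 1) = x powr \<mu> * x" "x powr (\<mu> + 2) = x powr \<mu> * x\<^sup>2" "x powr (\<mu> - 1) = x powr \<mu> / x"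
    using x by (simp_all add: powr_add powr_diff)
  have pos: "x + \<epsilon> > 0" using x \<epsilon> by simp
  have s: "x\<^sup>2 \<le> (x + \<epsilon>)\<^sup>2" "x * \<epsilon> \<le> (x + \<epsilon>)\<^sup>2" "\<epsilon>\<^sup>2 \<le> (x + \<epsilon>)\<^sup>2"
    using x \<epsilon> by (auto simp: power2_eq_square algebra_simps)
  show "0 \<le> cutoff \<mu> \<epsilon> x" by (simp add: cutoff_def)
  show "cutoff \<mu> \<epsilon> x \<le> x powr \<mu>"
    using s(1) pos by (simp add: cutoff_def p divide_le_eq mult_left_mono)
  have "x\<^sup>2 / (x + \<epsilon>)\<^sup>2 \<le> x\<^sup>2 / (x * \<epsilon>)" using s(2) x \<epsilon> by (intro divide_left_mono) auto
  also have "\<dots> = x / \<epsilon>" using x by (simp add: power2_eq_square)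
  finally have a: "x\<^sup>2 / (x + \<epsilon>)\<^sup>2 \<le> x / \<epsilon>" .
  show "cutoff \<mu> \<epsilon> x \<le> x powr (\<mu> + 1) / \<epsilon>"
    using mult_left_mono[OF a, of "x powr \<mu>"] by (simp add: cutoff_def p)
  show "cutoff \<mu> \<epsilon> x \<le> x powr (\<mu> + 2) / \<epsilon>\<^sup>2"
    unfolding cutoff_def using s(3) pos \<epsilon> by (intro divide_left_mono) auto
  have key: "\<bar>cutoff' \<mu> \<epsilon> x\<bar> \<le> (\<bar>\<mu> + 2\<bar> + 2) * (x powr \<mu> * (x / (x + \<epsilon>)\<^sup>2))"
  proof -
    have "x powr (\<mu> + 2) / (x + \<epsilon>) ^ 3 = x powr \<mu> * (x / (x + \<epsilon>)\<^sup>2) * (x / (x + \<epsilon>))"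
      by (simp add: p power2_eq_square power3_eq_cube)
    also have "\<dots> \<le> x powr \<mu> * (x / (x + \<epsilon>)\<^sup>2) * 1"
      using x \<epsilon> by (intro mult_left_mono) auto
    finally have 1: "x powr (\<mu> + 2) / (x + \<epsilon>) ^ 3 \<le> x powr \<mu> * (x / (x + \<epsilon>)\<^sup>2)" by simp
    have 2: "x powr (\<mu> + 2) / (x + \<epsilon>) ^ 3 \<ge> 0" using pos by simp
    have "\<bar>cutoff' \<mu> \<epsilon> x\<bar> \<le> \<bar>(\<mu> + 2) * x powr (\<mu> + 1) / (x + \<epsilon>)\<^sup>2\<bar> + \<bar>2 * x powr (\<mu> + 2) / (x + \<epsilon>) ^ 3\<bar>"
      unfolding cutoff'_def by (rule abs_triangle_ineq4)
    also have "\<bar>(\<mu> + 2) * x powr (\<mu> + 1) / (x + \<epsilon>)\<^sup>2\<bar> = \<bar>\<mu> + 2\<bar> * (x powr \<mu> * (x / (x + \<epsilon>)\<^sup>2))"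
      using x by (simp add: p abs_mult)
    also have "\<bar>2 * x powr (\<mu> + 2) / (x + \<epsilon>) ^ 3\<bar> = 2 * (x powr (\<mu> + 2) / (x + \<epsilon>) ^ 3)"
      by (subst abs_of_nonneg) (use pos in auto)
    finally show ?thesis unfolding distrib_right using 1 by linarith
  qed
  have "x / (x + \<epsilon>)\<^sup>2 \<le> x / (x * \<epsilon>)" using s(2) x \<epsilon> by (intro divide_left_mono) auto
  also have "\<dots> = 1 / \<epsilon>" using x by simp
  finally have b: "x / (x + \<epsilon>)\<^sup>2 \<le> 1 / \<epsilon>" .
  have "x / (x + \<epsilon>)\<^sup>2 \<le> x / x\<^sup>2" using s(1) x \<epsilon> by (intro divide_left_mono) auto
  also have "\<dots> = 1 / x" using x by (simp add: power2_eq_square)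
  finally have c: "x / (x + \<epsilon>)\<^sup>2 \<le> 1 / x" .
  have "(\<bar>\<mu> + 2\<bar> + 2) * (x powr \<mu> * (x / (x + \<epsilon>)\<^sup>2)) \<le> (\<bar>\<mu> + 2\<bar> + 2) * (x powr \<mu> * (1 / \<epsilon>))"
    by (intro mult_left_mono b) auto
  thus "\<bar>cutoff' \<mu> \<epsilon> x\<bar> \<le> (\<bar>\<mu> + 2\<bar> + 2) * x powr \<mu> / \<epsilon>" using key by simp
  have "(\<bar>\<mu> + 2\<bar> + 2) * (x powr \<mu> * (x / (x + \<epsilon>)\<^sup>2)) \<le> (\<bar>\<mu> + 2\<bar> + 2) * (x powr \<mu> * (1 / x))"
    by (intro mult_left_mono c) auto
  thus "\<bar>cutoff' \<mu> \<epsilon> x\<bar> \<le> (\<bar>\<mu> + 2\<bar> + 2) * x powr (\<mu> - 1)" using key by (simp add: p)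
qed

text \<open>Meant for base points outside the open half-space, its boundary included. There a
  function extended by zero is known only through its size along the line, and an exponent above 1
  makes the difference quotient vanish.\<close>

lemma has_vector_derivative_0_of_powr_bound:
  fixes G :: "real \<Rightarrow> complex"
  assumes m: "m > 1" and b: "\<And>t. \<bar>t\<bar> < 1 \<Longrightarrow> cmod (G t) \<le> K * \<bar>t\<bar> powr m"
  shows "(G has_vector_derivative 0) (at 0)"
proof -
  have G0: "G 0 = 0" using b[of 0] m by simp
  have "((\<lambda>t. norm (G t) / norm t) \<longlongrightarrow> 0) (at 0)"
  proof (rule tendsto_sandwich[OF _ _ tendsto_const])
    show "\<forall>\<^sub>F t in at 0. norm (G t) / norm t \<le> K * \<bar>t\<bar> powr (m - 1)"
      unfolding eventually_at
    proof (intro exI[of _ 1] conjI ballI impI)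
      fix t :: real assume t: "t \<noteq> 0 \<and> dist t 0 < 1"
      have "norm (G t) / norm t \<le> K * \<bar>t\<bar> powr m / \<bar>t\<bar>"
        using b[of t] t by (simp add: divide_right_mono)
      thus "norm (G t) / norm t \<le> K * \<bar>t\<bar> powr (m - 1)" using t by (simp add: powr_diff)
    qed simp
    have "((\<lambda>t. K * \<bar>t\<bar> powr (m - 1)) \<longlongrightarrow> K * \<bar>0\<bar> powr (m - 1)) (at (0::real))"
      using m by (intro tendsto_intros) auto
    thus "((\<lambda>t. K * \<bar>t\<bar> powr (m - 1)) \<longlongrightarrow> 0) (at (0::real))" using m by simp
  qed (auto intro!: always_eventually)
  thus ?thesis
    unfolding has_vector_derivative_def has_derivative_iff_norm by (simp add: G0 bounded_linear_zero)
qed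

definition rho_dir :: "'n::{finite,linorder} \<Rightarrow> complex \<Rightarrow> complex ^ 'n::{finite,linorder} \<Rightarrow> real" where
  "rho_dir j c w = (if j = top_idx then Im c else - 2 * Re (cnj (w $ j) * c))"

lemma scaleR_axis: "t *\<^sub>R axis j (c::complex) = axis j (of_real t * c)"
  by (simp add: vec_eq_iff axis_def scaleR_conv_of_real[where 'a=complex])

lemma rho_line_deriv: "((\<lambda>t. rho (w + t *\<^sub>R axis j c)) has_real_derivative rho_dir j c w) (at 0)"
proof -
  have "rho (w + t *\<^sub>R axis j c) = rho w + t * rho_dir j c w - (if j = top_idx then 0 else t\<^sup>2 * (cmod c)\<^sup>2)" for t
    unfolding scaleR_axis rho_axis rho_dir_def by (simp add: norm_mult power_mult_distrib algebra_simps)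
  thus ?thesis by (cases "j = top_idx") (auto intro!: derivative_eq_intros)
qed

lemma holo_real_line_deriv:
  assumes "holo_on h S" "w \<in> S"
  shows "((\<lambda>t. h (w + t *\<^sub>R axis j c)) has_vector_derivative c * pd j h w) (at 0)"
proof -
  have "((\<lambda>\<xi>. h (w + \<xi> *s axis j c)) has_field_derivative c * pd j h w) (at (of_real 0))"
    using holo_line_deriv[OF assms(1), of w 0 "axis j c"] assms by (simp add: cdiff_axis)
  from has_vector_derivative_real_field[OF this, of UNIV] show ?thesis
    by (simp add: scaleR_eq_smult)
qed

lemma growth_rho_dir: "growth 0 1 (\<lambda>w. of_real (rho_dir j c w))"
proof (rule growthI[where C="2 * cmod c"])
  fix w :: "(complex, 'a) vec" assume "w \<in> siegel"
  note s = siegelD[OF this]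
  have "\<bar>Re (cnj (w $ j) * c)\<bar> \<le> cmod (w $ j) * cmod c"
    by (metis abs_Re_le_cmod complex_mod_cnj norm_mult)
  also have "\<dots> \<le> wt w * cmod c" by (intro mult_right_mono s) auto
  finally have 1: "\<bar>Re (cnj (w $ j) * c)\<bar> \<le> wt w * cmod c" .
  have "\<bar>Im c\<bar> \<le> wt w * cmod c"
    using abs_Im_le_cmod[of c] mult_right_mono[OF s(4), of "cmod c"] by simp
  hence "\<bar>rho_dir j c w\<bar> \<le> 2 * (wt w * cmod c)"
    using 1 s(4) by (auto simp: rho_dir_def abs_mult)
  thus "cmod (of_real (rho_dir j c w)) \<le> 2 * cmod c * (rho w powr 0 * wt w powr 1)"
    using s by (simp add: mult_ac)
qed

lemma continuous_on_cutoff: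
  assumes "\<epsilon> > 0"
  shows "continuous_on siegel (\<lambda>w::(complex, 'n::{finite,linorder}) vec. cutoff \<mu> \<epsilon> (rho w))"
    "continuous_on siegel (\<lambda>w::(complex, 'n) vec. cutoff' \<mu> \<epsilon> (rho w))"
proof -
  have nz: "rho w \<noteq> 0" "rho w + \<epsilon> \<noteq> 0" if "w \<in> siegel" for w :: "(complex, 'n) vec"
    using siegelD(1)[OF that] assms by auto
  show "continuous_on siegel (\<lambda>w::(complex, 'n) vec. cutoff \<mu> \<epsilon> (rho w))"
    unfolding cutoff_def by (intro continuous_intros ballI) (use nz in auto)
  show "continuous_on siegel (\<lambda>w::(complex, 'n) vec. cutoff' \<mu> \<epsilon> (rho w))"
    unfolding cutoff'_def by (intro continuous_intros ballI) (use nz in auto)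
qed

lemma continuous_on_rho_dir: "continuous_on S (rho_dir j c)"
  unfolding rho_dir_def[abs_def] by (cases "j = top_idx") (auto intro!: continuous_intros)

lemma growth_cutoff:
  assumes "\<epsilon> > 0"
  shows "growth \<mu> 0 (\<lambda>w::(complex, 'a::{finite,linorder}) vec. of_real (cutoff \<mu> \<epsilon> (rho w)))" "growth (\<mu> + 1) 0 (\<lambda>w::(complex, 'a) vec. of_real (cutoff \<mu> \<epsilon> (rho w)))"
    "growth (\<mu> + 2) 0 (\<lambda>w::(complex, 'a) vec. of_real (cutoff \<mu> \<epsilon> (rho w)))" "growth \<mu> 0 (\<lambda>w::(complex, 'a) vec. of_real (cutoff' \<mu> \<epsilon> (rho w)))"
proof -
  have w0: "wt w powr 0 = 1" "rho w > 0" if "w \<in> siegel" for w :: "(complex, 'a) vec"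
    using siegelD(1,4)[OF that] by auto
  note b = cutoff_bounds[OF w0(2) assms]
  show "growth \<mu> 0 (\<lambda>w::(complex, 'a) vec. of_real (cutoff \<mu> \<epsilon> (rho w)))"
    by (rule growthI[where C=1]) (use b(1,2) w0 in auto)
  show "growth (\<mu> + 1) 0 (\<lambda>w::(complex, 'a) vec. of_real (cutoff \<mu> \<epsilon> (rho w)))"
    by (rule growthI[where C="1 / \<epsilon>"]) (use b(1,3) w0 in auto)
  show "growth (\<mu> + 2) 0 (\<lambda>w::(complex, 'a) vec. of_real (cutoff \<mu> \<epsilon> (rho w)))"
    by (rule growthI[where C="1 / \<epsilon>\<^sup>2"]) (use b(1,4) w0 in auto)
  show "growth \<mu> 0 (\<lambda>w::(complex, 'a) vec. of_real (cutoff' \<mu> \<epsilon> (rho w)))"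
    by (rule growthI[where C="(\<bar>\<mu> + 2\<bar> + 2) / \<epsilon>"]) (use b(5) w0 in auto)
qed


lemma has_vector_derivative_cnj':
  "(f has_vector_derivative f') F \<Longrightarrow> ((\<lambda>t. cnj (f t)) has_vector_derivative cnj f') F"
  by (rule bounded_linear.has_vector_derivative[OF bounded_linear_cnj])

text \<open>Integration by parts against the antiholomorphic derivative in the coordinate \<open>j\<close>: the
  derivatives of \<open>h\<close> cancel, and the cutoff makes the product differentiable across the boundary.\<close>

lemma dbar_by_parts_cutoff:
  fixes b h :: "(complex, 'n::{finite,linorder}) vec \<Rightarrow> complex" and j :: 'n
  assumes b: "holo_on b siegel" "growth a1 p1 b" and h: "holo_on h siegel" "growth a2 p2 h"
    and \<epsilon>: "\<epsilon> > 0" and \<mu>: "\<mu> + (a1 + a2) > -1" "- (p1 + p2 + 1) > real CARD('n) + 1 + (\<mu> + (a1 + a2))"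
  defines "\<Phi> \<equiv> \<lambda>w. of_real (cutoff' \<mu> \<epsilon> (rho w)) * ((if j = top_idx then \<i> else - 2 * w $ j) * (cnj (b w) * h w))
     + of_real (cutoff \<mu> \<epsilon> (rho w)) * (2 * cnj (pd j b w) * h w)"
  shows "set_integrable lborel siegel \<Phi>" "(LINT w:siegel|lborel. \<Phi> w) = 0"
proof -
  define a where "a = a1 + a2"
  define p where "p = p1 + p2"
  define G where "G w = of_real (cutoff \<mu> \<epsilon> (rho w)) * (cnj (b w) * h w)" for w
  \<comment> \<open>\<open>D c\<close> is the derivative of \<open>G\<close> in the real direction
    \<open>axis j c\<close>. The operator \<open>z\<close> below extends by zero, since the
    directional derivative has to be taken on the whole space.\<close>
  define D where "D c w = of_real (cutoff' \<mu> \<epsilon> (rho w)) * (of_real (rho_dir j c w) * (cnj (b w) * h w))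
    + of_real (cutoff \<mu> \<epsilon> (rho w)) * (cnj (c * pd j b w) * h w + cnj (b w) * (c * pd j h w))" for c w
  define z where "z f w = indicator siegel w *\<^sub>R (f w :: complex)" for f and w :: "(complex, 'n) vec"
  note conts = holo_continuous_on[OF b(1)] holo_continuous_on[OF h(1)]
    holo_continuous_on[OF holo_on_pd[OF b(1) open_siegel]] holo_continuous_on[OF holo_on_pd[OF h(1) open_siegel]]
    continuous_on_cutoff[OF \<epsilon>] continuous_on_rho_dir
  have bh: "growth a p (\<lambda>w. cnj (b w) * h w)"
    unfolding a_def p_def by (intro growth_mult growth_cnj b h)
  have dbh: "growth (a - 1) (p + 1) (\<lambda>w. cnj (c * pd j b w) * h w + cnj (b w) * (c * pd j h w))" for c
  proof (rule growth_add)
    have "growth ((a1 - 1) + a2) ((p1 + 1) + p2) (\<lambda>w. cnj (c * pd j b w) * h w)"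
      by (intro growth_mult growth_cnj growth_cmult growth_pd b h)
    thus "growth (a - 1) (p + 1) (\<lambda>w. cnj (c * pd j b w) * h w)" by (simp add: a_def p_def algebra_simps)
    have "growth (a1 + (a2 - 1)) (p1 + (p2 + 1)) (\<lambda>w. cnj (b w) * (c * pd j h w))"
      by (intro growth_mult growth_cnj growth_cmult growth_pd b h)
    thus "growth (a - 1) (p + 1) (\<lambda>w. cnj (b w) * (c * pd j h w))" by (simp add: a_def p_def algebra_simps)
  qed
  have Ggr: "growth (\<mu> + a) p G" "growth (\<mu> + 2 + a) p G"
    unfolding G_def[abs_def] using growth_mult[OF growth_cutoff(1)[OF \<epsilon>] bh] growth_mult[OF growth_cutoff(3)[OF \<epsilon>] bh]
    by simp_all
  have Gint: "integrable lborel (z G)"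
  proof -
    have "set_integrable lborel siegel G"
    proof (rule set_integrable_growth)
      show "continuous_on siegel G" unfolding G_def[abs_def] by (intro continuous_intros conts)
      show "growth (\<mu> + a) (p + 1) G" by (rule growth_weaken[OF Ggr(1)]) auto
    qed (use \<mu> in \<open>auto simp: a_def p_def\<close>)
    thus ?thesis by (simp add: set_integrable_def z_def[abs_def])
  qed
  have Dset: "set_integrable lborel siegel (D c)" for c
  proof (rule set_integrable_growth)
    show "continuous_on siegel (D c)" unfolding D_def[abs_def] by (intro continuous_intros conts)
    have "growth (\<mu> + (0 + a)) (0 + (1 + p)) (\<lambda>w. of_real (cutoff' \<mu> \<epsilon> (rho w)) * (of_real (rho_dir j c w) * (cnj (b w) * h w)))"
      by (intro growth_mult growth_cutoff \<epsilon> growth_rho_dir bh)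
    moreover have "growth ((\<mu> + 1) + (a - 1)) (0 + (p + 1)) (\<lambda>w. of_real (cutoff \<mu> \<epsilon> (rho w)) * (cnj (c * pd j b w) * h w + cnj (b w) * (c * pd j h w)))"
      by (intro growth_mult growth_cutoff \<epsilon> dbh)
    ultimately show "growth (\<mu> + a) (p + 1) (D c)"
      unfolding D_def[abs_def] by (intro growth_add) (simp_all add: add.commute)
  qed (use \<mu> in \<open>auto simp: a_def p_def\<close>)
  have Dint: "integrable lborel (z (D c))" for c
    using Dset[of c] by (simp add: set_integrable_def z_def[abs_def])
  have der: "((\<lambda>t. z G (w + t *\<^sub>R axis j c)) has_vector_derivative z (D c) w) (at 0)" for c w
  proof (cases "w \<in> siegel")
    case True
    have "((\<lambda>t. cutoff \<mu> \<epsilon> (rho (w + t *\<^sub>R axis j c))) has_real_derivative cutoff' \<mu> \<epsilon> (rho w) * rho_dir j c w) (at 0)"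
      by (rule DERIV_chain2[where g="\<lambda>t. rho (w + t *\<^sub>R axis j c)"]) (use cutoff_deriv[OF siegelD(1)[OF True] \<epsilon>] rho_line_deriv in auto)
    hence 1: "((\<lambda>t. of_real (cutoff \<mu> \<epsilon> (rho (w + t *\<^sub>R axis j c)))) has_vector_derivative
        complex_of_real (cutoff' \<mu> \<epsilon> (rho w) * rho_dir j c w)) (at 0)"
      by (intro has_vector_derivative_of_real) (simp add: has_real_derivative_iff_has_vector_derivative)
    note 2 = has_vector_derivative_cnj'[OF holo_real_line_deriv[OF b(1) True, of j c]]
    note 3 = holo_real_line_deriv[OF h(1) True, of j c]
    have "((\<lambda>t. G (w + t *\<^sub>R axis j c)) has_vector_derivative D c w) (at 0)"
      using has_vector_derivative_mult[OF 1 has_vector_derivative_mult[OF 2 3]]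
      unfolding G_def D_def by (simp add: algebra_simps)
    moreover have "open ((\<lambda>t. w + t *\<^sub>R axis j c) -` siegel)"
      by (intro open_vimage[OF open_siegel] continuous_intros)
    ultimately have "((\<lambda>t. z G (w + t *\<^sub>R axis j c)) has_vector_derivative D c w) (at 0)"
      by (rule has_vector_derivative_transform_within_open) (use True in \<open>auto simp: z_def\<close>)
    thus ?thesis using True by (simp add: z_def)
  next
    case False
    \<comment> \<open>Here \<open>rho w \<le> 0\<close>, so on the line \<open>rho\<close> is at
      most \<open>t * rho_dir j c w\<close>, the quadratic term only lowering it. The zero extension
      of \<open>G\<close> is thus of order \<open>\<bar>t\<bar> powr (\<mu> + 2 + a)\<close>, and
      the cutoff has made this exponent exceed 1.\<close>
    from Ggr(2) obtain C where C: "C \<ge> 0" "\<And>w. w \<in> siegel \<Longrightarrow> cmod (G w) \<le> C * (rho w powr (\<mu> + 2 + a) * wt w powr p)"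
      by (rule growthE) (rule that)
    define L where "L = \<bar>rho_dir j c w\<bar>"
    define M where "M = (wt w + cmod c) powr \<bar>p\<bar>"
    have "((\<lambda>t. z G (w + t *\<^sub>R axis j c)) has_vector_derivative 0) (at 0)"
    proof (rule has_vector_derivative_0_of_powr_bound[where m="\<mu> + 2 + a" and K="C * (L powr (\<mu> + 2 + a) * M)"])
      show "\<mu> + 2 + a > 1" using \<mu> by (simp add: a_def)
      fix t :: real assume t: "\<bar>t\<bar> < 1"
      let ?w = "w + t *\<^sub>R axis j c"
      show "cmod (z G ?w) \<le> C * (L powr (\<mu> + 2 + a) * M) * \<bar>t\<bar> powr (\<mu> + 2 + a)"
      proof (cases "?w \<in> siegel")
        case w': True
        note s = siegelD[OF w']
        have "rho ?w \<le> t * rho_dir j c w"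
        proof -
          have "rho w \<le> t\<^sup>2 * (cmod c)\<^sup>2" "rho w \<le> 0"
            using False order_trans[of "rho w" 0 "t\<^sup>2 * (cmod c)\<^sup>2"] by (auto simp: siegel_def)
          thus ?thesis unfolding scaleR_axis rho_axis rho_dir_def
            by (auto simp: algebra_simps norm_mult)
        qed
        also have "\<dots> \<le> L * \<bar>t\<bar>" unfolding L_def by (metis abs_ge_self abs_mult mult.commute)
        finally have r: "rho ?w powr (\<mu> + 2 + a) \<le> L powr (\<mu> + 2 + a) * \<bar>t\<bar> powr (\<mu> + 2 + a)"
          using s(1) \<mu> by (subst powr_mult[symmetric]) (auto simp: a_def L_def intro!: powr_mono2)
        have "wt ?w \<le> wt w + cmod (of_real t * c)"
          using wt_axis_le[of w j "of_real t * c"] unfolding scaleR_axis by linarith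
        also have "\<dots> \<le> wt w + cmod c" using t by (auto simp: norm_mult mult_left_le_one_le)
        finally have wt: "wt ?w \<le> wt w + cmod c" .
        have "wt ?w powr p \<le> wt ?w powr \<bar>p\<bar>" using s(4) by (intro powr_mono) auto
        also have "\<dots> \<le> M" unfolding M_def using wt s(4) by (intro powr_mono2) auto
        finally have q: "wt ?w powr p \<le> M" .
        have "cmod (z G ?w) \<le> C * (rho ?w powr (\<mu> + 2 + a) * wt ?w powr p)"
          using C(2)[OF w'] w' by (simp add: z_def)
        also have "\<dots> \<le> C * ((L powr (\<mu> + 2 + a) * \<bar>t\<bar> powr (\<mu> + 2 + a)) * M)"
          by (intro mult_left_mono mult_mono r q C) auto
        finally show ?thesis by (simp add: mult_ac)
      qed (use C in \<open>simp add: z_def M_def\<close>)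
    qed
    thus ?thesis using False by (simp add: z_def)
  qed
  have zero: "(LINT w|lborel. z (D c) w) = 0" for c
    by (rule integral_directional_derivative_eq_0[OF Gint Dint der])
  \<comment> \<open>\<open>D 1 + \<i> * D \<i>\<close> is twice the antiholomorphic derivative: the
    derivatives of \<open>h\<close> enter with the factors 1 and \<open>\<i> * \<i>\<close> and
    cancel, those of \<open>cnj (b w)\<close> with 1 and \<open>\<i> * cnj \<i>\<close> and add
    up.\<close>
  have "(LINT w|lborel. z (D 1) w + \<i> * z (D \<i>) w) = 0"
    using Dint by (subst Bochner_Integration.integral_add) (auto simp: zero)
  moreover have "integrable lborel (\<lambda>w. z (D 1) w + \<i> * z (D \<i>) w)"
    using Dint by auto
  moreover have "z (D 1) w + \<i> * z (D \<i>) w = indicator siegel w *\<^sub>R \<Phi> w" for w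
  proof -
    have e: "of_real (rho_dir j 1 w) + \<i> * of_real (rho_dir j \<i> w) = (if j = top_idx then \<i> else - 2 * w $ j)"
      by (simp add: rho_dir_def complex_eq_iff)
    have "D 1 w + \<i> * D \<i> w = of_real (cutoff' \<mu> \<epsilon> (rho w)) * ((if j = top_idx then \<i> else - 2 * w $ j) * (cnj (b w) * h w))
     + of_real (cutoff \<mu> \<epsilon> (rho w)) * (2 * cnj (pd j b w) * h w)"
      unfolding D_def e[symmetric] by (simp add: algebra_simps)
    thus ?thesis by (simp add: z_def indicator_def \<Phi>_def)
  qed
  ultimately show "set_integrable lborel siegel \<Phi>" "(LINT w:siegel|lborel. \<Phi> w) = 0"
    by (simp_all add: set_lebesgue_integral_def set_integrable_def)
qed

section \<open>Sums, products and compositions of holomorphic functions\<close>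

lemma holo_on_const: "holo_on (\<lambda>w. c) S"
  unfolding holo_on_def by (intro ballI exI[of _ "\<lambda>v. 0"]) auto

lemma holo_on_coord: "holo_on (\<lambda>w. w $ j) S"
  unfolding holo_on_def
  by (intro ballI exI[of _ "\<lambda>v. v $ j"]) (auto intro!: bounded_linear_imp_has_derivative bounded_linear_vec_nth)

lemma holo_on_add:
  assumes "holo_on f S" "holo_on g S"
  shows "holo_on (\<lambda>w. f w + g w) S"
  unfolding holo_on_def
proof
  fix z assume "z \<in> S"
  then obtain D E where "(f has_derivative D) (at z)" "\<And>c v. D (c *s v) = c * D v"
    "(g has_derivative E) (at z)" "\<And>c v. E (c *s v) = c * E v"
    using assms unfolding holo_on_def by blast
  thus "\<exists>D. ((\<lambda>w. f w + g w) has_derivative D) (at z) \<and> (\<forall>c v. D (c *s v) = c * D v)"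
    by (intro exI[of _ "\<lambda>v. D v + E v"]) (auto intro!: derivative_eq_intros simp: algebra_simps)
qed

lemma holo_on_mult_aux:
  fixes f g :: "complex ^ 'n::finite \<Rightarrow> complex"
  assumes "holo_on f S" "holo_on g S" "z \<in> S"
  shows "((\<lambda>w. f w * g w) has_derivative (\<lambda>v. f z * cdiff g z v + cdiff f z v * g z)) (at z)"
  using has_derivative_mult[OF holo_has_derivative[OF assms(1,3)] holo_has_derivative[OF assms(2,3)]] by simp

lemma holo_on_mult:
  fixes f g :: "complex ^ 'n::finite \<Rightarrow> complex"
  assumes "holo_on f S" "holo_on g S"
  shows "holo_on (\<lambda>w. f w * g w) S"
  unfolding holo_on_def
proof
  fix z assume z: "z \<in> S"
  show "\<exists>D. ((\<lambda>w. f w * g w) has_derivative D) (at z) \<and> (\<forall>c v. D (c *s v) = c * D v)"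
    using holo_on_mult_aux[OF assms z] cdiff_smult[OF assms(1) z] cdiff_smult[OF assms(2) z]
    by (intro exI[of _ "\<lambda>v. f z * cdiff g z v + cdiff f z v * g z"]) (auto simp: algebra_simps)
qed

lemma pd_mult:
  fixes f g :: "complex ^ 'n::finite \<Rightarrow> complex"
  assumes "holo_on f S" "holo_on g S" "z \<in> S"
  shows "pd j (\<lambda>w. f w * g w) z = f z * pd j g z + pd j f z * g z"
proof -
  have "cdiff (\<lambda>w. f w * g w) z = (\<lambda>v. f z * cdiff g z v + cdiff f z v * g z)"
    by (rule cdiff_eqI[OF holo_on_mult_aux[OF assms]])
      (simp add: cdiff_smult[OF assms(1,3)] cdiff_smult[OF assms(2,3)] algebra_simps)
  thus ?thesis by (simp add: pd_eq_cdiff)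
qed

lemma holo_on_power:
  fixes f :: "complex ^ 'n::finite \<Rightarrow> complex"
  shows "holo_on f S \<Longrightarrow> holo_on (\<lambda>w. f w ^ k) S"
  by (induction k) (auto intro: holo_on_const holo_on_mult)

lemma holo_on_compose_aux:
  fixes h :: "complex ^ 'n::finite \<Rightarrow> complex"
  assumes "holo_on h S" "z \<in> S" "(\<phi> has_field_derivative d) (at (h z))"
  shows "((\<lambda>w. \<phi> (h w)) has_derivative (\<lambda>v. d * cdiff h z v)) (at z)"
  using has_derivative_compose[OF holo_has_derivative[OF assms(1,2)], of \<phi> "(*) d"] assms(3)
  by (simp add: has_field_derivative_def)

lemma holo_on_compose:
  fixes h :: "complex ^ 'n::finite \<Rightarrow> complex"
  assumes "holo_on h S" "\<And>z. z \<in> S \<Longrightarrow> (\<phi> has_field_derivative \<phi>' (h z)) (at (h z))"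
  shows "holo_on (\<lambda>w. \<phi> (h w)) S"
  unfolding holo_on_def
proof
  fix z assume z: "z \<in> S"
  show "\<exists>D. ((\<lambda>w. \<phi> (h w)) has_derivative D) (at z) \<and> (\<forall>c v. D (c *s v) = c * D v)"
    using holo_on_compose_aux[OF assms(1) z assms(2)[OF z]] cdiff_smult[OF assms(1) z]
    by (intro exI[of _ "\<lambda>v. \<phi>' (h z) * cdiff h z v"]) auto
qed

lemma pd_compose:
  fixes h :: "complex ^ 'n::finite \<Rightarrow> complex"
  assumes "holo_on h S" "z \<in> S" "(\<phi> has_field_derivative d) (at (h z))"
  shows "pd j (\<lambda>w. \<phi> (h w)) z = d * pd j h z"
proof -
  have "cdiff (\<lambda>w. \<phi> (h w)) z = (\<lambda>v. d * cdiff h z v)"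
    by (rule cdiff_eqI[OF holo_on_compose_aux[OF assms]]) (simp add: cdiff_smult[OF assms(1,2)])
  thus ?thesis by (simp add: pd_eq_cdiff)
qed

lemma pd_coord: "pd j (\<lambda>w. w $ i) z = (if i = j then 1 else 0)"
proof -
  have "cdiff (\<lambda>w. w $ i) z = (\<lambda>v. v $ i)"
    by (rule cdiff_eqI) (auto intro!: bounded_linear_imp_has_derivative bounded_linear_vec_nth)
  thus ?thesis by (simp add: pd_eq_cdiff axis_def)
qed

lemma siegel_dominated_convergence:
  fixes s :: "nat \<Rightarrow> (complex, 'n::{finite,linorder}) vec \<Rightarrow> complex"
  assumes s: "\<And>k. continuous_on siegel (s k)" and f: "continuous_on siegel f"
    and B: "set_integrable lborel siegel (B :: _ \<Rightarrow> real)"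
    and le: "\<And>k w. w \<in> siegel \<Longrightarrow> cmod (s k w) \<le> B w"
    and lim: "\<And>w. w \<in> siegel \<Longrightarrow> (\<lambda>k. s k w) \<longlonglongrightarrow> f w"
  shows "set_integrable lborel siegel f" "(\<lambda>k. LINT w:siegel|lborel. s k w) \<longlonglongrightarrow> (LINT w:siegel|lborel. f w)"
proof -
  have m: "(\<lambda>w. indicator siegel w *\<^sub>R g w) \<in> borel_measurable lborel" if "continuous_on siegel g"
    for g :: "(complex, 'n) vec \<Rightarrow> complex"
    by (simp, rule borel_measurable_continuous_on_indicator[OF _ that]) simp
  have B': "integrable lborel (\<lambda>w. indicator siegel w *\<^sub>R B w)" using B by (simp add: set_integrable_def)
  have l: "AE w in lborel. (\<lambda>k. indicator siegel w *\<^sub>R s k w) \<longlonglongrightarrow> indicator siegel w *\<^sub>R f w"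
    by (intro AE_I2) (auto simp: indicator_def lim)
  have b: "AE w in lborel. norm (indicator siegel w *\<^sub>R s k w) \<le> indicator siegel w *\<^sub>R B w" for k
    by (intro AE_I2) (auto simp: indicator_def le)
  show "set_integrable lborel siegel f" "(\<lambda>k. LINT w:siegel|lborel. s k w) \<longlonglongrightarrow> (LINT w:siegel|lborel. f w)"
    unfolding set_integrable_def set_lebesgue_integral_def
    by (rule integrable_dominated_convergence[OF m[OF f] m[OF s] B' l b],
        rule integral_dominated_convergence[OF m[OF f] m[OF s] B' l b])
qed

lemma cutoff_limits:
  assumes "x > 0"
  shows "(\<lambda>k. cutoff \<mu> (1 / real (Suc k)) x) \<longlonglongrightarrow> x powr \<mu>"
    "(\<lambda>k. cutoff' \<mu> (1 / real (Suc k)) x) \<longlonglongrightarrow> \<mu> * x powr (\<mu> - 1)"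
proof -
  have e: "(\<lambda>k. 1 / real (Suc k)) \<longlonglongrightarrow> 0" by (rule lim_1_over_n[THEN LIMSEQ_Suc])
  have p: "x powr (\<mu> + 1) = x powr (\<mu> - 1) * x\<^sup>2" "x powr (\<mu> + 2) = x powr (\<mu> - 1) * x ^ 3"
    "x powr \<mu> = x powr (\<mu> - 1) * x"
    using assms by (simp_all add: powr_add powr_diff power2_eq_square power3_eq_cube)
  have "(\<lambda>k. cutoff \<mu> (1 / real (Suc k)) x) \<longlonglongrightarrow> x powr (\<mu> + 2) / (x + 0)\<^sup>2"
    unfolding cutoff_def using assms by (intro tendsto_intros e) auto
  also have "x powr (\<mu> + 2) / (x + 0)\<^sup>2 = x powr \<mu>"
    using assms by (simp add: p power2_eq_square power3_eq_cube)
  finally show "(\<lambda>k. cutoff \<mu> (1 / real (Suc k)) x) \<longlonglongrightarrow> x powr \<mu>" .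
  have "(\<lambda>k. cutoff' \<mu> (1 / real (Suc k)) x) \<longlonglongrightarrow>
      (\<mu> + 2) * x powr (\<mu> + 1) / (x + 0)\<^sup>2 - 2 * x powr (\<mu> + 2) / (x + 0) ^ 3"
    unfolding cutoff'_def using assms by (intro tendsto_intros e) auto
  also have "(\<mu> + 2) * x powr (\<mu> + 1) / (x + 0)\<^sup>2 - 2 * x powr (\<mu> + 2) / (x + 0) ^ 3 = \<mu> * x powr (\<mu> - 1)"
    using assms unfolding p by (simp add: field_simps power2_eq_square power3_eq_cube)
  finally show "(\<lambda>k. cutoff' \<mu> (1 / real (Suc k)) x) \<longlonglongrightarrow> \<mu> * x powr (\<mu> - 1)" .
qed

section \<open>Integration by parts in tangential and normal directions\<close>

lemma continuous_on_rho_powr: "continuous_on siegel (\<lambda>w. rho w powr a)"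
  by (intro continuous_intros ballI) (use siegelD(1) in force)

lemma set_integrable_growth_norm:
  fixes h :: "(complex, 'n::{finite,linorder}) vec \<Rightarrow> complex"
  assumes "continuous_on siegel h" "growth a p h" "a > -1" "- p > real CARD('n) + 1 + a"
  shows "set_integrable lborel siegel (\<lambda>w. cmod (h w))"
  using set_integrable_norm[OF set_integrable_growth[OF assms]] by simp

lemma continuous_on_Lop:
  fixes b :: "(complex, 'n::{finite,linorder}) vec \<Rightarrow> complex"
  assumes "holo_on b S" "open S"
  shows "continuous_on S (Lop k b)"
  unfolding Lop_def[abs_def]
  using holo_continuous_on[OF holo_on_pd[OF assms]] by (cases "k = top_idx") (auto intro!: continuous_intros)

text \<open>The conjugate of \<open>Lop k\<close> is the antiholomorphic derivative in
  \<open>k\<close> minus \<open>2 * \<i> * w $ k\<close> times the one in the top coordinate. The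
  terms with \<open>cutoff'\<close> then carry the coefficients \<open>- 2 * w $ k\<close> and
  \<open>- 2 * \<i> * \<i> * w $ k\<close> and cancel, so no derivative of the weight survives. The
  growth of \<open>Lop k b\<close> is a separate assumption because Cauchy's estimate would lose a
  power of \<open>rho\<close> which an explicit \<open>b\<close> need not lose.\<close>

lemma tangential_by_parts:
  fixes b h :: "(complex, 'n::{finite,linorder}) vec \<Rightarrow> complex"
  assumes b: "holo_on b siegel" "growth a1 p1 b" and h: "holo_on h siegel" "growth a2 p2 h"
    and \<mu>: "\<mu> + (a1 + a2) > -1" "- (p1 + p2 + 2) > real CARD('n) + 1 + (\<mu> + (a1 + a2))"
    and k: "k \<noteq> top_idx"
    and L: "growth a' p' (\<lambda>w. cnj (Lop k b w) * h w)" "\<mu> + a' > -1" "- p' > real CARD('n) + 1 + (\<mu> + a')"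
  shows "(LINT w:siegel|lborel. of_real (rho w powr \<mu>) * (cnj (Lop k b w) * h w)) = 0"
proof -
  \<comment> \<open>The coefficient \<open>w $ k\<close> of the top derivative is holomorphic, so it
    can be absorbed into \<open>h\<close>.\<close>
  let ?h = "\<lambda>w. w $ k * h w"
  have h': "holo_on ?h siegel" "growth a2 (p2 + 1) ?h"
    using growth_mult[OF growth_coord[of k] h(2)] by (auto intro!: holo_on_mult holo_on_coord h simp: add.commute)
  have zero: "(LINT w:siegel|lborel. of_real (cutoff \<mu> \<epsilon> (rho w)) * (cnj (Lop k b w) * h w)) = 0" if \<epsilon>: "\<epsilon> > 0" for \<epsilon>
  proof -
    have \<mu>1: "- (p1 + p2 + 1) > real CARD('n) + 1 + (\<mu> + (a1 + a2))" "- (p1 + (p2 + 1) + 1) > real CARD('n) + 1 + (\<mu> + (a1 + a2))"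
      using \<mu>(2) by linarith+
    note I1 = dbar_by_parts_cutoff[OF b h \<epsilon> \<mu>(1) \<mu>1(1), of k]
    note I2 = dbar_by_parts_cutoff[OF b h' \<epsilon> \<mu>(1) \<mu>1(2), of top_idx]
    let ?\<Phi>1 = "\<lambda>w. of_real (cutoff' \<mu> \<epsilon> (rho w)) * ((if k = top_idx then \<i> else - 2 * w $ k) * (cnj (b w) * h w))
     + of_real (cutoff \<mu> \<epsilon> (rho w)) * (2 * cnj (pd k b w) * h w)"
    let ?\<Phi>2 = "\<lambda>w. of_real (cutoff' \<mu> \<epsilon> (rho w)) * ((if top_idx = (top_idx::'n) then \<i> else - 2 * w $ top_idx) * (cnj (b w) * (w $ k * h w)))
     + of_real (cutoff \<mu> \<epsilon> (rho w)) * (2 * cnj (pd top_idx b w) * (w $ k * h w))"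
    have "(LINT w:siegel|lborel. ?\<Phi>1 w + (- 2 * \<i>) * ?\<Phi>2 w) = 0"
      by (subst set_integral_add[OF I1(1) set_integrable_mult_right[OF I2(1)]])
        (simp_all only: I1(2) I2(2) set_integral_mult_right mult_zero_right add_0)
    moreover have "?\<Phi>1 w + (- 2 * \<i>) * ?\<Phi>2 w = 2 * (of_real (cutoff \<mu> \<epsilon> (rho w)) * (cnj (Lop k b w) * h w))" for w
      using k by (simp add: Lop_def algebra_simps)
    ultimately show ?thesis by simp
  qed
  have c: "continuous_on siegel (\<lambda>w. cnj (Lop k b w) * h w)"
    by (intro continuous_intros continuous_on_Lop b open_siegel holo_continuous_on[OF h(1)])
  have B: "set_integrable lborel siegel (\<lambda>w. cmod (of_real (rho w powr \<mu>) * (cnj (Lop k b w) * h w)))"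
  proof (rule set_integrable_growth_norm)
    show "growth (\<mu> + a') (0 + p') (\<lambda>w. of_real (rho w powr \<mu>) * (cnj (Lop k b w) * h w))"
      by (rule growth_mult[OF growth_rho L(1)])
  qed (use L in \<open>auto intro!: continuous_intros c continuous_on_rho_powr\<close>)
  have "(\<lambda>m. LINT w:siegel|lborel. of_real (cutoff \<mu> (1 / real (Suc m)) (rho w)) * (cnj (Lop k b w) * h w))
     \<longlonglongrightarrow> (LINT w:siegel|lborel. of_real (rho w powr \<mu>) * (cnj (Lop k b w) * h w))"
  proof (rule siegel_dominated_convergence(2)[OF _ _ B])
    fix w :: "(complex, 'n) vec" and m assume w: "w \<in> siegel"
    have "\<bar>cutoff \<mu> (1 / real (Suc m)) (rho w)\<bar> \<le> rho w powr \<mu>"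
      using cutoff_bounds(1,2)[OF siegelD(1)[OF w], of "1 / real (Suc m)" \<mu>] by simp
    thus "cmod (of_real (cutoff \<mu> (1 / real (Suc m)) (rho w)) * (cnj (Lop k b w) * h w))
      \<le> cmod (of_real (rho w powr \<mu>) * (cnj (Lop k b w) * h w))"
      by (simp only: norm_mult norm_of_real) (auto intro!: mult_right_mono)
    show "(\<lambda>m. of_real (cutoff \<mu> (1 / real (Suc m)) (rho w)) * (cnj (Lop k b w) * h w))
        \<longlonglongrightarrow> of_real (rho w powr \<mu>) * (cnj (Lop k b w) * h w)"
      by (intro tendsto_intros cutoff_limits siegelD(1) w)
  qed (auto intro!: continuous_intros c continuous_on_rho_powr continuous_on_cutoff)
  moreover have "(LINT w:siegel|lborel. of_real (cutoff \<mu> (1 / real (Suc m)) (rho w)) * (cnj (Lop k b w) * h w)) = 0" for m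
    by (rule zero) simp
  ultimately show ?thesis by (simp add: LIMSEQ_const_iff)
qed

text \<open>In the top direction the weight does get differentiated and leaves
  \<open>rho powr (\<mu> - 1)\<close>; the bounds of \<open>cutoff\<close> and
  \<open>cutoff'\<close> that are uniform in \<open>\<epsilon>\<close> allow the cutoff to be
  removed. The identity trades a power of \<open>rho\<close> for a derivative. It is used once for
  the kernel and once, conjugated, to raise the order.\<close>

lemma normal_by_parts:
  fixes b h :: "(complex, 'n::{finite,linorder}) vec \<Rightarrow> complex"
  assumes b: "holo_on b siegel" "growth a1 p1 b" and h: "holo_on h siegel" "growth a2 p2 h"
    and \<mu>: "\<mu> - 1 + (a1 + a2) > -1" "- (p1 + p2 + 1) > real CARD('n) + 1 + (\<mu> + (a1 + a2))"
  shows "set_integrable lborel siegel (\<lambda>w. of_real (rho w powr (\<mu> - 1)) * (cnj (b w) * h w))" (is ?i1)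
    "set_integrable lborel siegel (\<lambda>w. of_real (rho w powr \<mu>) * (cnj (pd top_idx b w) * h w))" (is ?i2)
    "of_real \<mu> * \<i> * (LINT w:siegel|lborel. of_real (rho w powr (\<mu> - 1)) * (cnj (b w) * h w))
      + 2 * (LINT w:siegel|lborel. of_real (rho w powr \<mu>) * (cnj (pd top_idx b w) * h w)) = 0"
proof -
  let ?f = "\<lambda>w. of_real (rho w powr (\<mu> - 1)) * (cnj (b w) * h w)"
  let ?g = "\<lambda>w. of_real (rho w powr \<mu>) * (cnj (pd top_idx b w) * h w)"
  have cf: "continuous_on siegel (\<lambda>w. cnj (b w) * h w)" "continuous_on siegel (\<lambda>w. cnj (pd top_idx b w) * h w)"
    by (auto intro!: continuous_intros holo_continuous_on[OF b(1)] holo_continuous_on[OF h(1)]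
        holo_continuous_on[OF holo_on_pd[OF b(1) open_siegel]])
  have cfg: "continuous_on siegel ?f" "continuous_on siegel ?g"
    by (auto intro!: continuous_intros cf continuous_on_rho_powr)
  have gf: "growth (\<mu> - 1 + (a1 + a2)) (p1 + p2) ?f"
    using growth_mult[OF growth_rho[of "\<mu> - 1"] growth_mult[OF growth_cnj[OF b(2)] h(2)]] by simp
  have gg: "growth (\<mu> - 1 + (a1 + a2)) (p1 + p2 + 1) ?g"
    using growth_mult[OF growth_rho[of "\<mu>"] growth_mult[OF growth_cnj[OF growth_pd[OF b]] h(2)]]
    by (simp add: algebra_simps)
  show i1: ?i1 by (rule set_integrable_growth[OF cfg(1) gf]) (use \<mu> in auto)
  show i2: ?i2 by (rule set_integrable_growth[OF cfg(2) gg]) (use \<mu> in auto)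
  define M where "M = \<bar>\<mu> + 2\<bar> + 2"
  have B: "set_integrable lborel siegel (\<lambda>w. M * cmod (?f w) + 2 * cmod (?g w))"
    using set_integrable_norm[OF i1] set_integrable_norm[OF i2]
    by (intro set_integral_add set_integrable_mult_right) auto
  let ?\<Phi> = "\<lambda>\<epsilon> w. of_real (cutoff' \<mu> \<epsilon> (rho w)) * ((if top_idx = (top_idx::'n) then \<i> else - 2 * w $ top_idx) * (cnj (b w) * h w))
     + of_real (cutoff \<mu> \<epsilon> (rho w)) * (2 * cnj (pd top_idx b w) * h w)"
  have "(\<lambda>m. LINT w:siegel|lborel. ?\<Phi> (1 / real (Suc m)) w)
     \<longlonglongrightarrow> (LINT w:siegel|lborel. of_real \<mu> * \<i> * ?f w + 2 * ?g w)"
  proof (rule siegel_dominated_convergence(2)[OF _ _ B])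
    fix w :: "(complex, 'n) vec" and m assume w: "w \<in> siegel"
    note r = siegelD(1)[OF w]
    have e: "1 / real (Suc m) > 0" by simp
    have 1: "\<bar>cutoff \<mu> (1 / real (Suc m)) (rho w)\<bar> \<le> rho w powr \<mu>"
      using cutoff_bounds(1,2)[OF r e, of \<mu>] by simp
    have 2: "\<bar>cutoff' \<mu> (1 / real (Suc m)) (rho w)\<bar> \<le> M * rho w powr (\<mu> - 1)"
      using cutoff_bounds(6)[OF r e, of \<mu>] by (simp add: M_def)
    have "cmod (?\<Phi> (1 / real (Suc m)) w) \<le> \<bar>cutoff' \<mu> (1 / real (Suc m)) (rho w)\<bar> * cmod (cnj (b w) * h w)
       + 2 * (\<bar>cutoff \<mu> (1 / real (Suc m)) (rho w)\<bar> * cmod (cnj (pd top_idx b w) * h w))"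
      by (rule order_trans[OF norm_triangle_ineq]) (simp add: norm_mult mult_ac)
    also have "\<dots> \<le> M * rho w powr (\<mu> - 1) * cmod (cnj (b w) * h w) + 2 * (rho w powr \<mu> * cmod (cnj (pd top_idx b w) * h w))"
      by (intro add_mono mult_mono 1 2) (auto simp: M_def)
    also have "\<dots> = M * cmod (?f w) + 2 * cmod (?g w)" by (simp add: norm_mult)
    finally show "cmod (?\<Phi> (1 / real (Suc m)) w) \<le> M * cmod (?f w) + 2 * cmod (?g w)" .
    have "(\<lambda>m. ?\<Phi> (1 / real (Suc m)) w) \<longlonglongrightarrow> of_real (\<mu> * rho w powr (\<mu> - 1)) * (\<i> * (cnj (b w) * h w)) + of_real (rho w powr \<mu>) * (2 * cnj (pd top_idx b w) * h w)"
      unfolding if_P[OF refl] by (intro tendsto_intros cutoff_limits r)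
    thus "(\<lambda>m. ?\<Phi> (1 / real (Suc m)) w) \<longlonglongrightarrow> of_real \<mu> * \<i> * ?f w + 2 * ?g w"
      by (simp add: mult_ac)
  qed (auto intro!: continuous_intros cf cfg continuous_on_cutoff holo_continuous_on[OF b(1)]
        holo_continuous_on[OF h(1)] holo_continuous_on[OF holo_on_pd[OF b(1) open_siegel]])
  moreover have "(LINT w:siegel|lborel. ?\<Phi> (1 / real (Suc m)) w) = 0" for m
    by (rule dbar_by_parts_cutoff(2)[OF b h]) (use \<mu> in auto)
  ultimately have "(LINT w:siegel|lborel. of_real \<mu> * \<i> * ?f w + 2 * ?g w) = 0"
    by (simp only: LIMSEQ_const_iff)
  thus "of_real \<mu> * \<i> * (LINT w:siegel|lborel. ?f w) + 2 * (LINT w:siegel|lborel. ?g w) = 0"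
    by (subst (asm) set_integral_add) (use i1 i2 in \<open>auto intro!: set_integrable_mult_right\<close>)
qed

section \<open>The kernel\<close>

lemma rho2_cnj: "cnj (rho2 z w) = rho2 w z"
  by (simp add: rho2_def algebra_simps)

lemma rho2_Re: "Re (rho2 z w) = (rho z + rho w + (\<Sum>j\<in>{..<top_idx}. (cmod (z $ j - w $ j))\<^sup>2)) / 2"
proof -
  have "(\<Sum>j\<in>{..<top_idx}. (cmod (z $ j - w $ j))\<^sup>2) =
    (\<Sum>j\<in>{..<top_idx}. (cmod (z $ j))\<^sup>2 + (cmod (w $ j))\<^sup>2 - 2 * Re (z $ j * cnj (w $ j)))"
    by (intro sum.cong refl) (simp only: cmod_power2, simp add: power2_eq_square algebra_simps)
  also have "\<dots> = sqsum z + sqsum w - 2 * (\<Sum>j\<in>{..<top_idx}. Re (z $ j * cnj (w $ j)))"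
    by (simp add: sqsum_def sum.distrib sum_subtractf sum_distrib_left)
  finally show ?thesis by (simp add: rho2_def rho_eq)
qed

lemma rho2_Re_lower:
  assumes "z \<in> siegel" "w \<in> siegel"
  shows "Re (rho2 z w) > 0" "rho z \<le> 2 * Re (rho2 z w)" "rho w \<le> 2 * Re (rho2 z w)"
    "(\<Sum>j\<in>{..<top_idx}. (cmod (z $ j - w $ j))\<^sup>2) \<le> 2 * Re (rho2 z w)"
proof -
  have "(\<Sum>j\<in>{..<top_idx}. (cmod (z $ j - w $ j))\<^sup>2) \<ge> 0" by (intro sum_nonneg) auto
  thus "Re (rho2 z w) > 0" "rho z \<le> 2 * Re (rho2 z w)" "rho w \<le> 2 * Re (rho2 z w)"
    "(\<Sum>j\<in>{..<top_idx}. (cmod (z $ j - w $ j))\<^sup>2) \<le> 2 * Re (rho2 z w)"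
    using siegelD(1)[OF assms(1)] siegelD(1)[OF assms(2)] by (auto simp: rho2_Re)
qed

lemma rho2_diag: "rho2 z z = of_real (rho z)"
proof (rule complex_eqI)
  show "Re (rho2 z z) = Re (complex_of_real (rho z))" by (simp add: rho2_Re)
  have "Im (cnj (rho2 z z)) = Im (rho2 z z)" by (simp only: rho2_cnj)
  thus "Im (rho2 z z) = Im (complex_of_real (rho z))" by simp
qed

lemma sqsum_le_double:
  "sqsum w \<le> 2 * sqsum z + 2 * (\<Sum>j\<in>{..<top_idx}. (cmod (z $ j - w $ j))\<^sup>2)"
proof -
  have "(cmod (w $ j))\<^sup>2 \<le> 2 * (cmod (z $ j))\<^sup>2 + 2 * (cmod (z $ j - w $ j))\<^sup>2" for j
  proof -
    have "cmod (w $ j) \<le> cmod (z $ j) + cmod (z $ j - w $ j)"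
      using norm_triangle_ineq4[of "z $ j" "z $ j - w $ j"] by simp
    hence "(cmod (w $ j))\<^sup>2 \<le> (cmod (z $ j) + cmod (z $ j - w $ j))\<^sup>2" by (intro power_mono) auto
    also have "\<dots> \<le> 2 * (cmod (z $ j))\<^sup>2 + 2 * (cmod (z $ j - w $ j))\<^sup>2"
      using sum_squares_bound[of "cmod (z $ j)" "cmod (z $ j - w $ j)"] by (simp add: power2_sum)
    finally show ?thesis .
  qed
  hence "sqsum w \<le> (\<Sum>j\<in>{..<top_idx}. 2 * (cmod (z $ j))\<^sup>2 + 2 * (cmod (z $ j - w $ j))\<^sup>2)"
    unfolding sqsum_def by (intro sum_mono)
  thus ?thesis by (simp add: sqsum_def sum.distrib sum_distrib_left)
qed

lemma norm_dot_le: "cmod (\<Sum>j\<in>{..<top_idx}. z $ j * cnj (w $ j)) \<le> (sqsum z + sqsum w) / 2"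
proof -
  have "cmod (\<Sum>j\<in>{..<top_idx}. z $ j * cnj (w $ j)) \<le> (\<Sum>j\<in>{..<top_idx}. ((cmod (z $ j))\<^sup>2 + (cmod (w $ j))\<^sup>2) / 2)"
  proof (rule sum_norm_le)
    fix j
    show "cmod (z $ j * cnj (w $ j)) \<le> ((cmod (z $ j))\<^sup>2 + (cmod (w $ j))\<^sup>2) / 2"
      using sum_squares_bound[of "cmod (z $ j)" "cmod (w $ j)"] by (simp add: norm_mult)
  qed
  thus ?thesis by (simp add: sqsum_def sum.distrib sum_divide_distrib[symmetric])
qed

text \<open>The real part of \<open>rho2 z w\<close> controls both heights and the tangential
  distance, hence \<open>Im (w $ top_idx)\<close>; its imaginary part controls
  \<open>Re (w $ top_idx)\<close> up to the tangential product. The remaining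
  \<open>7 * wt z\<close> is absorbed through \<open>rho z \<le> 2 * cmod (rho2 z w)\<close>, which
  produces the 14. The constant is explicit because \<open>z\<close> will later move along a
  segment.\<close>

lemma wt_le_rho2:
  assumes z: "z \<in> siegel" and w: "w \<in> siegel"
  shows "wt w \<le> (12 + 14 * wt z / rho z) * cmod (rho2 z w)"
proof -
  define A where "A = cmod (rho2 z w)"
  note sz = siegelD[OF z] and sw = siegelD[OF w]
  have RA: "Re (rho2 z w) \<le> A" unfolding A_def by (rule complex_Re_le_cmod)
  have 1: "rho w \<le> 2 * A" "rho z \<le> 2 * A" "(\<Sum>j\<in>{..<top_idx}. (cmod (z $ j - w $ j))\<^sup>2) \<le> 2 * A"
    using rho2_Re_lower[OF z w] RA by linarith+
  have sq: "sqsum w \<le> 2 * sqsum z + 4 * A" using sqsum_le_double[of w z] 1 by linarith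
  have Im: "Im (w $ top_idx) \<le> 6 * A + 2 * sqsum z" using 1 sq by (simp add: rho_eq)
  have IA: "\<bar>Im (rho2 z w)\<bar> \<le> A" unfolding A_def by (rule abs_Im_le_cmod)
  define S where "S = (\<Sum>j\<in>{..<top_idx}. z $ j * cnj (w $ j))"
  define x y u v where "x = Re (w $ top_idx)" and "y = Re (z $ top_idx)" and "u = Im S" and "v = Im (rho2 z w)"
  have "v = (x - y) / 2 - u"
    by (simp add: rho2_def S_def[symmetric] x_def y_def u_def v_def)
  hence "x = 2 * v + y + 2 * u" by (simp add: field_simps)
  hence "\<bar>x\<bar> \<le> 2 * A + \<bar>y\<bar> + 2 * \<bar>u\<bar>"
    using IA unfolding v_def[symmetric] by linarith
  also have "\<dots> \<le> 2 * A + wt z + (sqsum z + sqsum w)"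
  proof -
    have "2 * cmod S \<le> sqsum z + sqsum w" using norm_dot_le[of z w] by (simp add: S_def field_simps)
    thus ?thesis using abs_Re_le_cmod[of "z $ top_idx"] sz(5)[of top_idx] abs_Im_le_cmod[of S]
      unfolding u_def y_def by linarith
  qed
  finally have Re: "\<bar>Re (w $ top_idx)\<bar> \<le> 6 * A + wt z + 3 * sqsum z" using sq unfolding x_def by linarith
  have "wt w \<le> \<bar>Re (w $ top_idx)\<bar> + \<bar>Im (w $ top_idx) + 1\<bar>"
    unfolding wt_def using cmod_le[of "w $ top_idx + \<i>"] by simp
  also have "\<dots> \<le> 12 * A + 7 * wt z" using Re Im sz sw(7) by linarith
  also have "7 * wt z \<le> 14 * wt z / rho z * A"
    using 1(2) sz by (simp add: field_simps)
  finally show ?thesis by (simp add: A_def algebra_simps)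
qed

lemma has_derivative_rho2:
  fixes z :: "(complex, 'a::{finite,linorder}) vec"
  shows "((\<lambda>w. rho2 w z) has_derivative (\<lambda>v. \<i> / 2 * (0 - v $ top_idx) - (\<Sum>j\<in>{..<top_idx}. v $ j * cnj (z $ j)))) (at w)"
proof -
  have c: "((\<lambda>w::(complex, 'a) vec. w $ j) has_derivative (\<lambda>v. v $ j)) (at w)" for j
    by (rule bounded_linear_imp_has_derivative, rule bounded_linear_vec_nth)
  have 1: "((\<lambda>w. \<i> / 2 * (cnj (z $ top_idx) - w $ top_idx)) has_derivative (\<lambda>v. \<i> / 2 * (0 - v $ top_idx))) (at w)"
    by (rule has_derivative_mult_right[OF has_derivative_diff[OF has_derivative_const c]])
  have 2: "((\<lambda>w. \<Sum>j\<in>{..<top_idx}. w $ j * cnj (z $ j)) has_derivative (\<lambda>v. \<Sum>j\<in>{..<top_idx}. v $ j * cnj (z $ j))) (at w)"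
    by (rule has_derivative_sum[where f="\<lambda>j w. w $ j * cnj (z $ j)" and f'="\<lambda>j v. v $ j * cnj (z $ j)"])
      (rule has_derivative_mult_left[OF c])
  show ?thesis unfolding rho2_def by (rule has_derivative_diff[OF 1 2])
qed

lemma holo_on_rho2: "holo_on (\<lambda>w. rho2 w z) S"
  unfolding holo_on_def
proof (intro ballI, rule exI, rule conjI, rule has_derivative_rho2)
qed (auto simp: algebra_simps sum_distrib_left)

lemma pd_rho2: "pd j (\<lambda>w. rho2 w z) w = (if j = top_idx then - \<i> / 2 else - cnj (z $ j))"
proof -
  have "cdiff (\<lambda>w. rho2 w z) w = (\<lambda>v. \<i> / 2 * (0 - v $ top_idx) - (\<Sum>j\<in>{..<top_idx}. v $ j * cnj (z $ j)))"
    by (rule cdiff_eqI[OF has_derivative_rho2]) (auto simp: algebra_simps sum_distrib_left)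
  moreover have "(\<Sum>i\<in>{..<top_idx}. axis j 1 $ i * cnj (z $ i)) = (if j = top_idx then 0 else cnj (z $ j))"
    using below_top[of j] by (auto simp: axis_def if_distrib[where f="\<lambda>x. x * _"] cong: if_cong)
  ultimately show ?thesis by (auto simp: pd_eq_cdiff axis_def)
qed

lemma cmod_powr_of_real: "x \<noteq> 0 \<Longrightarrow> cmod (x powr of_real r) = cmod x powr r"
  by (simp add: powr_def)

text \<open>The arguments of \<open>rho2\<close> are swapped so that the function is holomorphic in
  \<open>w\<close>. On the half-space the kernel is its conjugate (see
  \<open>kern_eq_cnj_kpow\<close>), so holomorphic calculus applies before conjugation.\<close>

definition kpow :: "real \<Rightarrow> complex ^ 'n::{finite,linorder} \<Rightarrow> complex ^ 'n::{finite,linorder} \<Rightarrow> complex" where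
  "kpow \<sigma> z w = rho2 w z powr of_real (- \<sigma>)"

lemma rho2_nonzero:
  assumes "z \<in> siegel" "w \<in> siegel"
  shows "rho2 z w \<noteq> 0" "rho2 z w \<notin> \<real>\<^sub>\<le>\<^sub>0"
  using rho2_Re_lower(1)[OF assms] by (auto simp: complex_nonpos_Reals_iff)

lemma cnj_kpow:
  assumes "z \<in> siegel" "w \<in> siegel"
  shows "cnj (kpow \<sigma> z w) = rho2 z w powr of_real (- \<sigma>)" "cnj (kpow \<sigma> z w) = kpow \<sigma> w z"
proof -
  have "cnj (rho2 w z powr of_real (- \<sigma>)) = cnj (rho2 w z) powr cnj (of_real (- \<sigma>))"
    by (rule cnj_powr) (use rho2_Re_lower(1)[OF assms(2,1)] in auto)
  thus "cnj (kpow \<sigma> z w) = rho2 z w powr of_real (- \<sigma>)" by (simp add: kpow_def rho2_cnj)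
  thus "cnj (kpow \<sigma> z w) = kpow \<sigma> w z" by (simp add: kpow_def)
qed

lemma kpow_deriv:
  assumes "z \<in> siegel" "w \<in> siegel"
  shows "((\<lambda>x. x powr of_real (- \<sigma>)) has_field_derivative of_real (- \<sigma>) * rho2 w z powr of_real (- (\<sigma> + 1))) (at (rho2 w z))"
proof -
  have "((\<lambda>x. x powr of_real (- \<sigma>)) has_field_derivative of_real (- \<sigma>) * rho2 w z powr (of_real (- \<sigma>) - 1)) (at (rho2 w z))"
    by (rule has_field_derivative_powr) (rule rho2_nonzero(2)[OF assms(2,1)])
  moreover have "of_real (- \<sigma>) - 1 = complex_of_real (- (\<sigma> + 1))" by simp
  ultimately show ?thesis by (simp only:)
qed

lemma holo_on_kpow: "z \<in> siegel \<Longrightarrow> holo_on (kpow \<sigma> z) siegel"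
  unfolding kpow_def[abs_def]
  by (rule holo_on_compose[OF holo_on_rho2, where \<phi>'="\<lambda>x. of_real (- \<sigma>) * x powr of_real (- (\<sigma> + 1))"])
    (rule kpow_deriv)

lemma pd_kpow:
  assumes "z \<in> siegel" "w \<in> siegel"
  shows "pd j (kpow \<sigma> z) w = - of_real \<sigma> * kpow (\<sigma> + 1) z w * (if j = top_idx then - \<i> / 2 else - cnj (z $ j))"
  using pd_compose[OF holo_on_rho2 assms(2) kpow_deriv[OF assms, of \<sigma>], of j]
  by (simp add: kpow_def[abs_def] pd_rho2)

text \<open>The source of the coefficients \<open>w $ k - z $ k\<close> for tangential
  \<open>k\<close>: conjugation turns the last factor into one of them and leaves the kernel with
  exponent raised by one.\<close>

lemma Lop_kpow:
  assumes "z \<in> siegel" "w \<in> siegel" "k \<noteq> top_idx"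
  shows "Lop k (kpow \<sigma> z) w = - of_real \<sigma> * kpow (\<sigma> + 1) z w * cnj (w $ k - z $ k)"
  using assms(3) by (simp add: Lop_def pd_kpow[OF assms(1,2)] algebra_simps)

lemma kpow_mult_rho2:
  assumes "z \<in> siegel" "w \<in> siegel"
  shows "kpow (\<sigma> + 1) z w * rho2 w z = kpow \<sigma> z w"
proof -
  have "kpow (\<sigma> + 1) z w * rho2 w z = rho2 w z powr of_real (- (\<sigma> + 1)) * rho2 w z powr 1"
    using rho2_nonzero[OF assms(2,1)] by (simp add: kpow_def powr_to_1)
  also have "\<dots> = rho2 w z powr (of_real (- (\<sigma> + 1)) + 1)"
    using rho2_nonzero[OF assms(2,1)] by (subst powr_add) auto
  finally show ?thesis by (simp add: kpow_def)
qed

lemma cmod_kpow: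
  assumes "z \<in> siegel" "w \<in> siegel"
  shows "cmod (kpow \<sigma> z w) = cmod (rho2 z w) powr (- \<sigma>)"
proof -
  have "cmod (rho2 w z) = cmod (rho2 z w)" by (metis complex_mod_cnj rho2_cnj)
  thus ?thesis
    unfolding kpow_def using cmod_powr_of_real[OF rho2_nonzero(1)[OF assms(2,1)], of "- \<sigma>"] by simp
qed

lemma growth_kpow:
  assumes z: "z \<in> siegel" and \<sigma>: "\<sigma> \<ge> 0"
  shows "growth 0 (- \<sigma>) (kpow \<sigma> z)"
proof (rule growthI)
  fix w :: "(complex, 'a) vec" assume w: "w \<in> siegel"
  note s = siegelD[OF w] and sz = siegelD[OF z]
  define C where "C = 12 + 14 * wt z / rho z"
  have C: "C > 0" using sz by (simp add: C_def add_pos_nonneg)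
  have "wt w / C \<le> cmod (rho2 z w)"
    using wt_le_rho2[OF z w] C by (simp add: C_def field_simps)
  hence "cmod (kpow \<sigma> z w) \<le> (wt w / C) powr (- \<sigma>)"
    unfolding cmod_kpow[OF z w] using C s \<sigma> by (intro powr_mono2') auto
  also have "\<dots> = C powr \<sigma> * wt w powr - \<sigma>"
    using C s by (simp add: powr_divide powr_minus_divide)
  finally show "cmod (kpow \<sigma> z w) \<le> C powr \<sigma> * (rho w powr 0 * wt w powr - \<sigma>)" using s by simp
qed

text \<open>In the difference of \<open>rho2 z w\<close> and \<open>rho2 w w\<close> the conjugated
  top coordinate cancels, and \<open>rho2 w w\<close> is \<open>rho w\<close>. So the top
  coefficient is expressed by the kernel's base, the weight and tangential coefficients, each of
  which can be integrated by parts.\<close>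

lemma top_coord_identity:
  "w $ top_idx - z $ top_idx = - 2 * \<i> * (rho2 z w - of_real (rho w) - (\<Sum>k\<in>{..<top_idx}. (w $ k - z $ k) * cnj (w $ k)))"
proof -
  have "rho2 z w - rho2 w w = \<i> / 2 * (w $ top_idx - z $ top_idx) + (\<Sum>k\<in>{..<top_idx}. (w $ k - z $ k) * cnj (w $ k))"
    by (simp add: rho2_def algebra_simps sum_subtractf)
  hence e: "rho2 z w - of_real (rho w) - (\<Sum>k\<in>{..<top_idx}. (w $ k - z $ k) * cnj (w $ k)) = \<i> / 2 * (w $ top_idx - z $ top_idx)"
    by (simp add: rho2_diag)
  show ?thesis unfolding e by simp
qed

text \<open>The coefficients \<open>w $ j - z $ j\<close> times the weighted kernel are divergences of antiholomorphic
  type, so they integrate to zero against every holomorphic function of sufficient decay.\<close>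

lemma kernel_annihilates:
  fixes z :: "(complex, 'n::{finite,linorder}) vec"
  assumes l: "l > -1" and z: "z \<in> siegel" and h: "holo_on h siegel" "growth (- \<delta>) (- 5) h"
    and \<delta>: "0 \<le> \<delta>" "l - \<delta> > -1"
  defines "\<kappa> \<equiv> \<lambda>w. of_real (rho w powr l) * cnj (kpow (real CARD('n) + 1 + l) z w)"
  shows "(LINT w:siegel|lborel. (w $ j - z $ j) * (\<kappa> w * h w)) = 0"
proof -
  \<comment> \<open>One less than the exponent of the kernel, so that differentiating
    \<open>kpow \<sigma> z\<close> produces the kernel itself.\<close>
  define \<sigma> where "\<sigma> = real CARD('n) + l"
  have n1: "real CARD('n) \<ge> 1" by (simp add: Suc_leI)
  have \<sigma>: "\<sigma> > 0" using l n1 unfolding \<sigma>_def by linarith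
  have s: "real CARD('n) + 1 + l = \<sigma> + 1" by (simp add: \<sigma>_def)
  note ch = holo_continuous_on[OF h(1)] and ck = holo_continuous_on[OF holo_on_kpow[OF z]]
  have gk: "growth 0 (- \<sigma>) (kpow \<sigma> z)" "growth 0 (- (\<sigma> + 1)) (kpow (\<sigma> + 1) z)"
    using \<sigma> by (auto intro!: growth_kpow[OF z] simp del: minus_add_distrib)
  note int = set_integrable_growth
  define I1 where "I1 k = (LINT w:siegel|lborel. (w $ k - z $ k) * (\<kappa> w * h w))" for k
  define I2 where "I2 k = (LINT w:siegel|lborel. (w $ k - z $ k) * cnj (w $ k) * (\<kappa> w * h w))" for k
  define A where "A = (LINT w:siegel|lborel. of_real (rho w powr l) * (cnj (kpow \<sigma> z w) * h w))"
  define B where "B = (LINT w:siegel|lborel. of_real (rho w powr (l + 1)) * (cnj (kpow (\<sigma> + 1) z w) * h w))"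
  have iA: "set_integrable lborel siegel (\<lambda>w. of_real (rho w powr l) * (cnj (kpow \<sigma> z w) * h w))"
  proof (rule int)
    show "growth (l + (0 + - \<delta>)) (0 + (- \<sigma> + - 5)) (\<lambda>w. of_real (rho w powr l) * (cnj (kpow \<sigma> z w) * h w))"
      by (intro growth_mult growth_rho growth_cnj gk h)
  qed (use \<delta> \<sigma> in \<open>auto intro!: continuous_intros ch ck continuous_on_rho_powr simp: \<sigma>_def\<close>)
  have iB: "set_integrable lborel siegel (\<lambda>w. of_real (rho w powr (l + 1)) * (cnj (kpow (\<sigma> + 1) z w) * h w))"
  proof (rule int)
    show "growth ((l + 1) + (0 + - \<delta>)) (0 + (- (\<sigma> + 1) + - 5)) (\<lambda>w. of_real (rho w powr (l + 1)) * (cnj (kpow (\<sigma> + 1) z w) * h w))"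
      by (intro growth_mult growth_rho growth_cnj gk h)
  qed (use \<delta> \<sigma> in \<open>auto intro!: continuous_intros ch ck continuous_on_rho_powr simp: \<sigma>_def\<close>)
  have g\<kappa>: "growth (l + - \<delta>) (- (\<sigma> + 1) + - 5) (\<lambda>w. \<kappa> w * h w)"
  proof -
    have "growth (l + 0 + - \<delta>) (0 + - (\<sigma> + 1) + - 5) (\<lambda>w. \<kappa> w * h w)"
      unfolding \<kappa>_def s by (intro growth_mult growth_rho growth_cnj gk h)
    thus ?thesis by simp
  qed
  have c\<kappa>: "continuous_on siegel (\<lambda>w. \<kappa> w * h w)"
    unfolding \<kappa>_def by (intro continuous_intros ch ck continuous_on_rho_powr)
  have i2: "set_integrable lborel siegel (\<lambda>w. (w $ k - z $ k) * cnj (w $ k) * (\<kappa> w * h w))" for k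
  proof (rule int)
    show "growth (0 + 0 + (l + - \<delta>)) (1 + 1 + (- (\<sigma> + 1) + - 5)) (\<lambda>w. (w $ k - z $ k) * cnj (w $ k) * (\<kappa> w * h w))"
      by (intro growth_mult growth_coord_diff growth_cnj growth_coord g\<kappa>)
  qed (use \<delta> \<sigma> in \<open>auto intro!: continuous_intros c\<kappa> simp: \<sigma>_def\<close>)
  have I1: "I1 k = 0" if k: "k \<noteq> top_idx" for k
  proof -
    have L: "cnj (Lop k (kpow \<sigma> z) w) * h w = - of_real \<sigma> * ((w $ k - z $ k) * (cnj (kpow (\<sigma> + 1) z w) * h w))"
      if "w \<in> siegel" for w
      by (simp add: Lop_kpow[OF z that k])
    have "(LINT w:siegel|lborel. of_real (rho w powr l) * (cnj (Lop k (kpow \<sigma> z) w) * h w)) = 0"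
    proof (rule tangential_by_parts[OF holo_on_kpow[OF z] gk(1) h _ _ k])
      have "growth 0 1 (\<lambda>w. - of_real \<sigma> * (w $ k - z $ k))" by (intro growth_cmult growth_coord_diff)
      from growth_mult[OF this growth_mult[OF growth_cnj[OF gk(2)] h(2)], unfolded add_0]
      show "growth (- \<delta>) (1 + (- (\<sigma> + 1) + - 5)) (\<lambda>w. cnj (Lop k (kpow \<sigma> z) w) * h w)"
        by (rule growth_cong) (simp only: L, simp add: norm_mult mult_ac)
    qed (use \<delta> \<sigma> in \<open>auto simp: \<sigma>_def\<close>)
    also have "(LINT w:siegel|lborel. of_real (rho w powr l) * (cnj (Lop k (kpow \<sigma> z) w) * h w))
       = (LINT w:siegel|lborel. - of_real \<sigma> * ((w $ k - z $ k) * (\<kappa> w * h w)))"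
      by (rule set_lebesgue_integral_cong, simp, intro allI impI, simp only: L \<kappa>_def s, simp)
    also have "\<dots> = - of_real \<sigma> * I1 k" unfolding I1_def by (rule set_integral_mult_right)
    finally show ?thesis using \<sigma> by simp
  qed
  \<comment> \<open>The argument for \<open>I1\<close> with the factor \<open>w $ k\<close> in front
    of the kernel: the product rule adds the undifferentiated \<open>kpow \<sigma> z\<close>, whose
    integral is \<open>A\<close>.\<close>
  have I2: "of_real \<sigma> * I2 k = A" if k: "k \<noteq> top_idx" for k
  proof -
    let ?b = "\<lambda>w. w $ k * kpow \<sigma> z w"
    have hb: "holo_on ?b siegel" "growth 0 (1 + - \<sigma>) ?b"
      using growth_mult[OF growth_coord[of k] gk(1)] by (auto intro!: holo_on_mult holo_on_coord holo_on_kpow z)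
    have L: "cnj (Lop k ?b w) = cnj (kpow \<sigma> z w) - of_real \<sigma> * ((w $ k - z $ k) * cnj (w $ k) * cnj (kpow (\<sigma> + 1) z w))"
      if w: "w \<in> siegel" for w
    proof -
      have "Lop k ?b w = kpow \<sigma> z w + w $ k * Lop k (kpow \<sigma> z) w"
        using k by (simp add: Lop_def pd_mult[OF holo_on_coord holo_on_kpow[OF z] w] pd_coord algebra_simps)
      thus ?thesis by (simp add: Lop_kpow[OF z w k])
    qed
    have "(LINT w:siegel|lborel. of_real (rho w powr l) * (cnj (Lop k ?b w) * h w)) = 0"
    proof (rule tangential_by_parts[OF hb h _ _ k])
      have 1: "growth 0 (- \<sigma> + 1) (\<lambda>w. cnj (kpow \<sigma> z w))"
        by (rule growth_weaken[OF growth_cnj[OF gk(1)]]) auto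
      have "growth (0 + 0 + 0) (1 + 1 + - (\<sigma> + 1)) (\<lambda>w. (w $ k - z $ k) * cnj (w $ k) * cnj (kpow (\<sigma> + 1) z w))"
        by (intro growth_mult growth_coord_diff growth_cnj growth_coord gk)
      hence 2: "growth 0 (- \<sigma> + 1) (\<lambda>w. (w $ k - z $ k) * cnj (w $ k) * cnj (kpow (\<sigma> + 1) z w))" by simp
      have "growth 0 (- \<sigma> + 1) (\<lambda>w. cnj (kpow \<sigma> z w) + (- of_real \<sigma>) * ((w $ k - z $ k) * cnj (w $ k) * cnj (kpow (\<sigma> + 1) z w)))"
        by (intro growth_add growth_cmult 1 2)
      from growth_mult[OF this h(2)]
      show "growth (- \<delta>) (- \<sigma> + 1 + - 5) (\<lambda>w. cnj (Lop k ?b w) * h w)"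
        by (auto intro: growth_cong simp: L)
    qed (use \<delta> \<sigma> in \<open>auto simp: \<sigma>_def\<close>)
    also have "(LINT w:siegel|lborel. of_real (rho w powr l) * (cnj (Lop k ?b w) * h w))
       = (LINT w:siegel|lborel. of_real (rho w powr l) * (cnj (kpow \<sigma> z w) * h w) - of_real \<sigma> * ((w $ k - z $ k) * cnj (w $ k) * (\<kappa> w * h w)))"
      by (rule set_lebesgue_integral_cong, simp, intro allI impI, simp only: L \<kappa>_def s, simp add: algebra_simps)
    also have "\<dots> = A - of_real \<sigma> * I2 k"
      unfolding A_def I2_def by (subst set_integral_diff[OF iA set_integrable_mult_right[OF i2]]) simp
    finally show ?thesis by simp
  qed
  \<comment> \<open>\<open>A\<close> and \<open>B\<close> differ by one power of \<open>rho\<close>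
    and one of the kernel's base, which is the trade made by differentiation in the normal direction
    with weight exponent \<open>l + 1\<close>.\<close>
  have N: "of_real (l + 1) * A = of_real \<sigma> * B"
  proof -
    have "of_real (l + 1) * \<i> * (LINT w:siegel|lborel. of_real (rho w powr (l + 1 - 1)) * (cnj (kpow \<sigma> z w) * h w))
      + 2 * (LINT w:siegel|lborel. of_real (rho w powr (l + 1)) * (cnj (pd top_idx (kpow \<sigma> z) w) * h w)) = 0"
      by (rule normal_by_parts(3)[OF holo_on_kpow[OF z] gk(1) h]) (use \<delta> \<sigma> in \<open>auto simp: \<sigma>_def\<close>)
    moreover have "(LINT w:siegel|lborel. of_real (rho w powr (l + 1)) * (cnj (pd top_idx (kpow \<sigma> z) w) * h w))
       = (LINT w:siegel|lborel. (- of_real \<sigma> * \<i> / 2) * (of_real (rho w powr (l + 1)) * (cnj (kpow (\<sigma> + 1) z w) * h w)))"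
      by (rule set_lebesgue_integral_cong) (auto simp: pd_kpow[OF z])
    moreover have "\<dots> = (- of_real \<sigma> * \<i> / 2) * B"
      unfolding B_def by (rule set_integral_mult_right)
    moreover have "l + 1 - 1 = l" by simp
    ultimately have "of_real (l + 1) * \<i> * A + 2 * ((- of_real \<sigma> * \<i> / 2) * B) = 0"
      unfolding A_def by (simp only:)
    hence "\<i> * (of_real (l + 1) * A - of_real \<sigma> * B) = 0"
      by (simp add: algebra_simps)
    thus ?thesis by (simp only: mult_eq_0_iff complex_i_not_zero simp_thms eq_iff_diff_eq_0[symmetric])
  qed
  show ?thesis
  proof (cases "j = top_idx")
    case False
    thus ?thesis using I1[of j] by (simp add: I1_def)
  next
    case True
    have "(LINT w:siegel|lborel. (w $ j - z $ j) * (\<kappa> w * h w)) =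
      (LINT w:siegel|lborel. (- 2 * \<i>) * ((of_real (rho w powr l) * (cnj (kpow \<sigma> z w) * h w) - of_real (rho w powr (l + 1)) * (cnj (kpow (\<sigma> + 1) z w) * h w))
         - (\<Sum>k\<in>{..<top_idx}. (w $ k - z $ k) * cnj (w $ k) * (\<kappa> w * h w))))"
    proof (rule set_lebesgue_integral_cong)
      show "\<forall>w. w \<in> siegel \<longrightarrow> (w $ j - z $ j) * (\<kappa> w * h w) = (- 2 * \<i>) * ((of_real (rho w powr l) * (cnj (kpow \<sigma> z w) * h w) - of_real (rho w powr (l + 1)) * (cnj (kpow (\<sigma> + 1) z w) * h w))
         - (\<Sum>k\<in>{..<top_idx}. (w $ k - z $ k) * cnj (w $ k) * (\<kappa> w * h w)))"
      proof (intro allI impI)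
        fix w :: "(complex, 'n) vec" assume w: "w \<in> siegel"
        have a: "cnj (kpow \<sigma> z w) = cnj (kpow (\<sigma> + 1) z w) * rho2 z w"
          by (subst kpow_mult_rho2[OF z w, symmetric]) (simp add: rho2_cnj)
        have b: "of_real (rho w powr (l + 1)) = of_real (rho w powr l) * complex_of_real (rho w)"
          using siegelD(1)[OF w] by (simp add: powr_add)
        show "(w $ j - z $ j) * (\<kappa> w * h w) = (- 2 * \<i>) * ((of_real (rho w powr l) * (cnj (kpow \<sigma> z w) * h w) - of_real (rho w powr (l + 1)) * (cnj (kpow (\<sigma> + 1) z w) * h w))
         - (\<Sum>k\<in>{..<top_idx}. (w $ k - z $ k) * cnj (w $ k) * (\<kappa> w * h w)))"
          unfolding True top_coord_identity[of w z] a b sum_distrib_right[symmetric] \<kappa>_def s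
          by (simp add: algebra_simps)
      qed
    qed simp
    also have "\<dots> = (- 2 * \<i>) * ((A - B) - (\<Sum>k\<in>{..<top_idx::'n}. I2 k))"
    proof -
      have S1: "set_integrable lborel siegel (\<lambda>w. \<Sum>k\<in>{..<top_idx}. (w $ k - z $ k) * cnj (w $ k) * (\<kappa> w * h w))"
        unfolding set_integrable_def scaleR_sum_right
        by (rule Bochner_Integration.integrable_sum) (rule i2[unfolded set_integrable_def])
      have S2: "(LINT w:siegel|lborel. \<Sum>k\<in>{..<top_idx}. (w $ k - z $ k) * cnj (w $ k) * (\<kappa> w * h w)) = (\<Sum>k\<in>{..<top_idx}. I2 k)"
        unfolding set_lebesgue_integral_def scaleR_sum_right I2_def
        by (rule Bochner_Integration.integral_sum) (rule i2[unfolded set_integrable_def])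
      show ?thesis
        by (simp only: set_integral_mult_right set_integral_diff(2)[OF set_integral_diff(1)[OF iA iB] S1]
            set_integral_diff(2)[OF iA iB] S2 A_def B_def)
    qed
    also have "(\<Sum>k\<in>{..<top_idx::'n}. I2 k) = of_real (real CARD('n) - 1) * (A / of_real \<sigma>)"
    proof -
      have "(\<Sum>k\<in>{..<top_idx::'n}. I2 k) = (\<Sum>k\<in>{..<top_idx::'n}. A / of_real \<sigma>)"
        by (intro sum.cong refl) (use I2 below_top \<sigma> in \<open>auto simp: field_simps\<close>)
      thus ?thesis using n1 by (simp add: card_below_top of_nat_diff)
    qed
    also have "B = of_real (l + 1) * A / of_real \<sigma>" using N \<sigma> by (simp add: field_simps)
    \<comment> \<open>In units of \<open>A / \<sigma>\<close> the three terms are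
      \<open>\<sigma>\<close>, \<open>l + 1\<close> and \<open>n - 1\<close>, and
      \<open>\<sigma> = n + l\<close>. Here the exponent of the kernel is tied to the dimension and
      the weight.\<close>
    also have "A - of_real (l + 1) * A / of_real \<sigma> - of_real (real CARD('n) - 1) * (A / of_real \<sigma>) = 0"
    proof -
      have "complex_of_real \<sigma> \<noteq> 0" using \<sigma> by simp
      thus ?thesis by (simp add: field_simps) (simp add: \<sigma>_def algebra_simps)
    qed
    finally show ?thesis by simp
  qed
qed

section \<open>The reproducing formula\<close>

lemma cdiff_scaleR:
  fixes h :: "complex ^ 'n::finite \<Rightarrow> complex"
  assumes "holo_on h S" "x \<in> S"
  shows "cdiff h x (r *\<^sub>R v) = of_real r * cdiff h x v"
  by (simp add: scaleR_eq_smult[of r v] cdiff_smult[OF assms])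

text \<open>Along a segment the imaginary part of the top coordinate is affine and
  \<open>sqsum\<close> is convex, so \<open>rho\<close> is concave; \<open>wt\<close>, the modulus
  of an affine function, is convex.\<close>

lemma segment_siegel:
  fixes z w :: "(complex, 'n::{finite,linorder}) vec"
  assumes z: "z \<in> siegel" and w: "w \<in> siegel" and t: "0 \<le> t" "t \<le> 1"
  shows "(1 - t) * rho z + t * rho w \<le> rho (z + t *\<^sub>R (w - z))" "z + t *\<^sub>R (w - z) \<in> siegel"
    "wt (z + t *\<^sub>R (w - z)) \<le> wt z + wt w"
proof -
  have comp: "(z + t *\<^sub>R (w - z)) $ j = (1 - t) *\<^sub>R (z $ j) + t *\<^sub>R (w $ j)" for j
    by (simp add: algebra_simps)
  have sq: "(cmod ((z + t *\<^sub>R (w - z)) $ j))\<^sup>2 \<le> (1 - t) * (cmod (z $ j))\<^sup>2 + t * (cmod (w $ j))\<^sup>2" for j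
  proof -
    have "cmod ((z + t *\<^sub>R (w - z)) $ j) \<le> (1 - t) * cmod (z $ j) + t * cmod (w $ j)"
      unfolding comp by (rule order_trans[OF norm_triangle_ineq]) (use t in simp)
    hence "(cmod ((z + t *\<^sub>R (w - z)) $ j))\<^sup>2 \<le> ((1 - t) * cmod (z $ j) + t * cmod (w $ j))\<^sup>2"
      by (intro power_mono) auto
    also have "\<dots> = (1 - t) * (cmod (z $ j))\<^sup>2 + t * (cmod (w $ j))\<^sup>2 - t * (1 - t) * (cmod (z $ j) - cmod (w $ j))\<^sup>2"
      by (simp add: power2_eq_square algebra_simps)
    also have "\<dots> \<le> (1 - t) * (cmod (z $ j))\<^sup>2 + t * (cmod (w $ j))\<^sup>2" using t by simp
    finally show ?thesis .
  qed
  have "sqsum (z + t *\<^sub>R (w - z)) \<le> (\<Sum>j\<in>{..<top_idx}. (1 - t) * (cmod (z $ j))\<^sup>2 + t * (cmod (w $ j))\<^sup>2)"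
    unfolding sqsum_def by (intro sum_mono sq)
  also have "\<dots> = (1 - t) * sqsum z + t * sqsum w"
    by (simp add: sqsum_def sum.distrib sum_distrib_left)
  finally have "sqsum (z + t *\<^sub>R (w - z)) \<le> (1 - t) * sqsum z + t * sqsum w" .
  moreover have "Im ((z + t *\<^sub>R (w - z)) $ top_idx) = (1 - t) * Im (z $ top_idx) + t * Im (w $ top_idx)"
    by (simp only: comp) (simp add: algebra_simps)
  ultimately show r: "(1 - t) * rho z + t * rho w \<le> rho (z + t *\<^sub>R (w - z))"
    by (simp add: rho_eq algebra_simps)
  have "min (rho z) (rho w) \<le> (1 - t) * rho z + t * rho w"
  proof -
    have "(1 - t) * min (rho z) (rho w) + t * min (rho z) (rho w) \<le> (1 - t) * rho z + t * rho w"
      using t by (intro add_mono mult_left_mono) auto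
    thus ?thesis by (simp add: algebra_simps)
  qed
  thus "z + t *\<^sub>R (w - z) \<in> siegel"
    using r siegelD(1)[OF z] siegelD(1)[OF w] by (simp add: siegel_def)
  have "(z + t *\<^sub>R (w - z)) $ top_idx + \<i> = (1 - t) *\<^sub>R (z $ top_idx + \<i>) + t *\<^sub>R (w $ top_idx + \<i>)"
    unfolding comp by (simp add: algebra_simps)
  hence "wt (z + t *\<^sub>R (w - z)) \<le> (1 - t) * wt z + t * wt w"
    unfolding wt_def by (simp only:) (rule order_trans[OF norm_triangle_ineq], use t in simp)
  also have "\<dots> \<le> 1 * wt z + 1 * wt w"
    using t by (intro add_mono mult_right_mono) (auto simp: wt_def)
  finally show "wt (z + t *\<^sub>R (w - z)) \<le> wt z + wt w" by simp
qed

lemma rho_segment_min: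
  fixes z w :: "(complex, 'n::{finite,linorder}) vec"
  assumes "z \<in> siegel" "w \<in> siegel" "0 \<le> t" "t \<le> 1"
  shows "min (rho z) (rho w) \<le> rho (z + t *\<^sub>R (w - z))"
proof -
  have "(1 - t) * min (rho z) (rho w) + t * min (rho z) (rho w) \<le> (1 - t) * rho z + t * rho w"
    using assms by (intro add_mono mult_left_mono) auto
  thus ?thesis using segment_siegel(1)[OF assms] by (simp add: algebra_simps)
qed

lemma holo_on_contraction:
  fixes z :: "(complex, 'n::{finite,linorder}) vec"
  assumes h: "holo_on h siegel" and z: "z \<in> siegel" and t: "0 \<le> t" "t \<le> 1"
  shows "holo_on (\<lambda>w. h (z + t *\<^sub>R (w - z))) siegel"
  unfolding holo_on_def
proof
  fix w :: "(complex, 'n) vec" assume w: "w \<in> siegel"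
  note zw = segment_siegel(2)[OF z w t]
  have "((\<lambda>w. z + t *\<^sub>R (w - z)) has_derivative (\<lambda>v. t *\<^sub>R v)) (at w)"
    by (auto intro!: derivative_eq_intros)
  from has_derivative_compose[OF this holo_has_derivative[OF h zw]]
  have "((\<lambda>w. h (z + t *\<^sub>R (w - z))) has_derivative (\<lambda>v. cdiff h (z + t *\<^sub>R (w - z)) (t *\<^sub>R v))) (at w)" .
  moreover have "cdiff h (z + t *\<^sub>R (w - z)) (t *\<^sub>R (c *s v)) = c * cdiff h (z + t *\<^sub>R (w - z)) (t *\<^sub>R v)" for c v
    by (simp add: cdiff_scaleR[OF h zw] cdiff_smult[OF h zw])
  ultimately show "\<exists>D. ((\<lambda>w. h (z + t *\<^sub>R (w - z))) has_derivative D) (at w) \<and> (\<forall>c v. D (c *s v) = c * D v)"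
    by blast
qed

text \<open>The chain rule along the segment yields the very coefficients
  \<open>w $ j - z $ j\<close> that the kernel annihilates.\<close>

lemma segment_has_integral:
  fixes z :: "(complex, 'n::{finite,linorder}) vec"
  assumes g: "holo_on g siegel" and z: "z \<in> siegel" and w: "w \<in> siegel" and \<tau>: "0 \<le> \<tau>" "\<tau> \<le> 1"
  shows "((\<lambda>t. \<Sum>j\<in>UNIV. (w $ j - z $ j) * pd j g (z + t *\<^sub>R (w - z))) has_integral (g (z + \<tau> *\<^sub>R (w - z)) - g z)) {0..\<tau>}"
proof -
  have d: "((\<lambda>t. g (z + t *\<^sub>R (w - z))) has_vector_derivative (\<Sum>j\<in>UNIV. (w $ j - z $ j) * pd j g (z + t *\<^sub>R (w - z)))) (at t)"
    if t: "t \<in> {0..\<tau>}" for t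
  proof -
    have zw: "z + t *\<^sub>R (w - z) \<in> siegel" by (rule segment_siegel(2)[OF z w]) (use t \<tau> in auto)
    have "((\<lambda>t. z + t *\<^sub>R (w - z)) has_derivative (\<lambda>x. x *\<^sub>R (w - z))) (at t)"
      by (auto intro!: derivative_eq_intros)
    from has_derivative_compose[OF this holo_has_derivative[OF g zw]]
    have "((\<lambda>t. g (z + t *\<^sub>R (w - z))) has_derivative (\<lambda>x. cdiff g (z + t *\<^sub>R (w - z)) (x *\<^sub>R (w - z)))) (at t)" .
    moreover have "cdiff g (z + t *\<^sub>R (w - z)) (x *\<^sub>R (w - z)) = x *\<^sub>R (\<Sum>j\<in>UNIV. (w $ j - z $ j) * pd j g (z + t *\<^sub>R (w - z)))" for x
      by (simp add: cdiff_scaleR[OF g zw] cdiff_eq_sum_pd[OF g zw] scaleR_conv_of_real[where 'a=complex]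
          sum_distrib_left mult.assoc)
    ultimately show ?thesis by (simp add: has_vector_derivative_def)
  qed
  have "((\<lambda>t. \<Sum>j\<in>UNIV. (w $ j - z $ j) * pd j g (z + t *\<^sub>R (w - z))) has_integral (g (z + \<tau> *\<^sub>R (w - z)) - g (z + 0 *\<^sub>R (w - z)))) {0..\<tau>}"
    by (rule fundamental_theorem_of_calculus[OF \<tau>(1)]) (rule has_vector_derivative_at_within[OF d])
  thus ?thesis by simp
qed

text \<open>Contracting \<open>g\<close> towards \<open>z\<close> does not change its integral against the kernel: the derivative in
  the contraction parameter vanishes by \<open>kernel_annihilates\<close>.\<close>

lemma kernel_contraction:
  fixes z :: "(complex, 'n::{finite,linorder}) vec"
  assumes l: "l > -1" and z: "z \<in> siegel"
    and g: "holo_on g siegel" "growth (- \<delta>) 0 g" and m: "holo_on m siegel" "growth (- \<delta>) (- 8) m"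
    and \<delta>: "0 \<le> \<delta>" "l - 2 * \<delta> > -1" and \<tau>: "0 \<le> \<tau>" "\<tau> < 1"
  defines "\<kappa> \<equiv> \<lambda>w. of_real (rho w powr l) * cnj (kpow (real CARD('n) + 1 + l) z w)"
  shows "(LINT w:siegel|lborel. \<kappa> w * (m w * (g (z + \<tau> *\<^sub>R (w - z)) - g z))) = 0"
proof -
  define s where "s = real CARD('n) + 1 + l"
  have s0: "s \<ge> 0" using l by (simp add: s_def)
  note ck = holo_continuous_on[OF holo_on_kpow[OF z]] and cm = holo_continuous_on[OF m(1)] and cg = holo_continuous_on[OF g(1)]
  have cpd: "continuous_on siegel (pd j g)" for j by (rule holo_continuous_on[OF holo_on_pd[OF g(1) open_siegel]])
  have c\<kappa>: "continuous_on siegel (\<lambda>w. \<kappa> w * m w)"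
    unfolding \<kappa>_def by (intro continuous_intros ck cm continuous_on_rho_powr)
  have g\<kappa>: "growth (l + - \<delta>) (- s + - 8) (\<lambda>w. \<kappa> w * m w)"
  proof -
    have "growth (l + 0 + - \<delta>) (0 + - s + - 8) (\<lambda>w. \<kappa> w * m w)"
      unfolding \<kappa>_def s_def[symmetric] by (intro growth_mult growth_rho growth_cnj growth_kpow z s0 m)
    thus ?thesis by simp
  qed
  define I where "I = {0..\<tau>}"
  have I01: "0 \<le> t \<and> t \<le> 1" if "t \<in> I" for t using that \<tau> by (auto simp: I_def)
  define P where "P t w = (\<Sum>j\<in>UNIV. (w $ j - z $ j) * pd j g (z + t *\<^sub>R (w - z)))" for t w
  define \<Phi> where "\<Phi> t w = indicator (I \<times> siegel) (t, w) *\<^sub>R (\<kappa> w * m w * P t w)" for t :: real and w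
  have cseg: "continuous_on (I \<times> siegel) (\<lambda>(t, w). pd j g (z + t *\<^sub>R (w - z)))" for j
  proof -
    have "continuous_on (I \<times> siegel) (\<lambda>x. pd j g (z + fst x *\<^sub>R (snd x - z)))"
      by (rule continuous_on_compose2[OF cpd]) (auto intro!: continuous_intros segment_siegel(2)[OF z] dest: I01)
    thus ?thesis by (simp add: case_prod_unfold)
  qed
  have meas: "(\<lambda>(t, w). \<Phi> t w) \<in> borel_measurable (borel \<Otimes>\<^sub>M borel)"
  proof -
    have "continuous_on (I \<times> siegel) (\<lambda>x. \<kappa> (snd x) * m (snd x))"
      by (rule continuous_on_compose2[OF c\<kappa>]) (auto intro!: continuous_intros)
    hence c: "continuous_on (I \<times> siegel) (\<lambda>x. \<kappa> (snd x) * m (snd x) * P (fst x) (snd x))"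
      unfolding P_def using cseg by (auto intro!: continuous_intros simp: case_prod_unfold)
    have "I \<times> (siegel :: (complex, 'n) vec set) \<in> sets (borel \<Otimes>\<^sub>M borel)"
      by (intro pair_measureI) (auto simp: I_def)
    hence Is: "I \<times> (siegel :: (complex, 'n) vec set) \<in> sets borel"
      by (simp only: borel_prod)
    have "(\<lambda>x. indicator (I \<times> siegel) x *\<^sub>R (\<kappa> (snd x) * m (snd x) * P (fst x) (snd x))) \<in> borel_measurable borel"
      by (rule borel_measurable_continuous_on_indicator[OF Is c])
    thus ?thesis by (simp add: borel_prod \<Phi>_def case_prod_unfold)
  qed
  obtain C where C: "C \<ge> 0" "\<And>j w t. w \<in> siegel \<Longrightarrow> t \<in> I \<Longrightarrow> cmod (pd j g (z + t *\<^sub>R (w - z))) \<le> C * wt w"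
  proof -
    have "\<exists>C\<ge>0. \<forall>w\<in>siegel. cmod (pd j g w) \<le> C * (rho w powr (- \<delta> - 1) * wt w powr (0 + 1))" for j
      using growth_pd[OF g, of j] unfolding growth_def .
    then obtain D where D: "\<And>j. D j \<ge> 0" "\<And>j w. w \<in> siegel \<Longrightarrow> cmod (pd j g w) \<le> D j * (rho w powr (- \<delta> - 1) * wt w powr (0 + 1))"
      by metis
    \<comment> \<open>As \<open>\<tau> < 1\<close>, the contracted point keeps a height of at least
      \<open>(1 - \<tau>) * rho z\<close>, however close \<open>w\<close> is to the boundary. The
      derivatives of \<open>g\<close> there are bounded by a multiple of \<open>wt w\<close>,
      without any negative power of \<open>rho w\<close>.\<close>
    define r where "r = (1 - \<tau>) * rho z"
    have r: "r > 0" using siegelD(1)[OF z] \<tau> by (simp add: r_def)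
    define E where "E = (\<Sum>j\<in>UNIV. D j) * (r powr (- \<delta> - 1) * (wt z + 1))"
    have wz: "wt z \<ge> 1" using siegelD(4)[OF z] .
    have "cmod (pd j g (z + t *\<^sub>R (w - z))) \<le> E * wt w" if w: "w \<in> siegel" and t: "t \<in> I" for j w t
    proof -
      have t01: "0 \<le> t" "t \<le> 1" using I01[OF t] by auto
      note seg = segment_siegel[OF z w t01]
      have "(1 - \<tau>) * rho z \<le> (1 - t) * rho z" using t siegelD(1)[OF z] by (intro mult_right_mono) (auto simp: I_def)
      also have "\<dots> \<le> (1 - t) * rho z + t * rho w" using t01 siegelD(1)[OF w] by simp
      finally have "r \<le> rho (z + t *\<^sub>R (w - z))" using seg(1) by (simp add: r_def)
      hence 1: "rho (z + t *\<^sub>R (w - z)) powr (- \<delta> - 1) \<le> r powr (- \<delta> - 1)"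
        using r \<delta> by (intro powr_mono2') auto
      have "wt (z + t *\<^sub>R (w - z)) \<le> wt z + wt w" by (rule seg(3))
      also have "\<dots> \<le> (wt z + 1) * wt w" using wz siegelD(4)[OF w] by (simp add: algebra_simps)
      finally have 2: "wt (z + t *\<^sub>R (w - z)) powr (0 + 1) \<le> (wt z + 1) * wt w"
        using siegelD(4)[OF seg(2)] by simp
      have "cmod (pd j g (z + t *\<^sub>R (w - z))) \<le> D j * (rho (z + t *\<^sub>R (w - z)) powr (- \<delta> - 1) * wt (z + t *\<^sub>R (w - z)) powr (0 + 1))"
        by (rule D(2)[OF seg(2)])
      also have "\<dots> \<le> (\<Sum>j\<in>UNIV. D j) * (r powr (- \<delta> - 1) * ((wt z + 1) * wt w))"
        using D(1) wz by (intro mult_mono 1 2 member_le_sum sum_nonneg mult_nonneg_nonneg) auto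
      finally show ?thesis by (simp add: E_def mult_ac)
    qed
    moreover have "E \<ge> 0" using D(1) wz by (auto simp: E_def intro!: mult_nonneg_nonneg sum_nonneg)
    ultimately show ?thesis using that by blast
  qed
  define B where "B w = indicator siegel w *\<^sub>R (\<Sum>j\<in>(UNIV::'n set). C * cmod (\<kappa> w * m w * (w $ j - z $ j) * of_real (wt w)))" for w
  have Bint: "integrable lborel B"
  proof -
    have "set_integrable lborel siegel (\<lambda>w. cmod (\<kappa> w * m w * (w $ j - z $ j) * of_real (wt w)))" for j
    proof (rule set_integrable_growth_norm)
      have gw: "growth 0 1 (\<lambda>w::(complex, 'n) vec. of_real (wt w))"
        by (rule growthI[where C=1]) (use siegelD(1,4) in \<open>force simp: \<close>)
      show "growth (l + - \<delta> + 0 + 0) (- s + - 8 + 1 + 1) (\<lambda>w. \<kappa> w * m w * (w $ j - z $ j) * of_real (wt w))"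
        by (intro growth_mult g\<kappa> growth_coord_diff gw)
    qed (use \<delta> in \<open>auto intro!: continuous_intros c\<kappa> simp: s_def\<close>)
    hence "set_integrable lborel siegel (\<lambda>w. C * cmod (\<kappa> w * m w * (w $ j - z $ j) * of_real (wt w)))" for j
      by (intro set_integrable_mult_right)
    thus ?thesis unfolding B_def[abs_def] set_integrable_def scaleR_sum_right
      by (intro Bochner_Integration.integrable_sum)
  qed
  have \<Phi>B: "cmod (\<Phi> t w) \<le> B w" if "t \<in> I" for t w
  proof (cases "w \<in> siegel")
    case True
    have "cmod (\<Phi> t w) = cmod (\<kappa> w * m w * P t w)" using True that by (simp add: \<Phi>_def)
    also have "\<dots> \<le> (\<Sum>j\<in>UNIV. cmod (\<kappa> w * m w * ((w $ j - z $ j) * pd j g (z + t *\<^sub>R (w - z)))))"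
      unfolding P_def sum_distrib_left by (rule norm_sum)
    also have "\<dots> \<le> (\<Sum>j\<in>UNIV. C * cmod (\<kappa> w * m w * (w $ j - z $ j) * of_real (wt w)))"
    proof (rule sum_mono)
      fix j
      have "cmod (\<kappa> w * m w * (w $ j - z $ j)) * cmod (pd j g (z + t *\<^sub>R (w - z))) \<le> cmod (\<kappa> w * m w * (w $ j - z $ j)) * (C * wt w)"
        by (intro mult_left_mono C True that) auto
      thus "cmod (\<kappa> w * m w * ((w $ j - z $ j) * pd j g (z + t *\<^sub>R (w - z)))) \<le> C * cmod (\<kappa> w * m w * (w $ j - z $ j) * of_real (wt w))"
        using siegelD(4)[OF True] by (simp add: norm_mult mult_ac)
    qed
    finally show ?thesis using True by (simp add: B_def)
  qed (simp add: \<Phi>_def B_def)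
  have int: "integrable (lborel \<Otimes>\<^sub>M lborel) (\<lambda>(t, w). indicator {0..\<tau>} t *\<^sub>R \<Phi> t w)"
    by (rule integrable_dominated_interval[OF meas Bint]) (use \<Phi>B in \<open>auto simp: I_def\<close>)
  have zero: "(LINT w|lborel. \<Phi> t w) = 0" if t: "t \<in> {0..\<tau>}" for t
  proof -
    have tI: "t \<in> I" using t by (simp add: I_def)
    have t01: "0 \<le> t" "t \<le> 1" using I01[OF tI] by auto
    have int_j: "set_integrable lborel siegel (\<lambda>w. (w $ j - z $ j) * (\<kappa> w * (pd j g (z + t *\<^sub>R (w - z)) * m w)))"
      and zero_j: "(LINT w:siegel|lborel. (w $ j - z $ j) * (\<kappa> w * (pd j g (z + t *\<^sub>R (w - z)) * m w))) = 0" for j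
    proof -
      let ?p = "\<lambda>w. pd j g (z + t *\<^sub>R (w - z))"
      have hp: "holo_on ?p siegel" by (rule holo_on_contraction[OF holo_on_pd[OF g(1) open_siegel] z t01])
      have gp: "growth 0 1 ?p"
        by (rule growthI[where C=C]) (use C(2)[OF _ tI] siegelD(1,4) in force)
      have h: "holo_on (\<lambda>w. ?p w * m w) siegel" by (intro holo_on_mult hp m)
      have gh: "growth (0 + - \<delta>) (1 + - 8) (\<lambda>w. ?p w * m w)" by (intro growth_mult gp m)
      \<comment> \<open>Of the decay 8 of \<open>m\<close> the derivative of \<open>g\<close> takes
        one order, and the rest exceeds the 5 that \<open>kernel_annihilates\<close> asks
        for.\<close>
      have "growth (- \<delta>) (- 5) (\<lambda>w. ?p w * m w)" by (rule growth_weaken[OF gh]) auto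
      from kernel_annihilates[OF l z h this \<delta>(1), of j] \<delta>
      show "(LINT w:siegel|lborel. (w $ j - z $ j) * (\<kappa> w * (?p w * m w))) = 0"
        by (simp add: \<kappa>_def)
      have "growth (0 + (l + - \<delta>) + 0) (1 + (- s + - 8) + 1) (\<lambda>w. (w $ j - z $ j) * (\<kappa> w * m w) * ?p w)"
        by (intro growth_mult growth_coord_diff g\<kappa> gp)
      moreover have "(\<lambda>w. (w $ j - z $ j) * (\<kappa> w * m w) * ?p w) = (\<lambda>w. (w $ j - z $ j) * (\<kappa> w * (?p w * m w)))"
        by (simp add: mult_ac)
      moreover have "continuous_on siegel (\<lambda>w. (w $ j - z $ j) * (\<kappa> w * m w) * ?p w)"
        by (intro continuous_intros c\<kappa> holo_continuous_on[OF hp])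
      ultimately show "set_integrable lborel siegel (\<lambda>w. (w $ j - z $ j) * (\<kappa> w * (?p w * m w)))"
        using set_integrable_growth[of "\<lambda>w. (w $ j - z $ j) * (\<kappa> w * m w) * ?p w"] \<delta>
        by (simp add: s_def)
    qed
    have "(LINT w|lborel. \<Phi> t w) = (LINT w|lborel. (\<Sum>j\<in>UNIV. indicator siegel w *\<^sub>R ((w $ j - z $ j) * (\<kappa> w * (pd j g (z + t *\<^sub>R (w - z)) * m w)))))"
      using tI by (intro Bochner_Integration.integral_cong refl)
        (auto simp: \<Phi>_def P_def indicator_def sum_distrib_left mult_ac)
    also have "\<dots> = 0"
      using int_j zero_j by (subst Bochner_Integration.integral_sum) (auto simp: set_integrable_def set_lebesgue_integral_def)
    finally show ?thesis .
  qed
  have "(LINT w|lborel. indicator siegel w *\<^sub>R (\<kappa> w * (m w * (g (z + \<tau> *\<^sub>R (w - z)) - g z)))) = \<tau> *\<^sub>R 0"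
  proof (rule integral_fubini_interval[OF \<tau>(1) int zero])
    fix w :: "(complex, 'n) vec"
    show "((\<lambda>t. \<Phi> t w) has_integral indicator siegel w *\<^sub>R (\<kappa> w * (m w * (g (z + \<tau> *\<^sub>R (w - z)) - g z)))) {0..\<tau>}"
    proof (cases "w \<in> siegel")
      case True
      have "((\<lambda>t. \<kappa> w * m w * P t w) has_integral (\<kappa> w * m w * (g (z + \<tau> *\<^sub>R (w - z)) - g z))) {0..\<tau>}"
        unfolding P_def by (intro has_integral_mult_right segment_has_integral g z True) (use \<tau> in auto)
      hence "((\<lambda>t. \<Phi> t w) has_integral (\<kappa> w * m w * (g (z + \<tau> *\<^sub>R (w - z)) - g z))) {0..\<tau>}"
        by (rule has_integral_eq[rotated]) (use True in \<open>simp add: \<Phi>_def I_def\<close>)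
      thus ?thesis using True by (simp add: mult_ac)
    qed (simp add: \<Phi>_def)
  next
    have "continuous_on siegel (\<lambda>w. g (z + \<tau> *\<^sub>R (w - z)))"
      by (rule holo_continuous_on[OF holo_on_contraction[OF g(1) z]]) (use \<tau> in auto)
    hence "continuous_on siegel (\<lambda>w. \<kappa> w * (m w * (g (z + \<tau> *\<^sub>R (w - z)) - g z)))"
      unfolding \<kappa>_def by (intro continuous_intros ck cm continuous_on_rho_powr)
    thus "(\<lambda>w. indicator siegel w *\<^sub>R (\<kappa> w * (m w * (g (z + \<tau> *\<^sub>R (w - z)) - g z)))) \<in> borel_measurable borel"
      by (intro borel_measurable_continuous_on_indicator) auto
  qed (auto simp: I_def)
  thus ?thesis by (simp add: set_lebesgue_integral_def)
qed

text \<open>Let \<open>\<tau>\<close> tend to 1 in \<open>kernel_contraction\<close>. On a segment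
  \<open>rho\<close> is at least the smaller of its values at the ends, so the singularity of
  \<open>g\<close> is bounded by those at \<open>z\<close> and at \<open>w\<close>, and the
  integrals are dominated. Both \<open>g\<close> and \<open>m\<close> may lose
  \<open>\<delta>\<close> at the boundary, whence the condition
  \<open>l - 2 * \<delta> > -1\<close>.\<close>

lemma kernel_exchange:
  fixes z :: "(complex, 'n::{finite,linorder}) vec"
  assumes l: "l > -1" and z: "z \<in> siegel"
    and g: "holo_on g siegel" "growth (- \<delta>) 0 g" and m: "holo_on m siegel" "growth (- \<delta>) (- 8) m"
    and \<delta>: "0 \<le> \<delta>" "l - 2 * \<delta> > -1"
  defines "\<kappa> \<equiv> \<lambda>w. of_real (rho w powr l) * cnj (kpow (real CARD('n) + 1 + l) z w)"
  shows "(LINT w:siegel|lborel. \<kappa> w * (m w * g w)) = g z * (LINT w:siegel|lborel. \<kappa> w * m w)"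
proof -
  define s where "s = real CARD('n) + 1 + l"
  have s0: "s \<ge> 0" using l by (simp add: s_def)
  note ck = holo_continuous_on[OF holo_on_kpow[OF z]] and cm = holo_continuous_on[OF m(1)] and cg = holo_continuous_on[OF g(1)]
  have c\<kappa>: "continuous_on siegel (\<lambda>w. \<kappa> w * m w)"
    unfolding \<kappa>_def by (intro continuous_intros ck cm continuous_on_rho_powr)
  have g\<kappa>: "growth (l + - \<delta>) (- s + - 8) (\<lambda>w. \<kappa> w * m w)"
  proof -
    have "growth (l + 0 + - \<delta>) (0 + - s + - 8) (\<lambda>w. \<kappa> w * m w)"
      unfolding \<kappa>_def s_def[symmetric] by (intro growth_mult growth_rho growth_cnj growth_kpow z s0 m)
    thus ?thesis by simp
  qed
  have i1: "set_integrable lborel siegel (\<lambda>w. \<kappa> w * m w)"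
    by (rule set_integrable_growth[OF c\<kappa> g\<kappa>]) (use \<delta> in \<open>auto simp: s_def\<close>)
  have i2: "set_integrable lborel siegel (\<lambda>w. \<kappa> w * m w * g w)"
    by (rule set_integrable_growth[OF _ growth_mult[OF g\<kappa> g(2)]])
      (use \<delta> in \<open>auto simp: s_def intro!: continuous_intros c\<kappa> cg\<close>)
  obtain C where C: "C \<ge> 0" "\<And>w. w \<in> siegel \<Longrightarrow> cmod (g w) \<le> C * (rho w powr (- \<delta>) * wt w powr 0)"
    using g(2) by (rule growthE) (rule that)
  define u where "u w = C * (rho z powr (- \<delta>) + rho w powr (- \<delta>)) + cmod (g z)" for w :: "(complex, 'n) vec"
  have u0: "u w \<ge> 0" for w using C(1) by (simp add: u_def)
  define \<tau> where "\<tau> k = 1 - 1 / real (Suc k)" for k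
  have \<tau>: "0 \<le> \<tau> k" "\<tau> k < 1" for k by (auto simp: \<tau>_def)
  have bound: "cmod (g (z + \<tau> k *\<^sub>R (w - z)) - g z) \<le> u w" if w: "w \<in> siegel" for k w
  proof -
    have \<tau>1: "\<tau> k \<le> 1" using \<tau>(2)[of k] by simp
    note seg = segment_siegel(2)[OF z w \<tau>(1) \<tau>1] and mn = rho_segment_min[OF z w \<tau>(1) \<tau>1]
    note rz = siegelD(1)[OF z] and rw = siegelD(1)[OF w]
    have "rho (z + \<tau> k *\<^sub>R (w - z)) powr (- \<delta>) \<le> min (rho z) (rho w) powr (- \<delta>)"
      using mn rz rw \<delta> by (intro powr_mono2') auto
    also have "\<dots> \<le> rho z powr (- \<delta>) + rho w powr (- \<delta>)" by (simp add: min_def)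
    finally have 1: "rho (z + \<tau> k *\<^sub>R (w - z)) powr (- \<delta>) \<le> rho z powr (- \<delta>) + rho w powr (- \<delta>)" .
    have "cmod (g (z + \<tau> k *\<^sub>R (w - z))) \<le> C * (rho (z + \<tau> k *\<^sub>R (w - z)) powr (- \<delta>) * wt (z + \<tau> k *\<^sub>R (w - z)) powr 0)"
      by (rule C(2)[OF seg])
    also have "\<dots> = C * rho (z + \<tau> k *\<^sub>R (w - z)) powr (- \<delta>)" using siegelD(4)[OF seg] by simp
    also have "\<dots> \<le> C * (rho z powr (- \<delta>) + rho w powr (- \<delta>))" by (intro mult_left_mono 1 C)
    finally show ?thesis
      using norm_triangle_ineq4[of "g (z + \<tau> k *\<^sub>R (w - z))" "g z"] by (simp add: u_def)
  qed
  have gu: "growth (- \<delta>) \<delta> (\<lambda>w::(complex, 'n) vec. of_real (u w))"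
  proof -
    have e: "complex_of_real (u w) = of_real (C * rho z powr (- \<delta>) + cmod (g z)) + of_real C * of_real (rho w powr (- \<delta>))" for w :: "(complex, 'n) vec"
      by (simp add: u_def algebra_simps)
    have 1: "growth (- \<delta>) \<delta> (\<lambda>w::(complex, 'n) vec. complex_of_real (C * rho z powr (- \<delta>) + cmod (g z)))"
      by (rule growth_weaken[OF growth_const]) (use \<delta> in auto)
    have 2: "growth (- \<delta>) \<delta> (\<lambda>w::(complex, 'n) vec. of_real C * of_real (rho w powr (- \<delta>)))"
      by (rule growth_weaken[OF growth_cmult[OF growth_rho]]) (use \<delta> in auto)
    show ?thesis unfolding e by (rule growth_add[OF 1 2])
  qed
  have B: "set_integrable lborel siegel (\<lambda>w. cmod (\<kappa> w * m w * of_real (u w)))"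
  proof (rule set_integrable_growth_norm[OF _ growth_mult[OF g\<kappa> gu]])
    show "continuous_on siegel (\<lambda>w. \<kappa> w * m w * of_real (u w))"
      unfolding u_def by (intro continuous_intros c\<kappa> continuous_on_rho_powr)
  qed (use \<delta> in \<open>auto simp: s_def\<close>)
  have "(\<lambda>k. LINT w:siegel|lborel. \<kappa> w * (m w * (g (z + \<tau> k *\<^sub>R (w - z)) - g z)))
     \<longlonglongrightarrow> (LINT w:siegel|lborel. \<kappa> w * (m w * (g w - g z)))"
  proof (rule siegel_dominated_convergence(2)[OF _ _ B])
    fix k
    have "continuous_on siegel (\<lambda>w. g (z + \<tau> k *\<^sub>R (w - z)))"
      by (rule holo_continuous_on[OF holo_on_contraction[OF g(1) z]]) (use \<tau>[of k] in auto)
    thus "continuous_on siegel (\<lambda>w. \<kappa> w * (m w * (g (z + \<tau> k *\<^sub>R (w - z)) - g z)))"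
      unfolding \<kappa>_def by (intro continuous_intros ck cm continuous_on_rho_powr)
  next
    show "continuous_on siegel (\<lambda>w. \<kappa> w * (m w * (g w - g z)))"
      unfolding \<kappa>_def by (intro continuous_intros ck cm cg continuous_on_rho_powr)
  next
    fix k and w :: "(complex, 'n) vec" assume w: "w \<in> siegel"
    have "cmod (\<kappa> w * m w) * cmod (g (z + \<tau> k *\<^sub>R (w - z)) - g z) \<le> cmod (\<kappa> w * m w) * u w"
      by (intro mult_left_mono bound w) auto
    thus "cmod (\<kappa> w * (m w * (g (z + \<tau> k *\<^sub>R (w - z)) - g z))) \<le> cmod (\<kappa> w * m w * of_real (u w))"
      using u0[of w] by (simp add: norm_mult mult_ac)
  next
    fix w :: "(complex, 'n) vec" assume w: "w \<in> siegel"
    have "(\<lambda>k. 1 / real (Suc k)) \<longlonglongrightarrow> 0" by (rule lim_1_over_n[THEN LIMSEQ_Suc])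
    hence "(\<lambda>k. z + \<tau> k *\<^sub>R (w - z)) \<longlonglongrightarrow> z + (1 - 0) *\<^sub>R (w - z)"
      unfolding \<tau>_def by (intro tendsto_intros)
    hence t: "(\<lambda>k. z + \<tau> k *\<^sub>R (w - z)) \<longlonglongrightarrow> w" by simp
    have "isCont g w" by (rule has_derivative_continuous[OF holo_has_derivative[OF g(1) w]])
    from isCont_tendsto_compose[OF this t]
    show "(\<lambda>k. \<kappa> w * (m w * (g (z + \<tau> k *\<^sub>R (w - z)) - g z))) \<longlonglongrightarrow> \<kappa> w * (m w * (g w - g z))"
      by (intro tendsto_intros)
  qed
  moreover have "(LINT w:siegel|lborel. \<kappa> w * (m w * (g (z + \<tau> k *\<^sub>R (w - z)) - g z))) = 0" for k
    unfolding \<kappa>_def by (rule kernel_contraction[OF l z g m \<delta> \<tau>])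
  ultimately have "(LINT w:siegel|lborel. \<kappa> w * (m w * (g w - g z))) = 0"
    by (simp only: LIMSEQ_const_iff)
  hence "(LINT w:siegel|lborel. \<kappa> w * m w * g w - g z * (\<kappa> w * m w)) = 0"
    by (simp add: algebra_simps)
  hence "(LINT w:siegel|lborel. \<kappa> w * m w * g w) = g z * (LINT w:siegel|lborel. \<kappa> w * m w)"
    by (simp only: set_integral_diff(2)[OF i2 set_integrable_mult_right[OF i1]] set_integral_mult_right
        eq_iff_diff_eq_0[symmetric])
  thus ?thesis by (simp only: mult.assoc)
qed

text \<open>The pair \<open>G\<close>, \<open>kpow 9 z\<close> is fed to
  \<open>kernel_exchange\<close> in both orders. Either way the integral of the same product
  results, once as a multiple of the integral of \<open>G\<close> and once as a multiple of
  \<open>G z\<close>; dividing by \<open>kpow 9 z z\<close>, a power of \<open>rho z\<close>, leaves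
  a constant independent of \<open>G\<close>. With exponent 9 the auxiliary function has decay 8 in
  the class with boundary exponent \<open>- \<delta>\<close>, for every
  \<open>\<delta> \<le> 1\<close>.\<close>

lemma reproducing_up_to_constant:
  fixes z :: "(complex, 'n::{finite,linorder}) vec"
  assumes l: "l > -1" and z: "z \<in> siegel"
  shows "\<exists>C. \<forall>G \<delta>. holo_on G siegel \<and> growth (- \<delta>) (- 8) G \<and> 0 \<le> \<delta> \<and> \<delta> \<le> 1 \<and> l - 2 * \<delta> > -1 \<longrightarrow>
    (LINT w:siegel|lborel. of_real (rho w powr l) * cnj (kpow (real CARD('n) + 1 + l) z w) * G w) = C * G z"
proof -
  define \<kappa> where "\<kappa> = (\<lambda>w. of_real (rho w powr l) * cnj (kpow (real CARD('n) + 1 + l) z w))"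
  have nz: "kpow 9 z z \<noteq> 0" using siegelD(1)[OF z] by (simp add: kpow_def rho2_diag)
  have "(LINT w:siegel|lborel. \<kappa> w * G w) = (LINT w:siegel|lborel. \<kappa> w * kpow 9 z w) / kpow 9 z z * G z"
    if G: "holo_on G siegel" "growth (- \<delta>) (- 8) G" and \<delta>: "0 \<le> \<delta>" "\<delta> \<le> 1" "l - 2 * \<delta> > -1" for G \<delta>
  proof -
    note hk = holo_on_kpow[OF z]
    have k9: "growth 0 (- 9) (kpow 9 z)" using growth_kpow[OF z, of 9] by simp
    have k9': "growth (- \<delta>) 0 (kpow 9 z)" "growth (- \<delta>) (- 8) (kpow 9 z)"
      by (rule growth_weaken[OF k9]; use \<delta> in simp)+
    have G0: "growth (- \<delta>) 0 G" by (rule growth_weaken[OF G(2)]) auto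
    have 1: "(LINT w:siegel|lborel. \<kappa> w * (G w * kpow 9 z w)) = kpow 9 z z * (LINT w:siegel|lborel. \<kappa> w * G w)"
      unfolding \<kappa>_def by (rule kernel_exchange[OF l z hk k9'(1) G \<delta>(1,3)])
    have 2: "(LINT w:siegel|lborel. \<kappa> w * (kpow 9 z w * G w)) = G z * (LINT w:siegel|lborel. \<kappa> w * kpow 9 z w)"
      unfolding \<kappa>_def by (rule kernel_exchange[OF l z G(1) G0 hk k9'(2) \<delta>(1,3)])
    have "kpow 9 z z * (LINT w:siegel|lborel. \<kappa> w * G w) = G z * (LINT w:siegel|lborel. \<kappa> w * kpow 9 z w)"
      unfolding 1[symmetric] 2[symmetric] by (simp only: mult.commute[of "G _"])
    thus ?thesis using nz by (simp add: field_simps)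
  qed
  thus ?thesis unfolding \<kappa>_def by blast
qed

text \<open>Holomorphic on the half-space, bounded by 1 and tending to 1 pointwise, while each
  member of the sequence is of size \<open>1 / wt w\<close> at infinity. A power of it supplies any
  decay and is removed by dominated convergence. With \<open>Suc k\<close> the denominator dominates
  \<open>wt w\<close> already for \<open>k = 0\<close>.\<close>

definition damp :: "nat \<Rightarrow> complex ^ 'n::{finite,linorder} \<Rightarrow> complex" where
  "damp k w = \<i> * of_nat (Suc k) / (w $ top_idx + \<i> * of_nat (Suc k))"

lemma damp_denominator:
  fixes w :: "(complex, 'n::{finite,linorder}) vec"
  assumes "w \<in> siegel"
  shows "wt w \<le> cmod (w $ top_idx + \<i> * of_nat (Suc k))" "real (Suc k) \<le> cmod (w $ top_idx + \<i> * of_nat (Suc k))"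
    "w $ top_idx + \<i> * of_nat (Suc k) \<noteq> 0"
proof -
  note I = siegelD(7)[OF assms]
  show "wt w \<le> cmod (w $ top_idx + \<i> * of_nat (Suc k))"
    unfolding wt_def cmod_def by (rule real_sqrt_le_mono, rule add_mono) (use I in \<open>auto intro!: power_mono\<close>)
  have "real (Suc k) \<le> Im (w $ top_idx + \<i> * of_nat (Suc k))" using I by simp
  also have "\<dots> \<le> cmod (w $ top_idx + \<i> * of_nat (Suc k))"
    using abs_Im_le_cmod[of "w $ top_idx + \<i> * of_nat (Suc k)"] by linarith
  finally show 1: "real (Suc k) \<le> cmod (w $ top_idx + \<i> * of_nat (Suc k))" .
  show "w $ top_idx + \<i> * of_nat (Suc k) \<noteq> 0"
  proof
    assume "w $ top_idx + \<i> * of_nat (Suc k) = 0"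
    with 1 have "real (Suc k) \<le> 0" by (simp only: norm_zero)
    thus False by simp
  qed
qed

lemma cmod_damp_le:
  fixes w :: "(complex, 'n::{finite,linorder}) vec"
  assumes "w \<in> siegel"
  shows "cmod (damp k w) \<le> 1" "cmod (damp k w) \<le> real (Suc k) / wt w"
proof -
  note d = damp_denominator[OF assms, of k]
  have e: "cmod (damp k w) = real (Suc k) / cmod (w $ top_idx + \<i> * of_nat (Suc k))"
    unfolding damp_def norm_divide norm_mult norm_of_nat by simp
  show "cmod (damp k w) \<le> 1" unfolding e using d by (subst divide_le_eq_1_pos) auto
  show "cmod (damp k w) \<le> real (Suc k) / wt w"
    unfolding e using d siegelD(4)[OF assms] by (intro divide_left_mono) auto
qed

lemma damp_deriv:
  fixes w :: "(complex, 'n::{finite,linorder}) vec"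
  assumes "w \<in> siegel"
  shows "((\<lambda>x. \<i> * of_nat (Suc k) / (x + \<i> * of_nat (Suc k))) has_field_derivative
    - (\<i> * of_nat (Suc k)) / (w $ top_idx + \<i> * of_nat (Suc k))\<^sup>2) (at (w $ top_idx))"
  using damp_denominator(3)[OF assms, of k]
  by (auto intro!: derivative_eq_intros simp: power2_eq_square simp del: of_nat_Suc)

lemma holo_on_damp: "holo_on (damp k) (siegel :: (complex, 'n::{finite,linorder}) vec set)"
  unfolding damp_def[abs_def]
  by (rule holo_on_compose[OF holo_on_coord, where \<phi>'="\<lambda>x. - (\<i> * of_nat (Suc k)) / (x + \<i> * of_nat (Suc k))\<^sup>2"])
    (rule damp_deriv)

lemma pd_damp:
  fixes w :: "(complex, 'n::{finite,linorder}) vec"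
  assumes "w \<in> siegel"
  shows "pd top_idx (damp k) w = - damp k w / (w $ top_idx + \<i> * of_nat (Suc k))"
  using pd_compose[OF holo_on_coord assms damp_deriv[OF assms], of top_idx k]
  by (simp add: damp_def[abs_def] pd_coord power2_eq_square del: of_nat_Suc)

lemma growth_damp_power: "growth 0 (- real m) (\<lambda>w::(complex, 'n::{finite,linorder}) vec. damp k w ^ m)"
proof (rule growthI)
  fix w :: "(complex, 'n) vec" assume w: "w \<in> siegel"
  note s = siegelD(1,4)[OF w]
  have "cmod (damp k w ^ m) \<le> (real (Suc k) / wt w) ^ m"
    unfolding norm_power by (intro power_mono cmod_damp_le w) auto
  also have "\<dots> = real (Suc k) ^ m * wt w powr - real m"
    using s by (simp add: power_divide powr_minus_divide powr_realpow del: of_nat_Suc)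
  finally show "cmod (damp k w ^ m) \<le> real (Suc k) ^ m * (rho w powr 0 * wt w powr - real m)"
    using s by simp
qed

lemma damp_tendsto: "(\<lambda>k. damp k w) \<longlonglongrightarrow> 1"
proof -
  have "(\<lambda>k. w $ top_idx / of_nat (Suc k)) \<longlonglongrightarrow> 0"
    using tendsto_mult[OF tendsto_const[of "w $ top_idx"] LIMSEQ_Suc[OF lim_1_over_n[where 'a=complex]]] by simp
  hence "(\<lambda>k. \<i> / (w $ top_idx / of_nat (Suc k) + \<i>)) \<longlonglongrightarrow> \<i> / (0 + \<i>)"
    by (intro tendsto_intros) auto
  moreover have "\<i> / (w $ top_idx / of_nat (Suc k) + \<i>) = damp k w" for k
  proof -
    have "complex_of_nat (Suc k) \<noteq> 0" by (rule of_nat_neq_0)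
    thus ?thesis by (simp add: damp_def field_simps del: of_nat_Suc)
  qed
  ultimately show ?thesis by simp
qed

lemma damped_integral_limit:
  fixes g :: "(complex, 'n::{finite,linorder}) vec \<Rightarrow> complex"
  assumes "continuous_on siegel g" "set_integrable lborel siegel g"
  shows "(\<lambda>k. LINT w:siegel|lborel. g w * damp k w ^ m) \<longlonglongrightarrow> (LINT w:siegel|lborel. g w)"
proof (rule siegel_dominated_convergence(2))
  show "set_integrable lborel siegel (\<lambda>w. cmod (g w))" using set_integrable_norm[OF assms(2)] by simp
  fix k and w :: "(complex, 'n) vec" assume w: "w \<in> siegel"
  have "cmod (damp k w) ^ m \<le> 1" by (intro power_le_one cmod_damp_le w) auto
  thus "cmod (g w * damp k w ^ m) \<le> cmod (g w)"
    by (simp add: norm_mult norm_power mult_left_le)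
  have "(\<lambda>k. g w * damp k w ^ m) \<longlonglongrightarrow> g w * 1 ^ m" by (intro tendsto_intros damp_tendsto)
  thus "(\<lambda>k. g w * damp k w ^ m) \<longlonglongrightarrow> g w" by simp
qed (intro continuous_intros assms holo_continuous_on[OF holo_on_damp] | rule assms)+

text \<open>At \<open>base_pt\<close> the squared modulus of the kernel is
  \<open>(wt w / 2) powr (- (2 * s))\<close> with \<open>s = n + 1 + l\<close>; this accounts for
  the doubled exponent and the power of 2. Legendre's duplication formula at \<open>s - 1/2\<close>
  removes the Gamma factors that do not occur in \<open>c_const\<close>.\<close>

lemma siegel_moment_normalization:
  assumes "l > -1" "n \<ge> 1"
  shows "2 powr (2 * (real n + 1 + l)) * siegel_moment n l (2 * (real n + 1 + l)) = 1 / c_const n l"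
proof -
  define s where "s = real n + 1 + l"
  have s: "s > 1" using assms by (simp add: s_def)
  have G: "Gamma s > 0" "Gamma (2 * s - 1) > 0" "Gamma (1 + l) > 0" "Gamma (s - 1/2) > 0"
    using s assms by (auto intro!: Gamma_real_pos)
  have nn: "complex_of_real x \<notin> \<int>\<^sub>\<le>\<^sub>0" if "x > 0" for x
    using that by (auto elim!: nonpos_Ints_cases simp: complex_eq_iff)
  have "Gamma (complex_of_real (s - 1/2)) * Gamma (complex_of_real (s - 1/2) + 1/2) =
     exp ((1 - 2 * complex_of_real (s - 1/2)) * of_real (ln 2)) * of_real (sqrt pi) * Gamma (2 * complex_of_real (s - 1/2))"
  proof (rule Gamma_legendre_duplication)
    show "complex_of_real (s - 1/2) \<notin> \<int>\<^sub>\<le>\<^sub>0" by (rule nn) (use s in simp)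
    have "complex_of_real (s - 1/2) + 1/2 = complex_of_real s" by simp
    thus "complex_of_real (s - 1/2) + 1/2 \<notin> \<int>\<^sub>\<le>\<^sub>0" using nn[of s] s by simp
  qed
  also have "complex_of_real (s - 1/2) + 1/2 = complex_of_real s" by simp
  also have "2 * complex_of_real (s - 1/2) = complex_of_real (2 * s - 1)" by simp
  also have "(1 - complex_of_real (2 * s - 1)) * of_real (ln 2) = complex_of_real ((2 - 2 * s) * ln 2)" by simp
  finally have "complex_of_real (Gamma (s - 1/2) * Gamma s) = complex_of_real (exp ((2 - 2 * s) * ln 2) * sqrt pi * Gamma (2 * s - 1))"
    by (simp only: Gamma_complex_of_real of_real_mult flip: exp_of_real)
  hence "Gamma (s - 1/2) * Gamma s = exp ((2 - 2 * s) * ln 2) * sqrt pi * Gamma (2 * s - 1)"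
    by (simp only: of_real_eq_iff)
  also have "exp ((2 - 2 * s) * ln 2) = 2 powr (2 - 2 * s)" by (simp add: powr_def)
  finally have dup: "Gamma (s - 1/2) = 2 powr (2 - 2 * s) * sqrt pi * Gamma (2 * s - 1) / Gamma s"
    using G by (simp add: field_simps)
  have "2 powr (2 * s) * siegel_moment n l (2 * s) =
     2 powr (2 * s) * (sqrt pi * Gamma (s - 1/2) / Gamma s * Gamma (1 + l) / Gamma (2 * s - 1) * pi ^ (n - 1) * Gamma s)"
  proof -
    have "(2 * s - 1) / 2 = s - 1/2" "2 * s / 2 = s" "2 * s - 1 - l - n = s" "l + 1 = 1 + l" by (simp_all add: s_def field_simps)
    thus ?thesis unfolding siegel_moment_def by (simp only:)
  qed
  also have "\<dots> = (2 powr (2 * s) * 2 powr (2 - 2 * s)) * (sqrt pi * sqrt pi * pi ^ (n - 1)) * Gamma (1 + l) / Gamma s"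
    unfolding dup using G by (simp add: field_simps)
  also have "2 powr (2 * s) * 2 powr (2 - 2 * s) = 4" by (simp add: powr_add[symmetric])
  also have "sqrt pi * sqrt pi * pi ^ (n - 1) = pi ^ n"
    using assms(2) by (cases n) auto
  also have "4 * pi ^ n * Gamma (1 + l) / Gamma s = 1 / c_const n l"
    by (simp add: c_const_def s_def)
  finally show ?thesis by (simp add: s_def)
qed

lemma rho2_base_pt: "cmod (rho2 w base_pt) = wt w / 2"
proof -
  have "(\<Sum>j\<in>{..<top_idx}. w $ j * cnj (base_pt $ j)) = 0"
    by (intro sum.neutral) (auto simp: base_pt_def axis_def)
  hence "rho2 w base_pt = \<i> / 2 * (- (\<i> + w $ top_idx))"
    by (simp add: rho2_def base_pt_def axis_def)
  hence "cmod (rho2 w base_pt) = cmod (\<i> / 2) * cmod (\<i> + w $ top_idx)"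
    by (simp only: norm_mult norm_minus_cancel)
  thus ?thesis by (simp add: wt_def add.commute norm_divide)
qed

lemma weighted_reproducing:
  fixes z :: "(complex, 'n::{finite,linorder}) vec"
  assumes l: "l > -1" and z: "z \<in> siegel"
    and G: "holo_on G siegel" "growth (- \<delta>) (- 8) G" and \<delta>: "0 \<le> \<delta>" "\<delta> \<le> 1" "l - 2 * \<delta> > -1"
  shows "(LINT w:siegel|lborel. of_real (rho w powr l) * cnj (kpow (real CARD('n) + 1 + l) z w) * G w)
    = G z / of_real (c_const CARD('n) l)"
proof -
  define s where "s = real CARD('n) + 1 + l"
  have n1: "real CARD('n) \<ge> 1" by (simp add: Suc_leI)
  have s0: "s > 0" using l n1 unfolding s_def by linarith
  define \<kappa> where "\<kappa> = (\<lambda>z w::(complex, 'n) vec. of_real (rho w powr l) * cnj (kpow s z w))"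
  have "\<forall>z\<in>siegel. \<exists>C. \<forall>G \<delta>. holo_on G siegel \<and> growth (- \<delta>) (- 8) G \<and> 0 \<le> \<delta> \<and> \<delta> \<le> 1 \<and> l - 2 * \<delta> > -1 \<longrightarrow>
      (LINT w:siegel|lborel. \<kappa> z w * G w) = C * G z"
    unfolding \<kappa>_def s_def by (intro ballI reproducing_up_to_constant l)
  from bchoice[OF this] obtain C where C0: "\<forall>z\<in>siegel. \<forall>G \<delta>. holo_on G siegel \<and> growth (- \<delta>) (- 8) G \<and> 0 \<le> \<delta> \<and> \<delta> \<le> 1 \<and> l - 2 * \<delta> > -1 \<longrightarrow>
      (LINT w:siegel|lborel. \<kappa> z w * G w) = C z * G z"
    by (elim exE)
  have C: "(LINT w:siegel|lborel. \<kappa> z w * G w) = C z * G z"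
    if "z \<in> siegel" "holo_on G siegel" "growth (- \<delta>) (- 8) G" "0 \<le> \<delta>" "\<delta> \<le> 1" "l - 2 * \<delta> > -1" for z G \<delta>
    using C0[rule_format, OF that(1), of G \<delta>] that by blast
  \<comment> \<open>A kernel with pole \<open>a\<close> need not decay by order 8, so it is damped
    first. The product of two kernels with the weight is integrable, which permits the
    limit.\<close>
  have kk: "(LINT w:siegel|lborel. \<kappa> z w * kpow s a w) = C z * kpow s a z" if z: "z \<in> siegel" and a: "a \<in> siegel" for z a
  proof -
    note hk = holo_on_kpow[OF a, of s]
    have c: "continuous_on siegel (\<lambda>w. \<kappa> z w * kpow s a w)"
      unfolding \<kappa>_def by (intro continuous_intros holo_continuous_on[OF hk] holo_continuous_on[OF holo_on_kpow[OF z]] continuous_on_rho_powr)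
    have i: "set_integrable lborel siegel (\<lambda>w. \<kappa> z w * kpow s a w)"
    proof (rule set_integrable_growth[OF c])
      show "growth (l + 0 + 0) (0 + - s + - s) (\<lambda>w. \<kappa> z w * kpow s a w)"
        unfolding \<kappa>_def by (intro growth_mult growth_rho growth_cnj growth_kpow z a) (use s0 in auto)
    qed (use l s0 in \<open>auto simp: s_def\<close>)
    have L1: "(\<lambda>k. LINT w:siegel|lborel. \<kappa> z w * kpow s a w * damp k w ^ 8) \<longlonglongrightarrow> (LINT w:siegel|lborel. \<kappa> z w * kpow s a w)"
      by (rule damped_integral_limit[OF c i])
    have E: "(LINT w:siegel|lborel. \<kappa> z w * kpow s a w * damp k w ^ 8) = C z * (kpow s a z * damp k z ^ 8)" for k
    proof -
      have g: "growth (0 + 0) (- s + - real 8) (\<lambda>w. kpow s a w * damp k w ^ 8)"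
        by (intro growth_mult growth_kpow a growth_damp_power) (use s0 in auto)
      have "growth (- 0) (- 8) (\<lambda>w. kpow s a w * damp k w ^ 8)"
        by (rule growth_weaken[OF g]) (use s0 in auto)
      from C[OF z holo_on_mult[OF hk holo_on_power[OF holo_on_damp]] this] l show ?thesis
        by (simp add: mult.assoc)
    qed
    have L2: "(\<lambda>k. C z * (kpow s a z * damp k z ^ 8)) \<longlonglongrightarrow> C z * (kpow s a z * 1 ^ 8)"
      by (intro tendsto_intros damp_tendsto)
    show ?thesis using LIMSEQ_unique[OF L1[unfolded E] L2] by simp
  qed
  \<comment> \<open>Conjugating the pairing of two kernels swaps their poles. Comparing both
    evaluations and dividing by a nonzero value of \<open>kpow\<close> relates arbitrary pairs of
    points, so knowing \<open>C\<close> at one point is enough.\<close>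
  have sym: "cnj (C z) = C a" if z: "z \<in> siegel" and a: "a \<in> siegel" for z a
  proof -
    have "cnj (C z) * kpow s z a = cnj (C z * kpow s a z)" using cnj_kpow(2)[OF a z, of s] by simp
    also have "\<dots> = cnj (LINT w:siegel|lborel. \<kappa> z w * kpow s a w)" by (simp only: kk[OF z a])
    also have "\<dots> = (LINT w:siegel|lborel. cnj (\<kappa> z w * kpow s a w))"
      unfolding set_lebesgue_integral_def by (subst Bochner_Integration.integral_cnj[symmetric]) simp
    also have "\<dots> = (LINT w:siegel|lborel. \<kappa> a w * kpow s z w)" by (simp add: \<kappa>_def mult_ac)
    also have "\<dots> = C a * kpow s z a" by (rule kk[OF a z])
    finally show ?thesis
      using rho2_nonzero(1)[OF a z] by (simp add: kpow_def)
  qed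
  have Cb: "C base_pt = of_real (1 / c_const CARD('n) l)"
  proof -
    let ?b = "base_pt :: (complex, 'n) vec"
    have "rho ?b = 1"
      by (simp add: rho_eq) (auto simp: base_pt_def axis_def sqsum_def intro!: sum.neutral)
    hence "C ?b = C ?b * kpow s ?b ?b" by (simp add: kpow_def rho2_diag)
    also have "\<dots> = (LINT w:siegel|lborel. \<kappa> ?b w * kpow s ?b w)" by (rule kk[symmetric]) (rule base_pt_siegel)+
    also have "\<dots> = (LINT w:siegel|lborel. complex_of_real (2 powr (2 * s) * (rho w powr l * wt (w::(complex, 'n) vec) powr - (2 * s))))"
    proof (rule set_lebesgue_integral_cong, simp, intro allI impI)
      fix w :: "(complex, 'n) vec" assume w: "w \<in> siegel"
      note sw = siegelD(4)[OF w]
      have "cmod (kpow s ?b w) = (wt w / 2) powr - s"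
      proof -
        have e: "cmod (rho2 ?b w) = wt w / 2"
          by (subst rho2_cnj[symmetric]) (simp only: complex_mod_cnj rho2_base_pt)
        show ?thesis by (simp only: cmod_kpow[OF base_pt_siegel w] e)
      qed
      hence "(cmod (kpow s ?b w))\<^sup>2 = (wt w / 2) powr - s * (wt w / 2) powr - s" by (simp add: power2_eq_square)
      also have "\<dots> = (wt w / 2) powr (- (2 * s))" by (simp add: powr_add[symmetric])
      also have "\<dots> = 2 powr (2 * s) * wt w powr - (2 * s)"
        using sw by (simp add: powr_divide powr_minus_divide)
      finally have e: "(cmod (kpow s ?b w))\<^sup>2 = 2 powr (2 * s) * wt w powr - (2 * s)" .
      have "cnj (kpow s ?b w) * kpow s ?b w = of_real ((cmod (kpow s ?b w))\<^sup>2)"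
        by (simp only: complex_norm_square mult.commute)
      hence "cnj (kpow s ?b w) * kpow s ?b w = of_real (2 powr (2 * s) * wt w powr - (2 * s))"
        unfolding e .
      thus "\<kappa> ?b w * kpow s ?b w = complex_of_real (2 powr (2 * s) * (rho w powr l * wt w powr - (2 * s)))"
        by (simp add: \<kappa>_def mult_ac)
    qed
    also have "\<dots> = complex_of_real (LINT w:siegel|lborel. 2 powr (2 * s) * (rho w powr l * wt (w::(complex, 'n) vec) powr - (2 * s)))"
      by (rule set_integral_complex_of_real)
    also have "(LINT w:siegel|lborel. 2 powr (2 * s) * (rho w powr l * wt (w::(complex, 'n) vec) powr - (2 * s)))
      = 2 powr (2 * s) * (LINT w:siegel|lborel. rho w powr l * wt (w::(complex, 'n) vec) powr - (2 * s))"
      by (rule set_integral_mult_right)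
    also have "(LINT w:siegel|lborel. rho w powr l * wt (w::(complex, 'n) vec) powr - (2 * s)) = siegel_moment CARD('n) l (2 * s)"
    proof -
      have m0: "siegel_moment CARD('n) l (2 * s) \<ge> 0"
      proof -
        have s1: "s > 1" using l n1 unfolding s_def by linarith
        have "(2 * s - 1) / 2 > 0" "2 * s / 2 > 0" "l + 1 > 0" "2 * s - 1 > 0" "2 * s - 1 - l - CARD('n) > 0"
          using s1 l by (auto simp: s_def)
        thus ?thesis unfolding siegel_moment_def
          by (intro mult_nonneg_nonneg divide_nonneg_nonneg less_imp_le[OF Gamma_real_pos]) auto
      qed
      have "(LINT w|lborel. indicator siegel w *\<^sub>R (rho w powr l * wt (w::(complex, 'n) vec) powr - (2 * s)))
        = enn2real (\<integral>\<^sup>+w. ennreal (indicator siegel w * (rho w powr l * wt (w::(complex, 'n) vec) powr - (2 * s))) \<partial>lborel)"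
        by (subst integral_eq_nn_integral) auto
      also have "\<dots> = siegel_moment CARD('n) l (2 * s)"
        using m0 nn_integral_siegel_moment[of l "2 * s", where 'n='n] l s0 by (simp add: s_def)
      finally show ?thesis by (simp add: set_lebesgue_integral_def)
    qed
    also have "2 powr (2 * s) * siegel_moment CARD('n) l (2 * s) = 1 / c_const CARD('n) l"
      unfolding s_def by (rule siegel_moment_normalization[OF l]) (simp add: Suc_leI)
    finally show ?thesis .
  qed
  have "C z = of_real (1 / c_const CARD('n) l)"
    using sym[OF base_pt_siegel z] unfolding Cb by simp
  thus ?thesis using C[OF z G \<delta>] by (simp add: \<kappa>_def s_def)
qed

section \<open>Bloch functions\<close>

text \<open>\<open>grad_norm\<close> is the root of a sum of nonnegative terms, so each vector field
  is bounded by itself. That the tangential ones lose only half a power of \<open>rho\<close> will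
  match the size \<open>sqrt (wt w)\<close> of the tangential coordinates.\<close>

lemma bloch0_bounds:
  fixes f :: "(complex, 'n::{finite,linorder}) vec \<Rightarrow> complex"
  assumes "f \<in> bloch0"
  obtains M where "M \<ge> 0" "\<And>w. w \<in> siegel \<Longrightarrow> cmod (pd top_idx f w) \<le> M / rho w"
    "\<And>w j. w \<in> siegel \<Longrightarrow> j < top_idx \<Longrightarrow> cmod (Lop j f w) \<le> M / sqrt (rho w)"
proof -
  have fin: "bloch_norm f < \<infinity>" using assms by (simp add: bloch0_def)
  define M where "M = enn2real (bloch_norm f)"
  have M0: "M \<ge> 0" by (simp add: M_def)
  have gr: "grad_norm f w \<le> M" if "w \<in> siegel" for w
  proof -
    have "ennreal (grad_norm f w) \<le> bloch_norm f" unfolding bloch_norm_def by (rule SUP_upper[OF that])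
    also have "\<dots> = ennreal M" using fin by (simp add: M_def)
    finally show ?thesis using M0 by simp
  qed
  have sq: "2 * rho w * (\<Sum>j\<in>{..<top_idx}. (cmod (Lop j f w))\<^sup>2) + 8 * (rho w)\<^sup>2 * (cmod (Lop top_idx f w))\<^sup>2 \<le> M\<^sup>2"
    if w: "w \<in> siegel" for w
  proof -
    have "0 \<le> 2 * rho w * (\<Sum>j\<in>{..<top_idx}. (cmod (Lop j f w))\<^sup>2) + 8 * (rho w)\<^sup>2 * (cmod (Lop top_idx f w))\<^sup>2"
      using siegelD(1)[OF w] by (intro add_nonneg_nonneg mult_nonneg_nonneg sum_nonneg) auto
    thus ?thesis using gr[OF w] M0 unfolding grad_norm_def by (simp add: real_sqrt_le_iff sqrt_le_D)
  qed
  show ?thesis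
  proof (rule that[OF M0])
    fix w :: "(complex, 'n) vec" assume w: "w \<in> siegel"
    note r = siegelD(1)[OF w]
    have "(\<Sum>j\<in>{..<top_idx}. (cmod (Lop j f w))\<^sup>2) \<ge> 0" by (intro sum_nonneg) auto
    hence "8 * (rho w)\<^sup>2 * (cmod (Lop top_idx f w))\<^sup>2 \<le> M\<^sup>2"
      using sq[OF w] r mult_nonneg_nonneg[of "2 * rho w" "\<Sum>j\<in>{..<top_idx}. (cmod (Lop j f w))\<^sup>2"] by linarith
    hence "8 * (rho w * cmod (pd top_idx f w))\<^sup>2 \<le> M\<^sup>2"
      by (simp add: Lop_def power_mult_distrib mult.assoc)
    hence "(rho w * cmod (pd top_idx f w))\<^sup>2 \<le> M\<^sup>2"
      using zero_le_power2[of "rho w * cmod (pd top_idx f w)"] by linarith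
    hence "rho w * cmod (pd top_idx f w) \<le> M" by (rule power2_le_imp_le[OF _ M0])
    thus "cmod (pd top_idx f w) \<le> M / rho w" using r by (simp add: field_simps)
  next
    fix w :: "(complex, 'n) vec" and j :: 'n assume w: "w \<in> siegel" and j: "j < top_idx"
    note r = siegelD(1)[OF w]
    have "(cmod (Lop j f w))\<^sup>2 \<le> (\<Sum>j\<in>{..<top_idx}. (cmod (Lop j f w))\<^sup>2)"
      using j by (intro member_le_sum) auto
    hence "rho w * (cmod (Lop j f w))\<^sup>2 \<le> rho w * (\<Sum>j\<in>{..<top_idx}. (cmod (Lop j f w))\<^sup>2)"
      using r by (intro mult_left_mono) auto
    moreover have "rho w * (\<Sum>j\<in>{..<top_idx}. (cmod (Lop j f w))\<^sup>2) \<ge> 0"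
      using r by (intro mult_nonneg_nonneg sum_nonneg) auto
    moreover have "8 * (rho w)\<^sup>2 * (cmod (Lop top_idx f w))\<^sup>2 \<ge> 0" by simp
    ultimately have "rho w * (cmod (Lop j f w))\<^sup>2 \<le> M\<^sup>2" using sq[OF w] by linarith
    hence "(sqrt (rho w) * cmod (Lop j f w))\<^sup>2 \<le> M\<^sup>2" using r by (simp add: power_mult_distrib)
    hence "sqrt (rho w) * cmod (Lop j f w) \<le> M" by (rule power2_le_imp_le[OF _ M0])
    thus "cmod (Lop j f w) \<le> M / sqrt (rho w)" using r by (simp add: field_simps)
  qed
qed

text \<open>Going up from \<open>w\<close> the height grows linearly, and the bound
  \<open>M / rho\<close> integrates to a logarithm.\<close>

lemma vertical_variation:
  fixes f :: "(complex, 'n::{finite,linorder}) vec \<Rightarrow> complex"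
  assumes f: "holo_on f siegel" and M: "M \<ge> 0" "\<And>w. w \<in> siegel \<Longrightarrow> cmod (pd top_idx f w) \<le> M / rho w"
    and w: "w \<in> siegel" and T: "T > 0"
  shows "cmod (f (w + axis top_idx (\<i> * of_real T)) - f w) \<le> M * ln ((rho w + T) / rho w)"
proof -
  let ?w = "w + axis top_idx (\<i> * of_real T)"
  note r = siegelD(1)[OF w]
  have wT: "?w \<in> siegel" using r T by (simp add: siegel_def rho_axis)
  have h1: "((\<lambda>t. \<Sum>j\<in>UNIV. (?w $ j - w $ j) * pd j f (w + t *\<^sub>R (?w - w))) has_integral (f (w + 1 *\<^sub>R (?w - w)) - f w)) {0..1}"
    by (rule segment_has_integral[OF f w wT]) auto
  have d: "((\<lambda>t. M * ln (rho w + t * T)) has_vector_derivative M * T / (rho w + t * T)) (at t within {0..1})"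
    if "t \<in> {0..1}" for t
  proof -
    have "rho w + t * T > 0" using that r T by (simp add: add_pos_nonneg)
    thus ?thesis
      unfolding has_real_derivative_iff_has_vector_derivative[symmetric]
      by (auto intro!: derivative_eq_intros)
  qed
  have h2: "((\<lambda>t. M * T / (rho w + t * T)) has_integral (M * ln (rho w + 1 * T) - M * ln (rho w + 0 * T))) {0..1}"
    by (rule fundamental_theorem_of_calculus[OF _ d]) auto
  have le: "cmod (\<Sum>j\<in>UNIV. (?w $ j - w $ j) * pd j f (w + t *\<^sub>R (?w - w))) \<le> M * T / (rho w + t * T)"
    if t: "t \<in> {0..1}" for t
  proof -
    have e: "w + t *\<^sub>R (?w - w) = w + axis top_idx (\<i> * of_real (t * T))"
      by (simp add: scaleR_axis mult_ac)
    have pos: "rho w + t * T > 0" using t r T by (simp add: add_pos_nonneg)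
    have S: "w + axis top_idx (\<i> * of_real (t * T)) \<in> siegel" "rho (w + axis top_idx (\<i> * of_real (t * T))) = rho w + t * T"
      using pos by (simp_all add: siegel_def rho_axis)
    have "(\<Sum>j\<in>UNIV. (?w $ j - w $ j) * pd j f (w + t *\<^sub>R (?w - w))) = \<i> * of_real T * pd top_idx f (w + axis top_idx (\<i> * of_real (t * T)))"
      unfolding e by (simp add: axis_def if_distrib[where f="\<lambda>x. x * _"] cong: if_cong)
    also have "cmod \<dots> = T * cmod (pd top_idx f (w + axis top_idx (\<i> * of_real (t * T))))"
      using T by (simp add: norm_mult)
    also have "\<dots> \<le> T * (M / (rho w + t * T))"
      using M(2)[OF S(1)] T unfolding S(2) by (intro mult_left_mono) auto
    finally show ?thesis by (simp add: mult.commute)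
  qed
  have "norm (integral {0..1} (\<lambda>t. \<Sum>j\<in>UNIV. (?w $ j - w $ j) * pd j f (w + t *\<^sub>R (?w - w)))) \<le> integral {0..1} (\<lambda>t. M * T / (rho w + t * T))"
    by (rule Henstock_Kurzweil_Integration.integral_norm_bound_integral)
      (use h1 h2 le in \<open>auto simp: has_integral_iff\<close>)
  hence "cmod (f ?w - f w) \<le> M * ln (rho w + T) - M * ln (rho w)"
    using integral_unique[OF h1] integral_unique[OF h2] by simp
  also have "\<dots> = M * ln ((rho w + T) / rho w)"
    using r T by (simp add: ln_div algebra_simps)
  finally show ?thesis .
qed

text \<open>Lifted by \<open>T = wt w\<close>, both points and the segment between them have height
  at least \<open>T\<close>. The top coordinate changes by at most \<open>T\<close> against a
  derivative of size \<open>M / T\<close>, a tangential one by at most \<open>sqrt T\<close> against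
  \<open>M / sqrt T\<close>. Expressing \<open>pd j\<close> through \<open>Lop j\<close> adds a term
  of size \<open>2 * T * (M / T)\<close>, so every coordinate contributes at most
  \<open>3 * M\<close>.\<close>

lemma horizontal_variation:
  fixes f :: "(complex, 'n::{finite,linorder}) vec \<Rightarrow> complex"
  assumes f: "holo_on f siegel" and M: "M \<ge> 0" "\<And>w. w \<in> siegel \<Longrightarrow> cmod (pd top_idx f w) \<le> M / rho w"
    "\<And>w j. w \<in> siegel \<Longrightarrow> j < top_idx \<Longrightarrow> cmod (Lop j f w) \<le> M / sqrt (rho w)"
    and w: "w \<in> siegel"
  defines "v \<equiv> axis top_idx (\<i> * of_real (wt w))"
  shows "cmod (f (w + v) - f (base_pt + v)) \<le> 3 * M * real CARD('n)"
proof -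
  define T where "T = wt w"
  note sw = siegelD[OF w]
  have T: "T \<ge> 1" using sw by (simp add: T_def)
  have b: "(base_pt :: (complex, 'n) vec) \<in> siegel" by (rule base_pt_siegel)
  have W: "w + v \<in> siegel" "T \<le> rho (w + v)"
    using siegelD(1)[OF w] T by (simp_all add: siegel_def rho_axis v_def T_def)
  have B: "base_pt + v \<in> siegel" "T \<le> rho (base_pt + v)"
    using siegelD(1)[OF b] T by (simp_all add: siegel_def rho_axis v_def T_def)
  let ?B = "base_pt + v" and ?W = "w + v"
  have h: "((\<lambda>t. \<Sum>j\<in>UNIV. (?W $ j - ?B $ j) * pd j f (?B + t *\<^sub>R (?W - ?B))) has_integral (f (?B + 1 *\<^sub>R (?W - ?B)) - f ?B)) {0..1}"
    by (rule segment_has_integral[OF f B(1) W(1)]) auto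
  have bk: "base_pt $ j = (if j = top_idx then \<i> else 0)" for j :: 'n
    by (simp add: base_pt_def axis_def)
  have le: "cmod (\<Sum>j\<in>UNIV. (?W $ j - ?B $ j) * pd j f (?B + t *\<^sub>R (?W - ?B))) \<le> 3 * M * real CARD('n)"
    if t: "t \<in> {0..1}" for t
  proof -
    let ?p = "?B + t *\<^sub>R (?W - ?B)"
    have t01: "0 \<le> t" "t \<le> 1" using t by auto
    have p: "?p \<in> siegel" by (rule segment_siegel(2)[OF B(1) W(1) t01])
    have rT: "T \<le> rho ?p" using rho_segment_min[OF B(1) W(1) t01] B(2) W(2) by linarith
    have pdT: "cmod (pd top_idx f ?p) \<le> M / T"
      using M(2)[OF p] rT T M(1) by (smt (verit) divide_left_mono mult_pos_pos)
    have "cmod ((?W $ j - ?B $ j) * pd j f ?p) \<le> 3 * M" for j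
    proof (cases "j = top_idx")
      case True
      have "cmod (w $ top_idx - \<i>) \<le> T"
        unfolding T_def wt_def cmod_def using sw(7)
        by (intro real_sqrt_le_mono add_mono) (auto simp: power2_eq_square algebra_simps)
      hence "cmod ((?W $ j - ?B $ j) * pd j f ?p) \<le> T * (M / T)"
        unfolding True norm_mult using pdT T by (intro mult_mono) (auto simp: bk)
      thus ?thesis using T M(1) by simp
    next
      case False
      hence j: "j < top_idx" using below_top by blast
      have wj: "(cmod (w $ j))\<^sup>2 \<le> T" using sw(6)[OF j] by (simp add: T_def)
      hence wj': "cmod (w $ j) \<le> sqrt T" by (rule real_le_rsqrt)
      have pj: "?p $ j = t *\<^sub>R (w $ j)" using False by (simp add: v_def axis_def bk)
      have "cmod (Lop j f ?p) \<le> M / sqrt (rho ?p)" by (rule M(3)[OF p j])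
      also have "\<dots> \<le> M / sqrt T" using rT T M(1) by (intro divide_left_mono) auto
      finally have L: "cmod (Lop j f ?p) \<le> M / sqrt T" .
      have alg: "x * pd j f P = x * Lop j f P - 2 * \<i> * (x * cnj (P $ j)) * pd top_idx f P" for x P
        using False by (simp add: Lop_def algebra_simps)
      have WB: "?W $ j - ?B $ j = w $ j" using False by (simp add: bk)
      have "(?W $ j - ?B $ j) * pd j f ?p = w $ j * Lop j f ?p - 2 * \<i> * (w $ j * cnj (?p $ j)) * pd top_idx f ?p"
        unfolding WB by (rule alg)
      also have "cmod \<dots> \<le> cmod (w $ j * Lop j f ?p) + cmod (2 * \<i> * (w $ j * cnj (?p $ j)) * pd top_idx f ?p)"
        by (rule norm_triangle_ineq4)
      also have "cmod (w $ j * Lop j f ?p) \<le> sqrt T * (M / sqrt T)"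
        unfolding norm_mult using wj' L T by (intro mult_mono) auto
      also have "sqrt T * (M / sqrt T) = M" using T by simp
      also have "cmod (2 * \<i> * (w $ j * cnj (?p $ j)) * pd top_idx f ?p) \<le> 2 * T * (M / T)"
      proof -
        have "cmod (w $ j * cnj (?p $ j)) = t * (cmod (w $ j))\<^sup>2"
          unfolding pj using t01 by (simp add: norm_mult power2_eq_square)
        also have "\<dots> \<le> 1 * T" using t01 wj by (intro mult_mono) auto
        finally have "cmod (2 * \<i> * (w $ j * cnj (?p $ j))) \<le> 2 * T" by (simp only: norm_mult) simp
        thus ?thesis unfolding norm_mult[of "2 * \<i> * (w $ j * cnj (?p $ j))"] using pdT T by (intro mult_mono) auto
      qed
      also have "2 * T * (M / T) = 2 * M" using T by simp
      finally show ?thesis by simp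
    qed
    hence "cmod (\<Sum>j\<in>UNIV. (?W $ j - ?B $ j) * pd j f ?p) \<le> (\<Sum>j\<in>(UNIV :: 'n set). 3 * M)"
      by (intro sum_norm_le)
    thus ?thesis by (simp add: mult.commute)
  qed
  show ?thesis
    using has_integral_bound_real[OF _ finite.emptyI h, of "3 * M * real CARD('n)"] le M(1) by (simp add: add.commute)
qed

text \<open>The path climbs from \<open>w\<close> by \<open>T = wt w\<close>, crosses over, and
  descends to \<open>base_pt\<close>, where \<open>f\<close> vanishes. The vertical pieces give
  logarithms of about \<open>T / rho w\<close> and \<open>T\<close>, bounded by multiples of their
  powers with exponent \<open>\<delta>\<close>. The product of these two powers dominates both and
  has the exponents \<open>- \<delta>\<close> and \<open>2 * \<delta>\<close>.\<close>

lemma growth_bloch0: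
  fixes f :: "(complex, 'n::{finite,linorder}) vec \<Rightarrow> complex"
  assumes fB: "f \<in> bloch0" and \<delta>: "\<delta> > 0"
  shows "growth (- \<delta>) (2 * \<delta>) f"
proof -
  have f: "holo_on f siegel" and f0: "f base_pt = 0" using fB by (auto simp: bloch0_def)
  obtain M where M: "M \<ge> 0" "\<And>w. w \<in> siegel \<Longrightarrow> cmod (pd top_idx f w) \<le> M / rho w"
    "\<And>w j. w \<in> siegel \<Longrightarrow> j < top_idx \<Longrightarrow> cmod (Lop j f w) \<le> M / sqrt (rho w)"
    using fB by (rule bloch0_bounds) (rule that)
  define K where "K = M * (2 powr \<delta> / \<delta>) + 3 * M * real CARD('n) + M * (2 powr \<delta> / \<delta>)"
  show ?thesis
  proof (rule growthI)
    fix w :: "(complex, 'n) vec" assume w: "w \<in> siegel"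
    note s = siegelD[OF w]
    define T where "T = wt w"
    define X where "X = rho w powr - \<delta> * wt w powr (2 * \<delta>)"
    let ?v = "axis top_idx (\<i> * of_real T) :: (complex, 'n) vec"
    have T: "T \<ge> 1" "T > 0" using s by (auto simp: T_def)
    have Xeq: "X = (T / rho w) powr \<delta> * T powr \<delta>"
    proof -
      have "T powr (2 * \<delta>) = T powr \<delta> * T powr \<delta>" by (simp add: powr_add[symmetric])
      thus ?thesis using s T by (simp add: X_def T_def[symmetric] powr_divide powr_minus_divide)
    qed
    have q1: "(T / rho w) powr \<delta> \<ge> 1" "T powr \<delta> \<ge> 1"
      using s T \<delta> by (auto intro!: ge_one_powr_ge_zero simp: T_def)
    have X1: "1 \<le> X" "(T / rho w) powr \<delta> \<le> X" "T powr \<delta> \<le> X"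
      unfolding Xeq using q1 mult_mono[of 1 "(T / rho w) powr \<delta>" 1 "T powr \<delta>"]
        mult_left_mono[of 1 "T powr \<delta>" "(T / rho w) powr \<delta>"] mult_right_mono[of 1 "(T / rho w) powr \<delta>" "T powr \<delta>"]
      by auto
    have rb: "rho (base_pt :: (complex, 'n) vec) = 1"
      by (simp add: rho_eq) (auto simp: base_pt_def axis_def sqsum_def intro!: sum.neutral)
    have lnb: "ln y \<le> 2 powr \<delta> / \<delta> * X" if "1 \<le> y" "y \<le> 2 * c" "c powr \<delta> \<le> X" "c > 0" for y c
    proof -
      have "ln y \<le> y powr \<delta> / \<delta>" by (rule ln_powr_bound) (use that \<delta> in auto)
      also have "\<dots> \<le> (2 * c) powr \<delta> / \<delta>" using that \<delta> by (intro divide_right_mono powr_mono2) auto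
      also have "\<dots> = 2 powr \<delta> / \<delta> * c powr \<delta>" using that by (simp add: powr_mult)
      also have "\<dots> \<le> 2 powr \<delta> / \<delta> * X" using that \<delta> by (intro mult_left_mono) auto
      finally show ?thesis .
    qed
    have "cmod (f (w + ?v) - f w) \<le> M * ln ((rho w + T) / rho w)"
      by (rule vertical_variation[OF f M(1,2) w T(2)])
    also have "\<dots> \<le> M * (2 powr \<delta> / \<delta> * X)"
    proof (intro mult_left_mono lnb[where c="T / rho w"] M)
      show "1 \<le> (rho w + T) / rho w" "(rho w + T) / rho w \<le> 2 * (T / rho w)" "T / rho w > 0"
        using s T by (auto simp: field_simps T_def)
    qed (rule X1)
    finally have 1: "cmod (f (w + ?v) - f w) \<le> M * (2 powr \<delta> / \<delta>) * X" by (simp add: mult_ac)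
    have "cmod (f (base_pt + ?v) - f base_pt) \<le> M * ln ((rho (base_pt :: (complex, 'n) vec) + T) / rho (base_pt :: (complex, 'n) vec))"
      by (rule vertical_variation[OF f M(1,2) base_pt_siegel T(2)])
    also have "\<dots> \<le> M * (2 powr \<delta> / \<delta> * X)"
    proof (intro mult_left_mono lnb[where c=T] M)
      show "1 \<le> (rho (base_pt :: (complex, 'n) vec) + T) / rho (base_pt :: (complex, 'n) vec)"
        "(rho (base_pt :: (complex, 'n) vec) + T) / rho (base_pt :: (complex, 'n) vec) \<le> 2 * T"
        using T unfolding rb by auto
    qed (use T X1 in auto)
    finally have 2: "cmod (f (base_pt + ?v)) \<le> M * (2 powr \<delta> / \<delta>) * X" by (simp add: mult_ac f0)
    have "cmod (f (w + ?v) - f (base_pt + ?v)) \<le> 3 * M * real CARD('n)"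
      unfolding T_def by (rule horizontal_variation[OF f M w])
    also have "\<dots> \<le> 3 * M * real CARD('n) * X" using mult_left_mono[OF X1(1), of "3 * M * real CARD('n)"] M(1) by simp
    finally have 3: "cmod (f (w + ?v) - f (base_pt + ?v)) \<le> 3 * M * real CARD('n) * X" .
    have e: "f w = (f (w + ?v) - f (base_pt + ?v)) + f (base_pt + ?v) - (f (w + ?v) - f w)" by simp
    have "cmod (f w) \<le> cmod (f (w + ?v) - f (base_pt + ?v)) + cmod (f (base_pt + ?v)) + cmod (f (w + ?v) - f w)"
      by (subst e) (rule order_trans[OF norm_triangle_ineq4 add_right_mono[OF norm_triangle_ineq]])
    also have "\<dots> \<le> K * X" unfolding K_def distrib_right using 1 2 3 by linarith
    finally show "cmod (f w) \<le> K * (rho w powr - \<delta> * wt w powr (2 * \<delta>))" by (simp add: X_def)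
  qed
qed

text \<open>A change of the top coordinate leaves \<open>sqsum\<close> alone, so a disc of radius
  \<open>rho w / 4\<close> fits and nothing is lost in \<open>wt\<close>. For this reason
  \<open>rho ^ N\<close> times the top derivative of order \<open>N\<close> stays in the growth
  class of the function.\<close>

lemma growth_pd_top:
  fixes h :: "(complex, 'n::{finite,linorder}) vec \<Rightarrow> complex"
  assumes hol: "holo_on h siegel" and gr: "growth a p h"
  shows "growth (a - 1) p (pd top_idx h)"
proof -
  from gr obtain C where C: "C \<ge> 0" "\<And>w. w \<in> siegel \<Longrightarrow> cmod (h w) \<le> C * (rho w powr a * wt w powr p)"
    by (rule growthE) (rule that)
  show ?thesis
  proof (rule growthI)
    fix w :: "(complex, 'n) vec" assume w: "w \<in> siegel"
    note s = siegelD[OF w]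
    have ax: "\<xi> *s axis top_idx 1 = (axis top_idx \<xi> :: (complex, 'n) vec)" for \<xi> :: complex by (rule axis_eq_smult[symmetric])
    have "cmod (cdiff h w (axis top_idx 1)) \<le> C * ((4 powr \<bar>a\<bar> * rho w powr a) * (4 powr \<bar>p\<bar> * wt w powr p)) / (rho w / 4)"
    proof (rule cauchy_line[OF hol])
      fix \<xi> :: complex assume \<xi>: "cmod \<xi> \<le> rho w / 4"
      let ?u = "w + axis top_idx \<xi>"
      have "\<bar>Im \<xi>\<bar> \<le> rho w / 4" using \<xi> abs_Im_le_cmod[of \<xi>] by linarith
      hence r: "rho w / 4 \<le> rho ?u" "rho ?u \<le> 4 * rho w"
        using s(1) by (auto simp: rho_axis abs_le_iff)
      have q: "wt w / 4 \<le> wt ?u" "wt ?u \<le> 4 * wt w"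
        using wt_axis_le[of w top_idx \<xi>] \<xi> s(1,3) by (auto simp: abs_le_iff)
      have S: "?u \<in> siegel" using r s(1) by (simp add: siegel_def)
      thus "w + \<xi> *s axis top_idx 1 \<in> siegel" by (simp add: ax)
      have "cmod (h ?u) \<le> C * (rho ?u powr a * wt ?u powr p)" by (rule C(2)[OF S])
      also have "\<dots> \<le> C * ((4 powr \<bar>a\<bar> * rho w powr a) * (4 powr \<bar>p\<bar> * wt w powr p))"
        by (rule mult_left_mono[OF mult_mono[OF powr_compare[OF s(1) r] powr_compare[OF _ q]]])
          (use s(4) C(1) in auto)
      finally show "cmod (h (w + \<xi> *s axis top_idx 1)) \<le> C * ((4 powr \<bar>a\<bar> * rho w powr a) * (4 powr \<bar>p\<bar> * wt w powr p))"
        by (simp add: ax)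
    qed (use s(1) in auto)
    also have "\<dots> = (C * (4 powr \<bar>a\<bar> * 4 powr \<bar>p\<bar> * 4)) * ((rho w powr a / rho w) * wt w powr p)" by simp
    also have "rho w powr a / rho w = rho w powr (a - 1)" using s by (simp add: powr_diff)
    finally show "cmod (pd top_idx h w) \<le> (C * (4 powr \<bar>a\<bar> * 4 powr \<bar>p\<bar> * 4)) * (rho w powr (a - 1) * wt w powr p)"
      by (simp add: pd_eq_cdiff)
  qed
qed

section \<open>The modified projection\<close>

lemma kern_eq_cnj_kpow:
  fixes z w :: "(complex, 'n::{finite,linorder}) vec"
  assumes "z \<in> siegel" "w \<in> siegel"
  shows "kern l z w = cnj (kpow (real CARD('n) + 1 + l) z w)"
  by (simp only: kern_def cnj_kpow(1)[OF assms])

text \<open>The mean value inequality for the power on the segment between the two bases. Since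
  \<open>rho2 w\<close> is real-affine in its second argument, that segment is the image of the one
  from \<open>b\<close> to \<open>z\<close>, which lies in the half-space. There
  \<open>wt_le_rho2\<close> keeps the base away from 0, and \<open>K\<close> bounds its constant
  uniformly.\<close>

lemma kpow_difference_bound:
  fixes z w :: "(complex, 'n::{finite,linorder}) vec"
  assumes z: "z \<in> siegel" and b: "b \<in> siegel" and w: "w \<in> siegel" and s: "s \<ge> 0"
  defines "K \<equiv> 12 + 14 * (wt b + wt z) / min (rho b) (rho z)"
  shows "cmod (kpow s z w - kpow s b w) \<le> s * (wt w / K) powr (- (s + 1)) * cmod (rho2 w z - rho2 w b)"
proof -
  note sz = siegelD[OF z] and sb = siegelD[OF b] and sw = siegelD[OF w]
  have m: "min (rho b) (rho z) > 0" using sz(1) sb(1) by simp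
  have K: "K > 0" using m sz(4) sb(4) by (simp add: K_def add_pos_nonneg)
  have pt: "x \<noteq> 0 \<and> x \<notin> \<real>\<^sub>\<le>\<^sub>0 \<and> wt w / K \<le> cmod x" if "x \<in> closed_segment (rho2 w b) (rho2 w z)" for x
  proof -
    from that obtain t where t: "0 \<le> t" "t \<le> 1" and x: "x = (1 - t) *\<^sub>R rho2 w b + t *\<^sub>R rho2 w z"
      by (auto simp: in_segment)
    let ?p = "b + t *\<^sub>R (z - b)"
    note seg = segment_siegel[OF b z t]
    have p: "?p \<in> siegel" by (rule seg(2))
    have "rho2 w ?p = x"
    proof -
      have c: "cnj (?p $ j) = of_real (1 - t) * cnj (b $ j) + of_real t * cnj (z $ j)" for j
        by (simp add: scaleR_conv_of_real[where 'a=complex] algebra_simps)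
      have S: "(\<Sum>j\<in>{..<top_idx}. w $ j * cnj (?p $ j)) =
         of_real (1 - t) * (\<Sum>j\<in>{..<top_idx}. w $ j * cnj (b $ j)) + of_real t * (\<Sum>j\<in>{..<top_idx}. w $ j * cnj (z $ j))"
        unfolding c by (simp only: sum_distrib_left sum.distrib[symmetric]) (simp only: algebra_simps)
      define Sb Sz where "Sb = (\<Sum>j\<in>{..<top_idx}. w $ j * cnj (b $ j))" and "Sz = (\<Sum>j\<in>{..<top_idx}. w $ j * cnj (z $ j))"
      have 1: "rho2 w ?p = \<i> / 2 * ((of_real (1 - t) * cnj (b $ top_idx) + of_real t * cnj (z $ top_idx)) - w $ top_idx)
          - (of_real (1 - t) * Sb + of_real t * Sz)"
        unfolding rho2_def S Sb_def Sz_def by (simp only: c)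
      have 2: "x = of_real (1 - t) * (\<i> / 2 * (cnj (b $ top_idx) - w $ top_idx) - Sb)
          + of_real t * (\<i> / 2 * (cnj (z $ top_idx) - w $ top_idx) - Sz)"
        by (simp only: x rho2_def scaleR_conv_of_real[where 'a=complex] Sb_def Sz_def)
      show ?thesis unfolding 1 2 by (simp add: field_simps)
    qed
    hence "cmod x = cmod (rho2 ?p w)" by (metis complex_mod_cnj rho2_cnj)
    moreover have "wt w \<le> K * cmod (rho2 ?p w)"
    proof -
      have "14 * wt ?p / rho ?p \<le> 14 * (wt b + wt z) / min (rho b) (rho z)"
        using seg(3) rho_segment_min[OF b z t] m siegelD(4)[OF p] by (intro frac_le) auto
      hence "(12 + 14 * wt ?p / rho ?p) * cmod (rho2 ?p w) \<le> K * cmod (rho2 ?p w)"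
        by (intro mult_right_mono) (auto simp: K_def)
      thus ?thesis using wt_le_rho2[OF p w] by linarith
    qed
    ultimately have "wt w / K \<le> cmod x" using K by (simp add: field_simps)
    thus ?thesis using rho2_nonzero[OF w p] \<open>rho2 w ?p = x\<close> by simp
  qed
  have "cmod (rho2 w z powr of_real (- s) - rho2 w b powr of_real (- s)) \<le> (s * (wt w / K) powr (- (s + 1))) * cmod (rho2 w z - rho2 w b)"
  proof (rule field_differentiable_bound[where S="closed_segment (rho2 w b) (rho2 w z)" and f'="\<lambda>x. of_real (- s) * x powr of_real (- (s + 1))"])
    fix x assume x: "x \<in> closed_segment (rho2 w b) (rho2 w z)"
    have "((\<lambda>x. x powr of_real (- s)) has_field_derivative of_real (- s) * x powr (of_real (- s) - 1)) (at x)"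
      by (rule has_field_derivative_powr) (use pt[OF x] in simp)
    moreover have "of_real (- s) - 1 = complex_of_real (- (s + 1))" by simp
    ultimately have "((\<lambda>x. x powr of_real (- s)) has_field_derivative of_real (- s) * x powr of_real (- (s + 1))) (at x)"
      by (simp only:)
    thus "((\<lambda>x. x powr of_real (- s)) has_field_derivative of_real (- s) * x powr of_real (- (s + 1))) (at x within closed_segment (rho2 w b) (rho2 w z))"
      by (rule has_field_derivative_at_within)
    have "cmod (of_real (- s) * x powr of_real (- (s + 1))) = s * cmod x powr (- (s + 1))"
      unfolding norm_mult using cmod_powr_of_real[of x "- (s + 1)"] pt[OF x] s by simp
    also have "\<dots> \<le> s * (wt w / K) powr (- (s + 1))"
      using pt[OF x] K sw(4) s by (intro mult_left_mono powr_mono2') auto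
    finally show "cmod (of_real (- s) * x powr of_real (- (s + 1))) \<le> s * (wt w / K) powr (- (s + 1))" .
  qed auto
  thus ?thesis by (simp add: kpow_def)
qed

text \<open>Differentiating the power gains a full order, but the difference of the bases contains
  the tangential product of \<open>w\<close> and \<open>z\<close>, which grows like
  \<open>sqrt (wt w)\<close>. One half is the net gain.\<close>

lemma growth_kpow_difference:
  fixes z :: "(complex, 'n::{finite,linorder}) vec"
  assumes z: "z \<in> siegel" and s: "s \<ge> 0"
  shows "growth 0 (- (s + 1/2)) (\<lambda>w. kpow s z w - kpow s base_pt w)"
proof -
  let ?b = "base_pt :: (complex, 'n) vec"
  note sz = siegelD[OF z] and b = base_pt_siegel[where 'n='n]
  define K where "K = 12 + 14 * (wt ?b + wt z) / min (rho ?b) (rho z)"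
  have K: "K > 0" using sz(1,4) siegelD(1,4)[OF b] by (simp add: K_def add_pos_nonneg)
  define N where "N = wt z + real CARD('n) * wt z"
  have N0: "N \<ge> 0" using sz(4) by (simp add: N_def)
  show ?thesis
  proof (rule growthI)
    fix w :: "(complex, 'n) vec" assume w: "w \<in> siegel"
    note sw = siegelD[OF w]
    have bk: "?b $ j = (if j = top_idx then \<i> else 0)" for j by (simp add: base_pt_def axis_def)
    have "rho2 w z - rho2 w ?b = \<i> / 2 * (cnj (z $ top_idx - \<i>)) - (\<Sum>j\<in>{..<top_idx}. w $ j * cnj (z $ j))"
    proof -
      have "(\<Sum>j\<in>{..<top_idx}. w $ j * cnj (?b $ j)) = 0" by (intro sum.neutral) (auto simp: bk)
      thus ?thesis by (simp add: rho2_def bk algebra_simps)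
    qed
    hence "cmod (rho2 w z - rho2 w ?b) \<le> cmod (\<i> / 2 * (cnj (z $ top_idx - \<i>))) + cmod (\<Sum>j\<in>{..<top_idx}. w $ j * cnj (z $ j))"
      by (simp only: norm_triangle_ineq4)
    also have "cmod (\<i> / 2 * (cnj (z $ top_idx - \<i>))) \<le> wt z * sqrt (wt w)"
    proof -
      have "cmod (\<i> / 2 * (cnj (z $ top_idx - \<i>))) \<le> cmod (z $ top_idx - \<i>)"
        by (simp add: norm_mult norm_divide del: complex_cnj_diff)
      also have "\<dots> \<le> wt z"
        unfolding wt_def cmod_def using sz(7)
        by (intro real_sqrt_le_mono add_mono) (auto simp: power2_eq_square algebra_simps)
      also have "\<dots> \<le> wt z * sqrt (wt w)" using sz(4) sw(4) by simp
      finally show ?thesis .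
    qed
    also have "cmod (\<Sum>j\<in>{..<top_idx}. w $ j * cnj (z $ j)) \<le> (\<Sum>j\<in>{..<top_idx::'n}. sqrt (wt w) * wt z)"
    proof (rule sum_norm_le)
      fix j :: 'n assume "j \<in> {..<top_idx}"
      hence "cmod (w $ j) \<le> sqrt (wt w)" using sw(6)[of j] by (intro real_le_rsqrt) auto
      thus "cmod (w $ j * cnj (z $ j)) \<le> sqrt (wt w) * wt z"
        unfolding norm_mult using sz(5)[of j] sw(4) by (intro mult_mono) auto
    qed
    also have "(\<Sum>j\<in>{..<top_idx::'n}. sqrt (wt w) * wt z) \<le> real CARD('n) * (sqrt (wt w) * wt z)"
    proof -
      have "card {..<top_idx::'n} \<le> CARD('n)" by (intro card_mono) auto
      thus ?thesis using sz(4) sw(4) by (simp add: mult_right_mono)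
    qed
    finally have d: "cmod (rho2 w z - rho2 w ?b) \<le> N * sqrt (wt w)"
      by (simp add: N_def algebra_simps)
    have "cmod (kpow s z w - kpow s ?b w) \<le> s * (wt w / K) powr (- (s + 1)) * cmod (rho2 w z - rho2 w ?b)"
      unfolding K_def by (rule kpow_difference_bound[OF z b w s])
    also have "\<dots> \<le> s * (wt w / K) powr (- (s + 1)) * (N * sqrt (wt w))"
      using d s by (intro mult_left_mono) auto
    also have "(wt w / K) powr (- (s + 1)) = K powr (s + 1) * wt w powr (- (s + 1))"
    proof -
      have "(wt w / K) powr (- (s + 1)) = wt w powr (- (s + 1)) / K powr (- (s + 1))"
        by (rule powr_divide)
      also have "K powr (- (s + 1)) = inverse (K powr (s + 1))" by (rule powr_minus)
      finally show ?thesis by (simp only: divide_inverse inverse_inverse_eq mult.commute)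
    qed
    also have "sqrt (wt w) = wt w powr (1/2)" using sw(4) by (simp add: powr_half_sqrt)
    also have "s * (K powr (s + 1) * wt w powr (- (s + 1))) * (N * wt w powr (1/2)) = s * K powr (s + 1) * N * (wt w powr (- (s + 1)) * wt w powr (1/2))"
      by (simp only: mult_ac)
    also have "wt w powr (- (s + 1)) * wt w powr (1/2) = wt w powr (- (s + 1/2))"
    proof -
      have "- (s + 1) + 1/2 = - (s + 1/2)" by simp
      thus ?thesis by (simp only: powr_add[symmetric])
    qed
    finally show "cmod (kpow s z w - kpow s ?b w) \<le> s * K powr (s + 1) * N * (rho w powr 0 * wt w powr (- (s + 1/2)))"
      using sw(1) by simp
  qed
qed

section \<open>The weighted measure and the passage to higher order\<close>

lemma c_const_pos: "l > -1 \<Longrightarrow> c_const n l > 0"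
  unfolding c_const_def by (intro divide_pos_pos mult_pos_pos Gamma_real_pos) auto

lemma dV_integral:
  fixes F :: "(complex, 'n::{finite,linorder}) vec \<Rightarrow> complex"
  assumes l: "l > -1" and F: "continuous_on siegel F"
  shows "integrable (dV l) F \<longleftrightarrow> set_integrable lborel siegel (\<lambda>w. of_real (rho w powr l) * F w)"
    "(LINT w|dV l. F w) = of_real (c_const CARD('n) l) * (LINT w:siegel|lborel. of_real (rho w powr l) * F w)"
proof -
  let ?c = "c_const CARD('n) l"
  have c: "?c > 0" by (rule c_const_pos[OF l])
  have mF: "(\<lambda>w. indicator siegel w *\<^sub>R F w) \<in> borel_measurable borel"
    by (rule borel_measurable_continuous_on_indicator[OF siegel_measurable F])
  have S: "siegel \<inter> space lebesgue \<in> sets (lebesgue :: (complex, 'n) vec measure)" by simp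
  have mL: "F \<in> borel_measurable (lebesgue_on siegel)"
    by (subst borel_measurable_restrict_space_iff[OF S]) (rule borel_measurable_if_lebesgue_on | rule measurable_completion[of _ lborel], use mF in simp)+
  have mr: "(\<lambda>w. ?c * rho w powr l) \<in> borel_measurable (lebesgue_on siegel)"
    by (rule measurable_restrict_space1, rule measurable_completion) simp
  have nn: "AE w in lebesgue_on siegel. 0 \<le> ?c * rho (w :: (complex, 'n) vec) powr l" using c by simp
  have mH: "(\<lambda>w. indicator siegel w *\<^sub>R ((?c * rho w powr l) *\<^sub>R F w)) \<in> borel_measurable lborel"
  proof -
    have "(\<lambda>w. (?c * rho w powr l) *\<^sub>R (indicator siegel w *\<^sub>R F w)) \<in> borel_measurable borel"
      by (intro borel_measurable_scaleR mF) simp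
    thus ?thesis by (simp add: mult_ac)
  qed
  have e: "(?c * rho w powr l) *\<^sub>R F w = of_real ?c * (of_real (rho w powr l) * F w)" for w
    by (simp add: scaleR_conv_of_real)
  have "integrable (dV l) F \<longleftrightarrow> integrable (lebesgue_on siegel) (\<lambda>w. (?c * rho w powr l) *\<^sub>R F w)"
    unfolding dV_def by (rule integrable_density[OF mL mr nn])
  also have "\<dots> \<longleftrightarrow> integrable lborel (\<lambda>w. indicator siegel w *\<^sub>R ((?c * rho w powr l) *\<^sub>R F w))"
    by (subst integrable_restrict_space[OF S], subst integrable_completion[OF mH]) simp
  also have "\<dots> \<longleftrightarrow> set_integrable lborel siegel (\<lambda>w. of_real ?c * (of_real (rho w powr l) * F w))"
    unfolding set_integrable_def e ..
  also have "\<dots> \<longleftrightarrow> set_integrable lborel siegel (\<lambda>w. of_real (rho w powr l) * F w)"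
    using c by (subst set_integrable_mult_right_iff) auto
  finally show "integrable (dV l) F \<longleftrightarrow> set_integrable lborel siegel (\<lambda>w. of_real (rho w powr l) * F w)" .
  have "(LINT w|dV l. F w) = (LINT w|lebesgue_on siegel. (?c * rho w powr l) *\<^sub>R F w)"
    unfolding dV_def by (rule integral_density[OF mL mr nn])
  also have "\<dots> = (LINT w|lborel. indicator siegel w *\<^sub>R ((?c * rho w powr l) *\<^sub>R F w))"
    by (subst integral_restrict_space[OF S], subst integral_completion[OF mH]) simp
  also have "\<dots> = (LINT w:siegel|lborel. of_real ?c * (of_real (rho w powr l) * F w))"
    unfolding set_lebesgue_integral_def e ..
  also have "\<dots> = of_real ?c * (LINT w:siegel|lborel. of_real (rho w powr l) * F w)"
    by (rule set_integral_mult_right)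
  finally show "(LINT w|dV l. F w) = of_real (c_const CARD('n) l) * (LINT w:siegel|lborel. of_real (rho w powr l) * F w)" .
qed

lemma pd_damp_power:
  fixes w :: "(complex, 'n::{finite,linorder}) vec"
  assumes "w \<in> siegel"
  shows "pd top_idx (\<lambda>w. damp k w ^ m) w = - of_nat m * damp k w ^ m / (w $ top_idx + \<i> * of_nat (Suc k))"
proof -
  have "((\<lambda>x. x ^ m) has_field_derivative of_nat m * damp k w ^ (m - 1)) (at (damp k w))"
    by (auto intro!: derivative_eq_intros)
  from pd_compose[OF holo_on_damp assms this, of top_idx]
  have "pd top_idx (\<lambda>w. damp k w ^ m) w = of_nat m * damp k w ^ (m - 1) * pd top_idx (damp k) w" .
  thus ?thesis unfolding pd_damp[OF assms] by (cases m) (auto simp del: of_nat_Suc)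
qed

text \<open>The damping factor makes the boundary terms at infinity vanish; its own derivative contributes
  nothing in the limit because \<open>rho w\<close> is at most the modulus of the denominator.\<close>

lemma order_raising_step:
  fixes z :: "(complex, 'n::{finite,linorder}) vec" and g :: "(complex, 'n) vec \<Rightarrow> complex"
  assumes l: "l > -1" and z: "z \<in> siegel" and g: "holo_on g siegel" "growth (- a) (2 * \<delta>) g"
    and \<delta>: "\<delta> > 0" "\<delta> < 1/2" and \<mu>: "\<mu> - 1 - a = l - \<delta>" "l - \<delta> > -1"
  defines "H \<equiv> \<lambda>w. cnj (kpow (real CARD('n) + 1 + l) z w - kpow (real CARD('n) + 1 + l) base_pt w)"
  shows "set_integrable lborel siegel (\<lambda>w. of_real (rho w powr (\<mu> - 1)) * (g w * H w))"
    "set_integrable lborel siegel (\<lambda>w. of_real (rho w powr \<mu>) * (pd top_idx g w * H w))"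
    "of_real \<mu> * (LINT w:siegel|lborel. of_real (rho w powr (\<mu> - 1)) * (g w * H w))
      = - 2 * \<i> * (LINT w:siegel|lborel. of_real (rho w powr \<mu>) * (pd top_idx g w * H w))"
proof -
  define s where "s = real CARD('n) + 1 + l"
  have s0: "s \<ge> 0" using l by (simp add: s_def)
  \<comment> \<open>\<open>normal_by_parts\<close> takes the holomorphic function whose conjugate is
    the kernel difference \<open>H\<close>.\<close>
  define h where "h = (\<lambda>w. kpow s z w + (- 1) * kpow s base_pt w)"
  have hH: "H w = cnj (h w)" for w by (simp add: H_def h_def s_def)
  have h: "holo_on h siegel" "growth 0 (- (s + 1/2)) h"
  proof -
    show "holo_on h siegel"
      unfolding h_def by (intro holo_on_add holo_on_mult holo_on_const holo_on_kpow z base_pt_siegel)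
    show "growth 0 (- (s + 1/2)) h" using growth_kpow_difference[OF z s0] by (simp add: h_def)
  qed
  note cg = holo_continuous_on[OF g(1)] and ch = holo_continuous_on[OF h(1)]
    and cpd = holo_continuous_on[OF holo_on_pd[OF g(1) open_siegel], of top_idx]
  let ?f = "\<lambda>w. of_real (rho w powr (\<mu> - 1)) * (g w * H w)"
  let ?p = "\<lambda>w. of_real (rho w powr \<mu>) * (pd top_idx g w * H w)"
  have cf: "continuous_on siegel ?f" "continuous_on siegel ?p"
    unfolding hH by (intro continuous_intros cg ch cpd continuous_on_rho_powr)+
  have gf: "growth (\<mu> - 1 + (- a + 0)) (0 + (2 * \<delta> + - (s + 1/2))) ?f"
    unfolding hH by (intro growth_mult growth_rho g growth_cnj h)
  have gp: "growth (\<mu> + ((- a - 1) + 0)) (0 + (2 * \<delta> + - (s + 1/2))) ?p"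
    unfolding hH by (intro growth_mult growth_rho growth_pd_top g growth_cnj h)
  \<comment> \<open>The boundary exponent is \<open>l - \<delta>\<close>. At infinity
    \<open>s + 1/2 - 2 * \<delta>\<close> has to exceed \<open>s - \<delta>\<close>: this is where
    the half order gained by the difference of kernels is spent, and where
    \<open>\<delta> < 1/2\<close> comes from.\<close>
  show i1: "set_integrable lborel siegel ?f"
    by (rule set_integrable_growth[OF cf(1) gf]) (use \<mu> \<delta> in \<open>auto simp: s_def\<close>)
  show i2: "set_integrable lborel siegel ?p"
    by (rule set_integrable_growth[OF cf(2) gp]) (use \<mu> \<delta> in \<open>auto simp: s_def\<close>)
  define b where "b k = (\<lambda>w. g w * damp k w ^ 8)" for k :: nat
  have hb: "holo_on (b k) siegel" for k
    unfolding b_def by (intro holo_on_mult holo_on_power holo_on_damp g)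
  have gb: "growth (- a + 0) (2 * \<delta> + - real 8) (b k)" for k
    unfolding b_def by (intro growth_mult growth_damp_power g)
  have pdb: "pd top_idx (b k) w = pd top_idx g w * damp k w ^ 8 - 8 * (g w * damp k w ^ 8) / (w $ top_idx + \<i> * of_nat (Suc k))"
    if w: "w \<in> siegel" for k w
    unfolding b_def pd_mult[OF g(1) holo_on_power[OF holo_on_damp] w] pd_damp_power[OF w]
    by (simp add: algebra_simps del: of_nat_Suc)
  \<comment> \<open>\<open>normal_by_parts\<close> conjugates its first function, so its identity
    carries \<open>cnj (b k w)\<close>. Conjugating the whole identity restores \<open>b k\<close>,
    and multiplying by \<open>\<i>\<close> brings it to the stated form.\<close>
  have E: "of_real \<mu> * (LINT w:siegel|lborel. of_real (rho w powr (\<mu> - 1)) * (b k w * H w))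
      = - 2 * \<i> * (LINT w:siegel|lborel. of_real (rho w powr \<mu>) * (pd top_idx (b k) w * H w))" for k
  proof -
    have "of_real \<mu> * \<i> * (LINT w:siegel|lborel. of_real (rho w powr (\<mu> - 1)) * (cnj (b k w) * h w))
      + 2 * (LINT w:siegel|lborel. of_real (rho w powr \<mu>) * (cnj (pd top_idx (b k) w) * h w)) = 0"
      by (rule normal_by_parts(3)[OF hb gb h]) (use \<mu> \<delta> in \<open>auto simp: s_def\<close>)
    hence "cnj (of_real \<mu> * \<i> * (LINT w:siegel|lborel. of_real (rho w powr (\<mu> - 1)) * (cnj (b k w) * h w))
      + 2 * (LINT w:siegel|lborel. of_real (rho w powr \<mu>) * (cnj (pd top_idx (b k) w) * h w))) = cnj 0"
      by (simp only:)
    moreover have "cnj (LINT w:siegel|lborel. of_real (rho w powr (\<mu> - 1)) * (cnj (b k w) * h w)) = (LINT w:siegel|lborel. of_real (rho w powr (\<mu> - 1)) * (b k w * H w))"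
      unfolding set_lebesgue_integral_def hH by (subst Bochner_Integration.integral_cnj[symmetric]) simp
    moreover have "cnj (LINT w:siegel|lborel. of_real (rho w powr \<mu>) * (cnj (pd top_idx (b k) w) * h w)) = (LINT w:siegel|lborel. of_real (rho w powr \<mu>) * (pd top_idx (b k) w * H w))"
      unfolding set_lebesgue_integral_def hH by (subst Bochner_Integration.integral_cnj[symmetric]) simp
    ultimately have "- \<i> * (of_real \<mu> * (LINT w:siegel|lborel. of_real (rho w powr (\<mu> - 1)) * (b k w * H w)))
      + 2 * (LINT w:siegel|lborel. of_real (rho w powr \<mu>) * (pd top_idx (b k) w * H w)) = 0"
      by (simp add: mult_ac)
    hence "\<i> * (- \<i> * (of_real \<mu> * (LINT w:siegel|lborel. of_real (rho w powr (\<mu> - 1)) * (b k w * H w)))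
      + 2 * (LINT w:siegel|lborel. of_real (rho w powr \<mu>) * (pd top_idx (b k) w * H w))) = 0"
      by (simp only: mult_zero_right)
    thus ?thesis by (simp add: distrib_left add_eq_0_iff2 mult_ac)
  qed
  have L1: "(\<lambda>k. LINT w:siegel|lborel. of_real (rho w powr (\<mu> - 1)) * (b k w * H w)) \<longlonglongrightarrow> (LINT w:siegel|lborel. ?f w)"
  proof -
    have e: "of_real (rho w powr (\<mu> - 1)) * (b k w * H w) = ?f w * damp k w ^ 8" for k w
      unfolding b_def by (simp only: mult_ac)
    show ?thesis unfolding e by (rule damped_integral_limit[OF cf(1) i1])
  qed
  have L2: "(\<lambda>k. LINT w:siegel|lborel. of_real (rho w powr \<mu>) * (pd top_idx (b k) w * H w)) \<longlonglongrightarrow> (LINT w:siegel|lborel. ?p w)"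
  proof (rule siegel_dominated_convergence(2))
    show "set_integrable lborel siegel (\<lambda>w. cmod (?p w) + 8 * cmod (?f w))"
      using set_integrable_norm[OF i1] set_integrable_norm[OF i2]
      by (intro set_integral_add set_integrable_mult_right) auto
    fix k
    show "continuous_on siegel (\<lambda>w. of_real (rho w powr \<mu>) * (pd top_idx (b k) w * H w))"
      unfolding hH by (intro continuous_intros ch holo_continuous_on[OF holo_on_pd[OF hb open_siegel]] continuous_on_rho_powr)
  next
    fix k and w :: "(complex, 'n) vec" assume w: "w \<in> siegel"
    note sw = siegelD[OF w] and dd = damp_denominator[OF w, of k]
    define D where "D = w $ top_idx + \<i> * of_nat (Suc k)"
    have D: "rho w \<le> cmod D" "cmod D > 0" using dd(1) sw(1,3) by (auto simp: D_def)
    have d8: "cmod (damp k w) ^ 8 \<le> 1" by (intro power_le_one cmod_damp_le w) auto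
    have r: "rho w powr \<mu> = rho w powr (\<mu> - 1) * rho w" using sw(1) by (simp add: powr_diff)
    have "of_real (rho w powr \<mu>) * (pd top_idx (b k) w * H w) = ?p w * damp k w ^ 8 - 8 * (?f w * (damp k w ^ 8 * (of_real (rho w) / D)))"
      unfolding pdb[OF w] D_def[symmetric] r by (simp add: algebra_simps)
    also have "cmod \<dots> \<le> cmod (?p w * damp k w ^ 8) + cmod (8 * (?f w * (damp k w ^ 8 * (of_real (rho w) / D))))"
      by (rule norm_triangle_ineq4)
    also have "cmod (?p w * damp k w ^ 8) \<le> cmod (?p w)"
      using d8 by (simp only: norm_mult norm_power mult_left_le norm_ge_zero mult_nonneg_nonneg)
    also have "cmod (8 * (?f w * (damp k w ^ 8 * (of_real (rho w) / D)))) \<le> 8 * cmod (?f w)"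
    proof -
      have "rho w / cmod D \<le> 1" using D by simp
      hence "cmod (damp k w ^ 8 * (of_real (rho w) / D)) \<le> 1 * 1"
        unfolding norm_mult norm_power norm_divide using d8 sw(1) D by (intro mult_mono) auto
      hence "cmod (?f w) * cmod (damp k w ^ 8 * (of_real (rho w) / D)) \<le> cmod (?f w)"
        by (simp only: mult_1 mult_left_le norm_ge_zero)
      thus ?thesis by (simp only: norm_mult[of 8] norm_mult[of "?f w"] norm_numeral mult_left_mono zero_le_numeral)
    qed
    finally show "cmod (of_real (rho w powr \<mu>) * (pd top_idx (b k) w * H w)) \<le> cmod (?p w) + 8 * cmod (?f w)" by simp
  next
    fix w :: "(complex, 'n) vec" assume w: "w \<in> siegel"
    have inv: "(\<lambda>k. 1 / (w $ top_idx + \<i> * of_nat (Suc k))) \<longlonglongrightarrow> 0"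
    proof (rule tendsto_norm_zero_cancel, rule tendsto_sandwich[OF _ _ tendsto_const])
      show "\<forall>\<^sub>F k in sequentially. cmod (1 / (w $ top_idx + \<i> * of_nat (Suc k))) \<le> 1 / real (Suc k)"
        unfolding norm_divide norm_one
        by (intro always_eventually allI divide_left_mono damp_denominator(2)[OF w])
          (use damp_denominator(3)[OF w] in \<open>auto simp del: of_nat_Suc\<close>)
      show "(\<lambda>k. 1 / real (Suc k)) \<longlonglongrightarrow> 0" by (rule lim_1_over_n[THEN LIMSEQ_Suc])
    qed auto
    have "(\<lambda>k. of_real (rho w powr \<mu>) * ((pd top_idx g w * damp k w ^ 8 - 8 * (g w * damp k w ^ 8) * (1 / (w $ top_idx + \<i> * of_nat (Suc k)))) * H w))
      \<longlonglongrightarrow> of_real (rho w powr \<mu>) * ((pd top_idx g w * 1 ^ 8 - 8 * (g w * 1 ^ 8) * 0) * H w)"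
      by (intro tendsto_intros damp_tendsto inv)
    thus "(\<lambda>k. of_real (rho w powr \<mu>) * (pd top_idx (b k) w * H w)) \<longlonglongrightarrow> ?p w"
      by (simp add: pdb[OF w] del: of_nat_Suc)
  qed (rule cf)
  have "(\<lambda>k. of_real \<mu> * (LINT w:siegel|lborel. of_real (rho w powr (\<mu> - 1)) * (b k w * H w))) \<longlonglongrightarrow> of_real \<mu> * (LINT w:siegel|lborel. ?f w)"
    by (intro tendsto_intros L1)
  moreover have "(\<lambda>k. - 2 * \<i> * (LINT w:siegel|lborel. of_real (rho w powr \<mu>) * (pd top_idx (b k) w * H w))) \<longlonglongrightarrow> - 2 * \<i> * (LINT w:siegel|lborel. ?p w)"
    by (intro tendsto_intros L2)
  ultimately show "of_real \<mu> * (LINT w:siegel|lborel. ?f w) = - 2 * \<i> * (LINT w:siegel|lborel. ?p w)"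
    unfolding E by (rule LIMSEQ_unique)
qed

lemma iterated_Lop_top:
  fixes f :: "(complex, 'n::{finite,linorder}) vec \<Rightarrow> complex"
  assumes "holo_on f siegel" "growth (- \<delta>) p f"
  shows "holo_on ((Lop top_idx ^^ N) f) siegel" "growth (- (\<delta> + real N)) p ((Lop top_idx ^^ N) f)"
proof -
  have L: "Lop top_idx g = pd top_idx g" for g :: "(complex, 'n) vec \<Rightarrow> complex"
    by (simp add: Lop_def fun_eq_iff)
  have "holo_on ((Lop top_idx ^^ N) f) siegel \<and> growth (- (\<delta> + real N)) p ((Lop top_idx ^^ N) f)"
  proof (induction N)
    case (Suc N)
    have "growth (- (\<delta> + real N) - 1) p (pd top_idx ((Lop top_idx ^^ N) f))"
      using Suc by (intro growth_pd_top) auto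
    moreover have "- (\<delta> + real N) - 1 = - (\<delta> + real (Suc N))" by simp
    moreover have "(Lop top_idx ^^ Suc N) f = pd top_idx ((Lop top_idx ^^ N) f)"
      unfolding funpow.simps o_apply by (rule L)
    moreover have "holo_on (pd top_idx ((Lop top_idx ^^ N) f)) siegel"
      using Suc by (intro holo_on_pd open_siegel) auto
    ultimately show ?case by (simp only: simp_thms)
  qed (use assms in simp)
  thus "holo_on ((Lop top_idx ^^ N) f) siegel" "growth (- (\<delta> + real N)) p ((Lop top_idx ^^ N) f)" by auto
qed

text \<open>This is the case of order 0. Nine damping factors leave decay 8 in spite of the growth
  \<open>2 * \<delta>\<close> of \<open>f\<close>, so the damped function is reproduced both at
  \<open>z\<close> and at \<open>base_pt\<close>. The damping is removed only after subtracting,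
  since it is the integral against the difference \<open>H\<close> that is known to converge; the
  contribution of \<open>base_pt\<close> is zero.\<close>

lemma modified_reproducing:
  fixes z :: "(complex, 'n::{finite,linorder}) vec"
  assumes l: "l > -1" and z: "z \<in> siegel" and f: "holo_on f siegel" "growth (- \<delta>) (2 * \<delta>) f" "f base_pt = 0"
    and \<delta>: "0 \<le> \<delta>" "\<delta> \<le> 1/4" "l - 2 * \<delta> > -1"
  defines "H \<equiv> \<lambda>w. cnj (kpow (real CARD('n) + 1 + l) z w - kpow (real CARD('n) + 1 + l) base_pt w)"
  assumes int: "set_integrable lborel siegel (\<lambda>w. of_real (rho w powr l) * (f w * H w))"
  shows "f z = of_real (c_const CARD('n) l) * (LINT w:siegel|lborel. of_real (rho w powr l) * (f w * H w))"
proof -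
  define s where "s = real CARD('n) + 1 + l"
  have s0: "s \<ge> 0" using l by (simp add: s_def)
  let ?c = "complex_of_real (c_const CARD('n) l)"
  have c: "?c \<noteq> 0" using c_const_pos[OF l, of "CARD('n)"] by simp
  have ck: "continuous_on siegel (kpow s a)" if "a \<in> siegel" for a :: "(complex, 'n) vec"
    by (rule holo_continuous_on[OF holo_on_kpow[OF that]])
  have cH: "continuous_on siegel H"
    unfolding H_def s_def[symmetric] by (intro continuous_intros ck z base_pt_siegel)
  have cI: "continuous_on siegel (\<lambda>w. of_real (rho w powr l) * (f w * H w))"
    by (intro continuous_intros cH holo_continuous_on[OF f(1)] continuous_on_rho_powr)
  have E: "(LINT w:siegel|lborel. of_real (rho w powr l) * (f w * H w) * damp k w ^ 9) = (f z * damp k z ^ 9 - f base_pt * damp k (base_pt :: (complex, 'n) vec) ^ 9) / ?c" for k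
  proof -
    define G where "G = (\<lambda>w. f w * damp k w ^ 9)"
    have hG: "holo_on G siegel" unfolding G_def by (intro holo_on_mult holo_on_power holo_on_damp f)
    have "growth (- \<delta> + 0) (2 * \<delta> + - real 9) G" unfolding G_def by (intro growth_mult growth_damp_power f)
    hence gG: "growth (- \<delta>) (- 8) G" by (rule growth_weaken) (use \<delta> in auto)
    let ?I = "\<lambda>a w. of_real (rho w powr l) * cnj (kpow s a w) * G w"
    have i: "set_integrable lborel siegel (?I a)" if a: "a \<in> siegel" for a
    proof (rule set_integrable_growth)
      show "growth (l + 0 + - \<delta>) (0 + - s + - 8) (?I a)"
        by (intro growth_mult growth_rho growth_cnj growth_kpow a s0 gG)
      show "continuous_on siegel (?I a)"
        by (intro continuous_intros ck a holo_continuous_on[OF hG] continuous_on_rho_powr)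
    qed (use \<delta> in \<open>auto simp: s_def\<close>)
    have r: "(LINT w:siegel|lborel. ?I a w) = G a / ?c" if a: "a \<in> siegel" for a
      unfolding s_def by (rule weighted_reproducing[OF l a hG gG]) (use \<delta> in auto)
    have "of_real (rho w powr l) * (f w * H w) * damp k w ^ 9 = ?I z w - ?I base_pt w" for w
      by (simp add: H_def s_def G_def algebra_simps)
    hence "(LINT w:siegel|lborel. of_real (rho w powr l) * (f w * H w) * damp k w ^ 9) = (LINT w:siegel|lborel. ?I z w - ?I base_pt w)"
      by (simp only:)
    also have "\<dots> = G z / ?c - G base_pt / ?c"
      by (simp only: set_integral_diff(2)[OF i[OF z] i[OF base_pt_siegel]] r[OF z] r[OF base_pt_siegel])
    finally show ?thesis by (simp add: G_def diff_divide_distrib)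
  qed
  have "(\<lambda>k. (f z * damp k z ^ 9 - f base_pt * damp k (base_pt :: (complex, 'n) vec) ^ 9) / ?c) \<longlonglongrightarrow> (f z * 1 ^ 9 - f base_pt * 1 ^ 9) / ?c"
    by (intro tendsto_intros damp_tendsto c)
  moreover have "(\<lambda>k. LINT w:siegel|lborel. of_real (rho w powr l) * (f w * H w) * damp k w ^ 9) \<longlonglongrightarrow> (LINT w:siegel|lborel. of_real (rho w powr l) * (f w * H w))"
    by (rule damped_integral_limit[OF cI int])
  ultimately have "(LINT w:siegel|lborel. of_real (rho w powr l) * (f w * H w)) = (f z * 1 ^ 9 - f base_pt * 1 ^ 9) / ?c"
    unfolding E by (rule LIMSEQ_unique[rotated])
  thus ?thesis using c f(3) by (simp add: field_simps)
qed

theorem theorem1p1: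
  fixes f :: "complex ^ 'n::{finite,linorder} \<Rightarrow> complex"
    and N :: nat and l :: real and z :: "complex ^ 'n::{finite,linorder}"
  assumes "f \<in> bloch0" and "l > -1" and "z \<in> siegel"
  shows "P_mod_converges l (\<lambda>w. complex_of_real (rho w ^ N) * (Lop top_idx ^^ N) f w) z \<and>
    f z = (-2 * \<i>) ^ N * complex_of_real (Gamma (1 + l)) / complex_of_real (Gamma (1 + l + real N))
          * P_mod l (\<lambda>w. complex_of_real (rho w ^ N) * (Lop top_idx ^^ N) f w) z"
proof -
  note l = assms(2) and z = assms(3)
  \<comment> \<open>The condition \<open>l - 2 * \<delta> > -1\<close> means that
    \<open>\<delta>\<close> is below half of \<open>1 + l\<close>; a quarter keeps it strict. The
    other bound, 1/4, keeps \<open>\<delta>\<close> below the half order gained from the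
    kernels.\<close>
  define \<delta> where "\<delta> = min (1/4) ((1 + l) / 4)"
  have "\<delta> \<le> (1 + l) / 4" unfolding \<delta>_def by (rule min.cobounded2)
  hence "4 * \<delta> \<le> 1 + l" by (simp add: field_simps)
  hence \<delta>: "\<delta> > 0" "\<delta> \<le> 1/4" "l - 2 * \<delta> > -1" "l - \<delta> > -1" "\<delta> < 1/2"
    using l by (auto simp: \<delta>_def)
  have f: "holo_on f siegel" "f base_pt = 0" using assms(1) by (auto simp: bloch0_def)
  have gf: "growth (- \<delta>) (2 * \<delta>) f" by (rule growth_bloch0[OF assms(1) \<delta>(1)])
  define F where "F N = (Lop top_idx ^^ N) f" for N
  note F = iterated_Lop_top[OF f(1) gf, folded F_def]
  have F0: "F 0 = f" and FS: "F (Suc m) = pd top_idx (F m)" for m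
    by (simp_all add: F_def Lop_def fun_eq_iff)
  define H where "H = (\<lambda>w. cnj (kpow (real CARD('n) + 1 + l) z w - kpow (real CARD('n) + 1 + l) base_pt w))"
  \<comment> \<open>The integral of order \<open>m\<close> without its normalising constant, with
    \<open>rho ^ m\<close> merged into the weight.\<close>
  define I where "I m = (LINT w:siegel|lborel. of_real (rho w powr (l + real m)) * (F m w * H w))" for m
  have step: "set_integrable lborel siegel (\<lambda>w. of_real (rho w powr (l + real m)) * (F m w * H w))"
    "of_real (1 + l + real m) * I m = - 2 * \<i> * I (Suc m)" for m
  proof -
    have e: "l + real m + 1 - 1 = l + real m" "l + real m + 1 = l + real (Suc m)" "1 + l + real m = l + real m + 1" by simp_all
    \<comment> \<open>The derivative of order \<open>m\<close> has boundary exponent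
      \<open>- (\<delta> + m)\<close>. The weight exponent \<open>l + m + 1\<close> compensates it,
      so the condition for convergence is \<open>l - \<delta> > -1\<close> for every
      \<open>m\<close>.\<close>
    have \<mu>: "(l + real m + 1) - 1 - (\<delta> + real m) = l - \<delta>" by simp
    note S = order_raising_step[OF l z F(1)[of m] F(2)[of m] \<delta>(1,5) \<mu> \<delta>(4), folded FS, unfolded e(1)]
    show "set_integrable lborel siegel (\<lambda>w. of_real (rho w powr (l + real m)) * (F m w * H w))"
      unfolding H_def by (rule S(1))
    show "of_real (1 + l + real m) * I m = - 2 * \<i> * I (Suc m)"
      unfolding I_def e(3) H_def using S(3) unfolding e(2) .
  qed
  \<comment> \<open>Every step contributes the factor \<open>- 2 * \<i> / (1 + l + m)\<close>, and
    the denominators multiply up to the quotient of the two Gamma values.\<close>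
  have I0: "I 0 = (- 2 * \<i>) ^ m * of_real (Gamma (1 + l)) / of_real (Gamma (1 + l + real m)) * I m" for m
  proof (induction m)
    case 0
    have "Gamma (1 + l) > 0" using l by (intro Gamma_real_pos) auto
    thus ?case by simp
  next
    case (Suc m)
    have pos: "1 + l + real m > 0" using l by simp
    have G: "Gamma (1 + l + real (Suc m)) = (1 + l + real m) * Gamma (1 + l + real m)"
    proof -
      have "1 + l + real m \<notin> \<int>\<^sub>\<le>\<^sub>0" using pos nonpos_Ints_nonpos[of "1 + l + real m"] by linarith
      from Gamma_plus1[OF this] show ?thesis by (simp add: add_ac)
    qed
    have "I m = - 2 * \<i> * I (Suc m) / of_real (1 + l + real m)"
      using step(2)[of m] pos by (simp add: field_simps del: of_real_add)
    hence "I 0 = (- 2 * \<i>) ^ m * of_real (Gamma (1 + l)) / of_real (Gamma (1 + l + real m)) * (- 2 * \<i> * I (Suc m) / of_real (1 + l + real m))"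
      using Suc by simp
    thus ?case unfolding G by (simp add: mult_ac del: of_real_add)
  qed
  \<comment> \<open>The convergence required for order 0 is itself part of what
    \<open>order_raising_step\<close> delivers.\<close>
  have fz: "f z = of_real (c_const CARD('n) l) * I 0"
  proof -
    have "set_integrable lborel siegel (\<lambda>w. of_real (rho w powr l) * (f w * H w))"
      using step(1)[of 0] by (simp only: F0 of_nat_0 add_0_right)
    hence "f z = of_real (c_const CARD('n) l) * (LINT w:siegel|lborel. of_real (rho w powr l) * (f w * H w))"
      unfolding H_def by (rule modified_reproducing[OF l z f(1) gf f(2) less_imp_le[OF \<delta>(1)] \<delta>(2,3)])
    thus ?thesis by (simp only: I_def F0 of_nat_0 add_0_right)
  qed
  \<comment> \<open>Inside the half-space the bases have positive real part, so the principal power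
    commutes with conjugation.\<close>
  have km: "kern_mod l z w = H w" if "w \<in> siegel" for w
    by (simp add: kern_mod_def H_def kern_eq_cnj_kpow[OF _ that] z base_pt_siegel)
  let ?g = "\<lambda>w. kern_mod l z w * (complex_of_real (rho w ^ N) * F N w)"
  have cg: "continuous_on siegel ?g"
  proof -
    have "continuous_on siegel (\<lambda>w. H w * (complex_of_real (rho w ^ N) * F N w))"
      unfolding H_def by (intro continuous_intros holo_continuous_on[OF F(1)] holo_continuous_on[OF holo_on_kpow] z base_pt_siegel)
    thus ?thesis by (rule continuous_on_eq) (simp add: km)
  qed
  have eq: "of_real (rho w powr l) * ?g w = of_real (rho w powr (l + real N)) * (F N w * H w)" if w: "w \<in> siegel" for w
    using siegelD(1)[OF w] by (simp add: km[OF w] powr_add powr_realpow mult_ac)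
  have "set_integrable lborel siegel (\<lambda>w. of_real (rho w powr l) * ?g w)"
    by (subst set_integrable_cong[OF refl refl eq]) (auto intro: step(1))
  hence conv: "integrable (dV l) ?g" using dV_integral(1)[OF l cg] by simp
  have "(LINT w|dV l. ?g w) = of_real (c_const CARD('n) l) * I N"
  proof -
    have "(LINT w:siegel|lborel. of_real (rho w powr l) * ?g w) = I N"
      unfolding I_def by (rule set_lebesgue_integral_cong, simp, intro allI impI, rule eq)
    thus ?thesis by (simp only: dV_integral(2)[OF l cg])
  qed
  hence "f z = (-2 * \<i>) ^ N * complex_of_real (Gamma (1 + l)) / complex_of_real (Gamma (1 + l + real N)) * (LINT w|dV l. ?g w)"
    unfolding fz I0[of N] by (simp only: mult_ac times_divide_eq_left times_divide_eq_right)
  thus ?thesis using conv by (simp only: P_mod_converges_def P_mod_def F_def)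
qed

end
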